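(* For any real $\gamma$ with $|\gamma|\le 2-\alpha$, as $n\to\infty$, $$f^0(n)\sim \frac{\kappa_{\alpha,\gamma}\,c_\circ^{1/\alpha}}{n^{2-1/\alpha}},\qquad \kappa_{\alpha,\gamma}=\frac{(\alpha-1)\sin\frac{\pi}{\alpha}}{\Gamma(\frac1\alpha)\,\sin\frac{\pi(\alpha-\gamma)}{2\alpha}} .$$
   Context: Let $1<\alpha<2$. $S_n=X_1+\cdots+X_n$, $S_0=0$, is a random walk on $\mathbb Z$ with i.i.d. integer-valued increments distributed as $X$. Standing assumptions: (1) $\phi(\theta):=E e^{i\theta X}$ satisfies $\lim_{\theta\to\pm0}\frac{1-\phi(\theta)}{|\theta|^\alpha}=c_\circ e^{\pm i\pi\gamma/2}$ for some real $c_\circ>0$ and real $\gamma$ with $|\gamma|\le 2-\alpha$ (this entails $EX=0$); (2) strong aperiodicity: for every $x\in\mathbb Z$, $P[S_n=x]>0$ for all sufficiently large $n$. For $x\in\mathbb Z$, $S^x_n=x+S_n$, and $f^x(n)=P[\inf\{k\ge1:S^x_k=0\}=n]$; in particular $f^0(n)$ is the probability that the walk started at $0$ returns to $0$ for the first time at time $n$. $\sim$ means that the ratio tends to $1$. *)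

theory Defs
  imports "HOL-Probability.Probability" "HOL-Library.Landau_Symbols"
begin

definition walk :: "(nat \<Rightarrow> 'a \<Rightarrow> int) \<Rightarrow> int \<Rightarrow> nat \<Rightarrow> 'a \<Rightarrow> int" where
  "walk X x n \<omega> = x + (\<Sum>k=1..n. X k \<omega>)"

(* Valued in enat: the infimum of the empty set is \<infinity> there, whereas on nat it is 0. *)
definition hit_time :: "(nat \<Rightarrow> 'a \<Rightarrow> int) \<Rightarrow> int \<Rightarrow> 'a \<Rightarrow> enat" where
  "hit_time X x \<omega> = Inf {enat k | k. k \<ge> 1 \<and> walk X x k \<omega> = 0}"

definition hit_prob :: "'a measure \<Rightarrow> (nat \<Rightarrow> 'a \<Rightarrow> int) \<Rightarrow> int \<Rightarrow> nat \<Rightarrow> real" where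
  "hit_prob M X x n = measure M {\<omega> \<in> space M. hit_time X x \<omega> = enat n}"

definition kappa :: "real \<Rightarrow> real \<Rightarrow> real" where
  "kappa \<alpha> \<gamma> =
     (\<alpha> - 1) * sin (pi / \<alpha>) / (Gamma (1 / \<alpha>) * sin (pi * (\<alpha> - \<gamma>) / (2 * \<alpha>)))"

end

theory Submission
  imports Defs "HOL-Real_Asymp.Real_Asymp"
begin

text \<open>
  Let \<open>U\<close> be the generating function of \<open>P[S\<^sub>n = 0]\<close> and \<open>F\<close> that of \<open>f\<^sup>0\<close>, so that \<open>F = 1 - 1/U\<close>.
  Fourier inversion gives \<open>2 \<pi> U(z) = \<integral> d\<theta> / (1 - z \<phi>(\<theta>))\<close> over \<open>[-\<pi>, \<pi>]\<close>.  Since \<open>1 - |\<phi>(\<theta>)|\<close> is at least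
  a multiple of \<open>|\<theta>|\<^sup>\<alpha>\<close> while \<open>|1 - \<phi>(\<theta>)|\<close> is at most another such multiple, \<open>|1 - z \<phi>(\<theta>)|\<close> is comparable to \<open>|1 - z| + |\<theta>|\<^sup>\<alpha>\<close> on the
  whole disc.  Scaling turns this into \<open>|F''(z)| \<le> C |1 - z|\<close> to the power \<open>-(1 + 1/\<alpha>)\<close>, together with the limit of
  \<open>F''(z) (1 - z)\<close> to the power \<open>1 + 1/\<alpha>\<close>.  As the exponent \<open>1 + 1/\<alpha>\<close> exceeds \<open>1\<close>, Cauchy's formula on the circle of
  radius \<open>1 - 1/n\<close> and dominated convergence give the coefficients of \<open>F''\<close>, that is, \<open>n (n - 1) f\<^sup>0(n)\<close>;
  the singularity of \<open>F\<close> itself is too weak for this argument, whence the two derivatives.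
\<close>

section \<open>Coefficients of power series with a power singularity at 1\<close>

text \<open>The lower bound on 1 - |\<phi>| has two sources: near 0 the condition |\<gamma>| \<le> 2
  - \<alpha> < 1, which puts both one-sided limits of (1 - \<phi>)/|\<theta>|^\<alpha> in the open
  right half plane, and elsewhere strong aperiodicity with compactness. As F'' has powers of U in
  its denominators, |U| must also be bounded below, by a multiple of |1 - z|^(1/\<alpha> - 1); this
  comes from Re (1/(1 - z \<phi>)) \<ge> 0. A single derivative would leave the exponent 1/\<alpha>
  < 1, whose majorant on the rescaled circle is not integrable. The constant comes from the integral
  of 1/(\<mu> + W x^\<alpha>) over a half line. Homogeneity in the complex parameters \<mu> and W
  reduces it to a Beta integral at \<mu> = W = 1. The two sides of 0 contribute W^(-1/\<alpha>) and
  its conjugate, hence the cosine of \<pi> \<gamma>/(2 \<alpha>), which is the sine in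
  \<open>kappa\<close>.\<close>

lemma integrable_one_plus_abs_powr:
  fixes \<delta> :: real
  assumes "\<delta> > 1"
  shows "integrable lborel (\<lambda>x::real. (1 + \<bar>x\<bar>) powr (-\<delta>))"
proof -
  let ?f = "\<lambda>x::real. (1 + x) powr (-\<delta>)"
  have lim: "((\<lambda>x::real. (1 + x) powr (1-\<delta>) / (1-\<delta>)) \<longlongrightarrow> 0) at_top"
  proof -
    have "filterlim (\<lambda>x::real. 1 + x) at_top at_top"
      by (rule filterlim_tendsto_add_at_top[OF tendsto_const filterlim_ident])
    then have "((\<lambda>x::real. (1 + x) powr (1-\<delta>)) \<longlongrightarrow> 0) at_top"
      using assms by (intro tendsto_neg_powr) auto
    from tendsto_divide[OF this tendsto_const[of "1-\<delta>"]] show ?thesis using assms by simp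
  qed
  have nn: "(\<integral>\<^sup>+x. ennreal (?f x) * indicator {0..} x \<partial>lborel) = 0 - (1 + 0) powr (1-\<delta>) / (1-\<delta>)"
  proof (rule nn_integral_FTC_atLeast[OF _ _ _ lim])
    fix x :: real assume "0 \<le> x"
    then show "((\<lambda>x. (1 + x) powr (1-\<delta>) / (1-\<delta>)) has_real_derivative ?f x) (at x)"
      using assms by (auto intro!: derivative_eq_intros)
  qed auto
  have half: "integrable lborel (\<lambda>x. indicator {0..} x *\<^sub>R ?f x)"
  proof (rule integrableI_nonneg)
    have "(\<integral>\<^sup>+x. ennreal (indicator {0..} x *\<^sub>R ?f x) \<partial>lborel)
        = (\<integral>\<^sup>+x. ennreal (?f x) * indicator {0..} x \<partial>lborel)"
      by (intro nn_integral_cong) (auto split: split_indicator)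
    also have "\<dots> < \<infinity>" unfolding nn by simp
    finally show "(\<integral>\<^sup>+x. ennreal (indicator {0..} x *\<^sub>R ?f x) \<partial>lborel) < \<infinity>" .
  qed auto
  have half': "integrable lborel (\<lambda>x. indicator {0..} (0 + (-1) * x) *\<^sub>R ?f (0 + (-1) * x))"
    by (rule lborel_integrable_real_affine[OF half]) auto
  show ?thesis
    by (rule Bochner_Integration.integrable_bound[OF Bochner_Integration.integrable_add[OF half half']])
       (auto split: split_indicator)
qed

section \<open>Orthogonality of characters and Cauchy's coefficient formula\<close>

lemma borel_measurable_cis [measurable]: "cis \<in> borel_measurable borel"
  by (intro borel_measurable_continuous_onI continuous_intros)

lemma cis_has_vector_derivative:
  "((\<lambda>t. cis (a * t)) has_vector_derivative \<i> * of_real a * cis (a * t)) (at t within S)"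
proof -
  have "((\<lambda>z. exp (\<i> * of_real a * z)) has_field_derivative \<i> * of_real a * exp (\<i> * of_real a * of_real t)) (at (of_real t))"
    by (auto intro!: derivative_eq_intros)
  from has_vector_derivative_real_field[OF this] show ?thesis
    by (simp add: cis_conv_exp mult.assoc)
qed

text \<open>Orthogonality on the circle; it serves both to extract coefficients of power series and
  to invert the law of an integer-valued variable.\<close>

lemma integral_cis_int:
  fixes k :: int
  shows "(\<integral>t. indicator {-pi..pi} t *\<^sub>R cis (of_int k * t) \<partial>lborel) = (if k = 0 then 2 * pi else 0)"
proof (cases "k = 0")
  case True
  have "(\<integral>t. indicator {-pi..pi} t *\<^sub>R (1::complex) \<partial>lborel) = complex_of_real (2 * pi)"
    by (simp add: scaleR_conv_of_real)
  with True show ?thesis by simp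
next
  case False
  let ?F = "\<lambda>t. cis (of_int k * t) / (\<i> * of_int k)"
  have "(\<integral>t. indicator {-pi..pi} t *\<^sub>R cis (of_int k * t) \<partial>lborel) = ?F pi - ?F (-pi)"
  proof (rule integral_FTC_Icc)
    fix x :: real
    show "(?F has_vector_derivative cis (of_int k * x)) (at x within {-pi..pi})"
      using has_vector_derivative_divide[OF cis_has_vector_derivative[of "of_int k" x], of "\<i> * of_int k"] False
      by simp
  next
    show "continuous_on {-pi..pi} (\<lambda>x. cis (of_int k * x))"
      by (intro continuous_intros)
  qed auto
  also have "cis (of_int k * pi) = cis (of_int k * (-pi))"
    by (simp add: complex_eq_iff mult.commute[of _ pi])
  finally show ?thesis using False by simp
qed

text \<open>Cauchy's formula in Fourier form. The series converges at a radius R > r, hence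
  absolutely and summably on the circle of radius r, so it may be integrated term by term, and
  orthogonality leaves only the n-th term.\<close>

lemma power_series_coeff_integral:
  fixes h :: "nat \<Rightarrow> complex"
  assumes sums: "\<And>z. norm z < 1 \<Longrightarrow> (\<lambda>n. h n * z ^ n) sums H z"
  assumes r: "0 \<le> r" "r < 1"
  shows "(\<integral>t. indicator {-pi..pi} t *\<^sub>R (H (of_real r * cis t) * cis (- (real n * t))) \<partial>lborel)
          = 2 * pi * h n * of_real r ^ n"
proof -
  define R where "R = (1 + r) / 2"
  have R: "r \<le> R" "r < R" "R < 1" "0 < R" using r by (auto simp: R_def)
  have "summable (\<lambda>n. h n * of_real R ^ n)"
    using sums[of "of_real R"] R by (auto simp: sums_iff)
  then have abs: "summable (\<lambda>n. norm (h n * of_real r ^ n))"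
    by (rule powser_insidea) (use r R in auto)
  let ?g = "\<lambda>m t. indicator {-pi..pi} t *\<^sub>R (h m * of_real r ^ m * cis (of_int (int m - int n) * t))"
  have norm_g: "norm (?g m t) = indicator {-pi..pi} t * norm (h m * of_real r ^ m)" for m t
    by (auto simp: norm_mult split: split_indicator)
  have int_g: "integrable lborel (?g m)" for m
    by (rule Bochner_Integration.integrable_bound[of _ "\<lambda>t. indicator {-pi..pi} t *\<^sub>R norm (h m * of_real r ^ m)"])
       (auto simp: norm_g simp del: norm_scaleR of_int_diff of_int_of_nat_eq)
  have "(\<lambda>m. integral\<^sup>L lborel (?g m)) sums (\<integral>t. (\<Sum>m. ?g m t) \<partial>lborel)"
  proof (rule sums_integral[OF int_g])
    show "AE t in lborel. summable (\<lambda>m. norm (?g m t))"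
      unfolding norm_g by (intro AE_I2 summable_mult abs)
    have "(\<integral>t. norm (?g m t) \<partial>lborel) = 2 * pi * norm (h m * of_real r ^ m)" for m
      unfolding norm_g by simp
    then show "summable (\<lambda>m. \<integral>t. norm (?g m t) \<partial>lborel)"
      using summable_mult[OF abs, of "2*pi"] by simp
  qed
  moreover have "integral\<^sup>L lborel (?g m) = (if m = n then 2 * pi * h n * of_real r ^ n else 0)" for m
  proof -
    have "integral\<^sup>L lborel (?g m) = (\<integral>t. (h m * of_real r ^ m) * (indicator {-pi..pi} t *\<^sub>R cis (of_int (int m - int n) * t)) \<partial>lborel)"
      by (intro Bochner_Integration.integral_cong) auto
    also have "\<dots> = (h m * of_real r ^ m) * (\<integral>t. indicator {-pi..pi} t *\<^sub>R cis (of_int (int m - int n) * t) \<partial>lborel)"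
      by (rule integral_mult_right_zero)
    finally show ?thesis by (subst (asm) integral_cis_int) auto
  qed
  ultimately have s: "(\<lambda>m. if m = n then 2 * pi * h n * of_real r ^ n else 0) sums (\<integral>t. (\<Sum>m. ?g m t) \<partial>lborel)"
    by simp
  have "(\<integral>t. (\<Sum>m. ?g m t) \<partial>lborel) = 2 * pi * h n * of_real r ^ n"
    using sums_unique2[OF s sums_single[of n "\<lambda>_. 2 * pi * h n * of_real r ^ n"]] by simp
  moreover have "(\<Sum>m. ?g m t) = indicator {-pi..pi} t *\<^sub>R (H (of_real r * cis t) * cis (- (real n * t)))" for t
  proof -
    have "(\<lambda>m. indicator {-pi..pi} t *\<^sub>R (h m * (of_real r * cis t) ^ m * cis (- (real n * t)))) sums
      (indicator {-pi..pi} t *\<^sub>R (H (of_real r * cis t) * cis (- (real n * t))))"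
      by (intro sums_scaleR_right sums_mult2 sums) (use r in \<open>auto simp: norm_mult\<close>)
    moreover have "h m * (of_real r * cis t) ^ m * cis (- (real n * t)) = h m * of_real r ^ m * cis (of_int (int m - int n) * t)" for m
    proof -
      have "cis t ^ m * cis (- (real n * t)) = cis (of_int (int m - int n) * t)"
        unfolding Complex.DeMoivre cis_mult by (rule arg_cong[where f = cis]) (simp add: algebra_simps)
      then show ?thesis by (simp add: power_mult_distrib mult.assoc)
    qed
    ultimately show ?thesis by (simp add: sums_iff)
  qed
  ultimately show ?thesis by simp
qed

section \<open>Geometry of the circles of radius 1 - 1/n near the point 1\<close>

lemma sin_ge_half:
  fixes x :: real
  assumes "0 \<le> x" "x \<le> pi / 2"
  shows "x / 2 \<le> sin x"
proof -
  have "\<bar>sin x - (\<Sum>m<3. sin_coeff m * x ^ m)\<bar> \<le> inverse (fact 3) * \<bar>x\<bar> ^ 3"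
    by (rule Maclaurin_sin_bound)
  then have "\<bar>sin x - x\<bar> \<le> x ^ 3 / 6"
    using assms by (simp add: numeral_3_eq_3 sin_coeff_def fact_numeral field_simps)
  \<comment> \<open>As \<pi>/2 \<le> 8/5, the square of x is at most 3, so the cubic Maclaurin
    remainder costs at most x/2.\<close>
  moreover have "x ^ 3 \<le> 3 * x"
  proof -
    have "x \<le> 8/5" using assms pi_approx by simp
    then have "x * x \<le> (8/5) * (8/5)" using assms by (intro mult_mono) auto
    then have "x * x \<le> 3" by simp
    from mult_right_mono[OF this \<open>0 \<le> x\<close>] show ?thesis by (simp add: power3_eq_cube)
  qed
  ultimately show ?thesis by linarith
qed

text \<open>The squared distance equals (1 - r)^2 + 2 r (1 - cos t). Here 2 r \<ge> 1, and 1 - cos t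
  = 2 sin^2 (t/2) \<ge> t^2/8.\<close>

lemma cmod_one_minus_rcis_ge:
  fixes r t :: real
  assumes "1 / 2 \<le> r" "r \<le> 1" "\<bar>t\<bar> \<le> pi"
  shows "(1 - r)\<^sup>2 + t\<^sup>2 / 8 \<le> (cmod (1 - of_real r * cis t))\<^sup>2"
proof -
  have "\<bar>t\<bar> / 4 \<le> sin (\<bar>t\<bar> / 2)" using sin_ge_half[of "\<bar>t\<bar>/2"] assms by simp
  then have "(\<bar>t\<bar> / 4)\<^sup>2 \<le> (sin (\<bar>t\<bar> / 2))\<^sup>2" by (intro power_mono) auto
  moreover have "cos t = 1 - 2 * (sin (\<bar>t\<bar> / 2))\<^sup>2"
    using cos_double_sin[of "\<bar>t\<bar> / 2"] by simp
  ultimately have c: "t\<^sup>2 / 8 \<le> 1 - cos t" by (simp add: power_divide)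
  have "1 * (1 - cos t) \<le> (2 * r) * (1 - cos t)" using assms by (intro mult_right_mono) auto
  moreover have "(cmod (1 - of_real r * cis t))\<^sup>2 = (1 - r)\<^sup>2 + 2 * r * (1 - cos t)"
  proof -
    have "(cmod (1 - of_real r * cis t))\<^sup>2 = (1 - r * cos t)\<^sup>2 + (r * sin t)\<^sup>2"
      by (simp add: cmod_power2)
    also have "\<dots> = 1 - 2 * r * cos t + r\<^sup>2 * ((sin t)\<^sup>2 + (cos t)\<^sup>2)"
      by (simp only: power2_eq_square) algebra
    finally show ?thesis by (simp only: sin_cos_squared_add) (simp add: power2_eq_square algebra_simps)
  qed
  ultimately show ?thesis using c by simp
qed

text \<open>The integration circle in the scale of its singularity: in the variable s the distance
  to 1 is of order (1 + |s|)/n. For n = 0 division by zero gives the point 1 and for n = 1 the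
  radius is 0, so the estimates start at n \<ge> 2.\<close>

definition circ :: "nat \<Rightarrow> real \<Rightarrow> complex" where
  "circ n s = of_real (1 - 1 / real n) * cis (s / real n)"

lemma norm_circ_less_1: "n \<ge> 1 \<Longrightarrow> norm (circ n s) < 1"
  by (auto simp: circ_def norm_mult simp del: of_real_diff of_real_divide)

text \<open>The assumptions keep the radius above 1/2 and the angle in [-\<pi>, \<pi>]. The squared
  distance estimate then becomes linear through (1 + |s|)^2 \<le> 2 + 2 s^2.\<close>

lemma circ_bound:
  assumes "n \<ge> 2" "\<bar>s\<bar> \<le> pi * real n"
  shows "(1 + \<bar>s\<bar>) / 4 \<le> real n * norm (1 - circ n s)"
proof -
  have n: "real n \<ge> 2" using assms by simp
  have "(1 - (1 - 1 / real n))\<^sup>2 + (s / real n)\<^sup>2 / 8 \<le> (norm (1 - circ n s))\<^sup>2"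
    unfolding circ_def using assms n
    by (intro cmod_one_minus_rcis_ge) (auto simp: field_simps abs_divide)
  from mult_left_mono[OF this, of "(real n)\<^sup>2"]
  have "1 + s\<^sup>2 / 8 \<le> (real n * norm (1 - circ n s))\<^sup>2"
    using n by (simp add: power_mult_distrib power_divide distrib_left)
  moreover have "((1 + \<bar>s\<bar>) / 4)\<^sup>2 \<le> 1 + s\<^sup>2 / 8"
  proof -
    have "0 \<le> (1 - \<bar>s\<bar>)\<^sup>2" by simp
    then have "(1 + \<bar>s\<bar>)\<^sup>2 \<le> 2 + 2 * s\<^sup>2" by (simp add: power2_eq_square algebra_simps)
    then show ?thesis by (simp add: power_divide)
  qed
  ultimately have "((1 + \<bar>s\<bar>) / 4)\<^sup>2 \<le> (real n * norm (1 - circ n s))\<^sup>2" by linarith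
  then show ?thesis by (rule power2_le_imp_le) auto
qed

text \<open>With e = cis (s/n) the expression is e - n (e - 1), so the limit is a derivative of the
  exponential at 0.\<close>

lemma tendsto_circ: "(\<lambda>n. of_nat n * (1 - circ n s)) \<longlonglongrightarrow> 1 - \<i> * of_real s"
proof -
  have "((\<lambda>z. exp (\<i> * of_real s * z)) has_field_derivative \<i> * of_real s) (at 0)"
    by (auto intro!: derivative_eq_intros)
  then have d: "((\<lambda>h. (exp (\<i> * of_real s * h) - 1) / h) \<longlongrightarrow> \<i> * of_real s) (at 0)"
    by (simp add: DERIV_def)
  have "filterlim (\<lambda>n. complex_of_real (1 / real n)) (at 0) sequentially"
    unfolding filterlim_at
    using tendsto_of_real[OF lim_const_over_n[of 1], where ?'a = complex] eventually_gt_at_top[of 0]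
    by (auto elim!: eventually_mono)
  from filterlim_compose[OF d this]
  have "(\<lambda>n. (cis (s * (1 / real n)) - 1) / of_real (1 / real n)) \<longlonglongrightarrow> \<i> * of_real s"
    by (simp add: cis_conv_exp mult.assoc)
  moreover have "(\<lambda>n. cis (s / real n)) \<longlonglongrightarrow> cis 0"
    by (intro tendsto_intros lim_const_over_n)
  ultimately have "(\<lambda>n. cis (s / real n) - (cis (s * (1 / real n)) - 1) / of_real (1 / real n)) \<longlonglongrightarrow> 1 - \<i> * of_real s"
    by (auto intro!: tendsto_diff)
  then show ?thesis
    by (rule Lim_transform_eventually)
       (use eventually_gt_at_top[of 0] in eventually_elim, auto simp: circ_def field_simps)
qed

text \<open>Substituting t = s/n in Cauchy's formula produces n^(\<delta> - 1) times an integral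
  whose integrand is at most a multiple of (1 + |s|)^(-\<delta>). This majorant is integrable
  because \<delta> > 1, so the pointwise limit 0 passes to the coefficients.\<close>

lemma coeff_tendsto_zero:
  fixes h :: "nat \<Rightarrow> complex"
  assumes sums: "\<And>z. norm z < 1 \<Longrightarrow> (\<lambda>n. h n * z ^ n) sums H z"
  assumes \<delta>: "\<delta> > 1"
  assumes bound: "\<And>z. norm z < 1 \<Longrightarrow> norm (H z) \<le> C * norm (1 - z) powr (-\<delta>)"
  assumes lim: "\<And>s. (\<lambda>n. H (circ n s) / of_real (real n powr \<delta>)) \<longlonglongrightarrow> 0"
  shows "(\<lambda>n. h n / of_real (real n powr (\<delta> - 1))) \<longlonglongrightarrow> 0"
proof -
  let ?f = "\<lambda>n s. indicator {-pi..pi} (s / real n) *\<^sub>R (H (circ n s) / of_real (real n powr \<delta>) * cis (-s))"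
  have C: "C \<ge> 0" using bound[of 0] norm_ge_zero[of "H 0"] by (simp del: norm_ge_zero)
  \<comment> \<open>\<open>H\<close> is known only as the sum of its series, and only in the open
    disc; measurability is taken from the series.\<close>
  have meas: "(\<lambda>t. H (of_real r * cis t)) \<in> borel_measurable borel" if "0 \<le> r" "r < 1" for r
  proof -
    have "(\<lambda>t. \<Sum>n. h n * (of_real r * cis t) ^ n) \<in> borel_measurable borel"
      by measurable
    also have "(\<lambda>t. \<Sum>n. h n * (of_real r * cis t) ^ n) = (\<lambda>t. H (of_real r * cis t))"
      by (intro ext sums_unique[symmetric] sums) (use that in \<open>auto simp: norm_mult\<close>)
    finally show ?thesis .
  qed
  \<comment> \<open>The shift by 2 makes the majorant valid for every index, since
    \<open>circ_bound\<close> needs n \<ge> 2; it is undone right afterwards.\<close>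
  have "(\<lambda>n. \<integral>s. ?f (n + 2) s \<partial>lborel) \<longlonglongrightarrow> (\<integral>s. 0 \<partial>(lborel::real measure))"
  proof (rule integral_dominated_convergence)
    show "integrable lborel (\<lambda>s::real. C * 4 powr \<delta> * (1 + \<bar>s\<bar>) powr (-\<delta>))"
      using integrable_one_plus_abs_powr[OF \<delta>] by simp
    show "?f (n + 2) \<in> borel_measurable lborel" for n
    proof -
      have "(\<lambda>s. H (of_real (1 - 1 / real (n+2)) * cis (s / real (n+2)))) \<in> borel_measurable borel"
        by (rule measurable_compose[OF _ meas]) auto
      then show ?thesis unfolding circ_def by measurable
    qed
    have "(\<lambda>n. ?f n s) \<longlonglongrightarrow> 0" for s
    proof (rule Lim_null_comparison)
      show "\<forall>\<^sub>F n in sequentially. norm (?f n s) \<le> norm (H (circ n s) / of_real (real n powr \<delta>))"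
        by (auto simp: norm_mult norm_divide split: split_indicator)
      show "(\<lambda>n. norm (H (circ n s) / of_real (real n powr \<delta>))) \<longlonglongrightarrow> 0"
        by (rule tendsto_norm_zero[OF lim])
    qed
    then show "AE s in lborel. (\<lambda>n. ?f (n + 2) s) \<longlonglongrightarrow> 0"
      by (intro AE_I2 LIMSEQ_ignore_initial_segment)
    have "norm (?f m s) \<le> C * 4 powr \<delta> * (1 + \<bar>s\<bar>) powr (-\<delta>)" if "m \<ge> 2" for m s
    proof (cases "s / real m \<in> {-pi..pi}")
      case True
      have m: "real m \<ge> 2" using that by simp
      have "\<bar>s\<bar> \<le> pi * real m" using True m by (auto simp: field_simps)
      from circ_bound[OF that this] have b: "(1 + \<bar>s\<bar>) / 4 \<le> real m * norm (1 - circ m s)" .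
      have "norm (?f m s) = norm (H (circ m s)) / real m powr \<delta>"
        using True by (simp add: norm_mult norm_divide)
      also have "\<dots> \<le> C * norm (1 - circ m s) powr (-\<delta>) / real m powr \<delta>"
        by (intro divide_right_mono bound norm_circ_less_1) (use that in auto)
      also have "\<dots> = C * (real m * norm (1 - circ m s)) powr (-\<delta>)"
        by (simp add: powr_mult powr_minus divide_inverse mult_ac)
      also have "\<dots> \<le> C * ((1 + \<bar>s\<bar>) / 4) powr (-\<delta>)"
        using b \<delta> C by (intro mult_left_mono powr_mono2') auto
      also have "\<dots> = C * 4 powr \<delta> * (1 + \<bar>s\<bar>) powr (-\<delta>)"
        by (simp add: powr_divide powr_minus field_simps)
      finally show ?thesis .
    qed (use C in simp)
    then show "AE s in lborel. norm (?f (n + 2) s) \<le> C * 4 powr \<delta> * (1 + \<bar>s\<bar>) powr (-\<delta>)" for n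
      by (intro AE_I2) (metis le_add2)
  qed simp
  then have lim0: "(\<lambda>n. \<integral>s. ?f n s \<partial>lborel) \<longlonglongrightarrow> 0"
    using LIMSEQ_offset[of "\<lambda>n. \<integral>s. ?f n s \<partial>lborel" 2] by simp
  have eq: "(\<integral>s. ?f n s \<partial>lborel) = 2 * pi * (h n / of_real (real n powr (\<delta> - 1))) * of_real ((1 - 1 / real n) ^ n)"
    if n: "n > 0" for n
  proof -
    let ?r = "1 - 1 / real n"
    let ?g = "\<lambda>t. indicator {-pi..pi} t *\<^sub>R (H (of_real ?r * cis t) * cis (- (real n * t)))"
    have "2 * pi * h n * of_real ?r ^ n = (\<integral>t. ?g t \<partial>lborel)"
      by (rule power_series_coeff_integral[OF sums, symmetric]) (use n in auto)
    also have "\<dots> = \<bar>1 / real n\<bar> *\<^sub>R (\<integral>s. ?g (0 + (1 / real n) * s) \<partial>lborel)"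
      by (rule lborel_integral_real_affine) (use n in auto)
    also have "(\<lambda>s. ?g (0 + (1 / real n) * s)) = (\<lambda>s. of_real (real n powr \<delta>) * ?f n s)"
      using n by (auto simp: fun_eq_iff circ_def)
    also have "(\<integral>s. of_real (real n powr \<delta>) * ?f n s \<partial>lborel) = of_real (real n powr \<delta>) * (\<integral>s. ?f n s \<partial>lborel)"
      by (rule integral_mult_right_zero)
    finally have e: "2 * pi * h n * of_real ?r ^ n
        = \<bar>1 / real n\<bar> *\<^sub>R (of_real (real n powr \<delta>) * (\<integral>s. ?f n s \<partial>lborel))" .
    have "\<bar>1 / real n\<bar> *\<^sub>R (of_real (real n powr \<delta>) * J) = of_real (real n powr (\<delta> - 1)) * J" for J :: complex
      using n by (simp add: scaleR_conv_of_real powr_diff)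
    with e have "2 * pi * h n * of_real ?r ^ n = of_real (real n powr (\<delta> - 1)) * (\<integral>s. ?f n s \<partial>lborel)"
      by (simp only:)
    moreover have "J = 2 * pi * (h n / P) * of_real (?r ^ n)"
      if "2 * pi * h n * of_real ?r ^ n = P * J" "P \<noteq> 0" for J P :: complex
      using that unfolding of_real_power by (metis nonzero_mult_div_cancel_left times_divide_eq_left times_divide_eq_right)
    ultimately show ?thesis using n by simp
  qed
  \<comment> \<open>The factor (1 - 1/n)^n left over from the radius tends to 1/e, so dividing by it
    preserves the limit 0.\<close>
  have "(\<lambda>n. (1 + (-1) / real n) ^ n) \<longlonglongrightarrow> exp (-1)" by (rule tendsto_exp_limit_sequentially)
  then have e: "(\<lambda>n. complex_of_real (2 * pi) * of_real ((1 - 1 / real n) ^ n)) \<longlonglongrightarrow> complex_of_real (2 * pi) * of_real (exp (-1))"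
    by (intro tendsto_intros) simp
  have "(\<lambda>n. (\<integral>s. ?f n s \<partial>lborel) / (complex_of_real (2 * pi) * of_real ((1 - 1 / real n) ^ n))) \<longlonglongrightarrow> 0 / (complex_of_real (2 * pi) * of_real (exp (-1)))"
    by (rule tendsto_divide[OF lim0 e]) auto
  then show ?thesis
  proof (rule Lim_transform_eventually[OF tendsto_eq_rhs])
    show "\<forall>\<^sub>F n in sequentially. (\<integral>s. ?f n s \<partial>lborel) / (complex_of_real (2 * pi) * of_real ((1 - 1 / real n) ^ n)) = h n / of_real (real n powr (\<delta> - 1))"
      using eventually_gt_at_top[of 1] by eventually_elim (subst eq, auto)
  qed simp
qed

text \<open>The function A (1 - z)^(-\<delta>) has the same rescaled limit and obeys a bound of the
  same form, so the difference is covered by the case of limit 0. The asymptotics then come from the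
  binomial coefficients of the comparison function.\<close>

lemma coeff_asymptotics:
  fixes h :: "nat \<Rightarrow> complex"
  assumes sums: "\<And>z. norm z < 1 \<Longrightarrow> (\<lambda>n. h n * z ^ n) sums H z"
  assumes \<delta>: "\<delta> > 1"
  assumes bound: "\<And>z. norm z < 1 \<Longrightarrow> norm (H z) \<le> C * norm (1 - z) powr (-\<delta>)"
  assumes lim: "\<And>s. (\<lambda>n. H (circ n s) / of_real (real n powr \<delta>)) \<longlonglongrightarrow> A * (1 - \<i> * of_real s) powr (- of_real \<delta>)"
  shows "(\<lambda>n. h n / of_real (real n powr (\<delta> - 1))) \<longlonglongrightarrow> A / of_real (Gamma \<delta>)"
proof -
  \<comment> \<open>Coefficients of (1 - z)^(-\<delta>) by the generalised binomial theorem; they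
    grow like n^(\<delta> - 1) / Gamma \<delta>.\<close>
  define b where "b = (\<lambda>n. (- complex_of_real \<delta> gchoose n) * (-1) ^ n)"
  have norm_powr: "norm ((1 - z) powr (- complex_of_real \<delta>)) = norm (1 - z) powr (-\<delta>)" if "norm z < 1" for z
    using that by (cases "z = 1") (auto simp: powr_def norm_exp_eq_Re)
  have sums_b: "(\<lambda>n. b n * z ^ n) sums (1 - z) powr (- of_real \<delta>)" if "norm z < 1" for z
    using gen_binomial_complex[of "-z" "- of_real \<delta>"] that
    by (simp add: b_def power_minus[of z] mult_ac)
  have lim_b: "(\<lambda>n. b n / of_real (real n powr (\<delta> - 1))) \<longlonglongrightarrow> 1 / of_real (Gamma \<delta>)"
  proof -
    have "(\<lambda>n. (- complex_of_real \<delta> gchoose n) / ((-1)^n / exp ((- of_real \<delta>+1) * of_real (ln (real n))))) \<longlonglongrightarrow> inverse (Gamma (- (- of_real \<delta>)))"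
      by (rule gbinomial_asymptotic)
    moreover have "inverse (Gamma (- (- complex_of_real \<delta>))) = 1 / of_real (Gamma \<delta>)"
      by (simp add: Gamma_complex_of_real divide_inverse)
    ultimately have *: "(\<lambda>n. (- complex_of_real \<delta> gchoose n) / ((-1)^n / exp ((- of_real \<delta>+1) * of_real (ln (real n))))) \<longlonglongrightarrow> 1 / of_real (Gamma \<delta>)" by simp
    show ?thesis
    proof (rule Lim_transform_eventually[OF *])
      show "\<forall>\<^sub>F n in sequentially. (- complex_of_real \<delta> gchoose n) / ((-1)^n / exp ((- of_real \<delta>+1) * of_real (ln (real n)))) = b n / of_real (real n powr (\<delta> - 1))"
        using eventually_gt_at_top[of 0]
      proof eventually_elim
        case (elim n)
        have "exp ((- of_real \<delta>+1) * complex_of_real (ln (real n))) = of_real (exp ((1 - \<delta>) * ln (real n)))"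
          by (simp add: exp_of_real[symmetric])
        also have "exp ((1 - \<delta>) * ln (real n)) = inverse (real n powr (\<delta> - 1))"
          using elim by (simp add: powr_def exp_minus[symmetric] algebra_simps)
        finally show ?case by (simp add: b_def divide_inverse mult_ac power_inverse[symmetric])
      qed
    qed
  qed
  have "(\<lambda>n. (h n - A * b n) / of_real (real n powr (\<delta> - 1))) \<longlonglongrightarrow> 0"
  proof (rule coeff_tendsto_zero[OF _ \<delta>])
    fix z :: complex assume z: "norm z < 1"
    show "(\<lambda>n. (h n - A * b n) * z ^ n) sums (H z - A * (1 - z) powr (- of_real \<delta>))"
      using sums_diff[OF sums[OF z] sums_mult[OF sums_b[OF z], of A]] by (simp add: algebra_simps)
    have "norm (H z - A * (1 - z) powr (- of_real \<delta>)) \<le> C * norm (1 - z) powr (-\<delta>) + norm A * norm (1 - z) powr (-\<delta>)"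
      by (intro order_trans[OF norm_triangle_ineq4] add_mono bound[OF z]) (simp add: norm_mult norm_powr z)
    then show "norm (H z - A * (1 - z) powr (- of_real \<delta>)) \<le> (C + norm A) * norm (1 - z) powr (-\<delta>)"
      by (simp add: algebra_simps)
  next
    fix s
    \<comment> \<open>The limit 1 - \<i> s has real part 1 and so stays off the branch cut, where
      the complex power is continuous.\<close>
    have c: "(\<lambda>n. (of_nat n * (1 - circ n s)) powr (- of_real \<delta>)) \<longlonglongrightarrow> (1 - \<i> * of_real s) powr (- of_real \<delta>)"
      by (intro tendsto_powr_complex tendsto_circ tendsto_const) (auto simp: complex_nonpos_Reals_iff)
    have "(\<lambda>n. H (circ n s) / of_real (real n powr \<delta>) - A * (of_nat n * (1 - circ n s)) powr (- of_real \<delta>)) \<longlonglongrightarrow> 0"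
      using tendsto_diff[OF lim[of s] tendsto_mult[OF tendsto_const c, of A]] by simp
    then show "(\<lambda>n. (H (circ n s) - A * (1 - circ n s) powr (- of_real \<delta>)) / of_real (real n powr \<delta>)) \<longlonglongrightarrow> 0"
    proof (rule Lim_transform_eventually)
      show "\<forall>\<^sub>F n in sequentially. H (circ n s) / of_real (real n powr \<delta>) - A * (of_nat n * (1 - circ n s)) powr (- of_real \<delta>) = (H (circ n s) - A * (1 - circ n s) powr (- of_real \<delta>)) / of_real (real n powr \<delta>)"
        using eventually_gt_at_top[of 0]
      proof eventually_elim
        case (elim n)
        \<comment> \<open>A positive real factor leaves the argument unchanged, so it splits off a
          complex power without a branch correction.\<close>
        have "(of_real (real n) * (1 - circ n s)) powr (- of_real \<delta>) = of_real (real n) powr (- of_real \<delta>) * (1 - circ n s) powr (- of_real \<delta>)"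
          by (rule powr_times_real_left) (use elim in auto)
        also have "of_real (real n) powr (- of_real \<delta>) = inverse (complex_of_real (real n powr \<delta>))"
          using elim by (metis of_nat_0_le_iff powr_minus powr_of_real of_real_inverse of_real_minus)
        finally show ?case by (simp add: divide_inverse algebra_simps)
      qed
    qed
  qed
  from tendsto_add[OF this tendsto_mult[OF tendsto_const lim_b, of A]] show ?thesis
    by (simp add: diff_divide_distrib)
qed

section \<open>Integrals of powers of an affine function of a power\<close>

text \<open>Holds because 1 + x is at most twice the larger of 1 and x. It reduces the natural
  majorant of the scaled integrals to a power of 1 + x.\<close>

lemma one_plus_powr_bound:
  fixes \<alpha> x :: real
  assumes "\<alpha> > 0" "x \<ge> 0"
  shows "1 / (1 + x powr \<alpha>) \<le> 2 powr \<alpha> * (1 + x) powr (-\<alpha>)"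
proof -
  have "(1 + x) powr \<alpha> \<le> 2 powr \<alpha> * (1 + x powr \<alpha>)"
  proof (cases "x \<le> 1")
    case True
    then have "(1 + x) powr \<alpha> \<le> 2 powr \<alpha>" using assms by (intro powr_mono2) auto
    also have "\<dots> * 1 \<le> 2 powr \<alpha> * (1 + x powr \<alpha>)" by (intro mult_left_mono) auto
    finally show ?thesis by simp
  next
    case False
    then have "(1 + x) powr \<alpha> \<le> (2 * x) powr \<alpha>" using assms by (intro powr_mono2) auto
    also have "\<dots> = 2 powr \<alpha> * x powr \<alpha>" using assms by (simp add: powr_mult)
    also have "\<dots> \<le> 2 powr \<alpha> * (1 + x powr \<alpha>)" by (intro mult_left_mono) auto
    finally show ?thesis .
  qed
  moreover have "1 + x powr \<alpha> > 0" by (simp add: add_pos_nonneg)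
  moreover have "(1 + x) powr \<alpha> > 0" using assms by simp
  ultimately show ?thesis by (simp add: powr_minus field_simps)
qed

lemma integrable_inverse_one_plus_powr:
  fixes \<alpha> :: real
  assumes "\<alpha> > 1"
  shows "integrable lborel (\<lambda>x::real. 1 / (1 + \<bar>x\<bar> powr \<alpha>))"
proof (rule Bochner_Integration.integrable_bound)
  show "integrable lborel (\<lambda>x::real. 2 powr \<alpha> * (1 + \<bar>x\<bar>) powr (-\<alpha>))"
    using integrable_one_plus_abs_powr[OF assms] by simp
  show "AE x in lborel. norm (1 / (1 + \<bar>x\<bar> powr \<alpha>)) \<le> norm (2 powr \<alpha> * (1 + \<bar>x\<bar>) powr (-\<alpha>))"
    using one_plus_powr_bound[of \<alpha>] assms by (auto simp: abs_mult)
qed auto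

text \<open>One half line of the scaling limit: \<mu> stands for the limit of n (1 - z), and w for a
  one-sided limit of (1 - \<phi>)/|\<theta>|^\<alpha>. The two sides of 0 have different w and are
  therefore kept apart.\<close>

definition half_int :: "real \<Rightarrow> nat \<Rightarrow> complex \<Rightarrow> complex \<Rightarrow> complex" where
  "half_int \<alpha> k \<mu> w = (\<integral>x. indicator {0<..} x *\<^sub>R (1 / (\<mu> + w * of_real (x powr \<alpha>)) ^ k) \<partial>lborel)"

lemma cmod_affine_ge:
  fixes \<mu> w :: complex
  assumes "t \<ge> 0" "m \<le> Re \<mu>" "m \<le> Re w"
  shows "m * (1 + t) \<le> cmod (\<mu> + w * of_real t)"
proof -
  have "m * (1 + t) \<le> Re \<mu> + Re w * t"
    using assms mult_right_mono[of m "Re w" t] by (simp add: algebra_simps)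
  also have "\<dots> = Re (\<mu> + w * of_real t)" by simp
  also have "\<dots> \<le> cmod (\<mu> + w * of_real t)" by (rule complex_Re_le_cmod)
  finally show ?thesis .
qed

lemma affine_nonzero:
  fixes \<mu> w :: complex
  assumes "t \<ge> 0" "0 < Re \<mu>" "0 < Re w"
  shows "\<mu> + w * of_real t \<noteq> 0"
proof -
  have "Re (\<mu> + w * of_real t) > 0" using assms by (simp add: add_pos_nonneg)
  then show ?thesis by force
qed

text \<open>The real part of the denominator is at least m (1 + t), and (1 + t)^k \<ge> 1 + t, so
  one integrable majorant serves all powers.\<close>

lemma affine_power_bound:
  fixes \<mu> w :: complex
  assumes "t \<ge> 0" "0 < m" "m \<le> Re \<mu>" "m \<le> Re w" "k \<ge> 1"
  shows "norm (1 / (\<mu> + w * of_real t) ^ k) \<le> (1 / m ^ k) * (1 / (1 + t))"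
proof -
  have "m ^ k * (1 + t) \<le> m ^ k * (1 + t) ^ k"
    using assms self_le_power[of "1 + t" k] by (intro mult_left_mono) auto
  also have "\<dots> = (m * (1 + t)) ^ k" by (simp add: power_mult_distrib)
  also have "\<dots> \<le> cmod (\<mu> + w * of_real t) ^ k"
    using assms by (intro power_mono cmod_affine_ge) auto
  finally have *: "m ^ k * (1 + t) \<le> cmod (\<mu> + w * of_real t) ^ k" .
  moreover have "0 < m ^ k * (1 + t)" using assms by (intro mult_pos_pos) auto
  ultimately have "1 / cmod (\<mu> + w * of_real t) ^ k \<le> 1 / (m ^ k * (1 + t))"
    by (intro divide_left_mono mult_pos_pos[OF _ order.strict_trans2[OF _ *]]) auto
  then show ?thesis by (simp add: norm_divide norm_power)
qed

lemma integrable_half_int: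
  assumes "\<alpha> > 1" "0 < Re \<mu>" "0 < Re w" "k \<ge> 1"
  shows "integrable lborel (\<lambda>x::real. indicator {0<..} x *\<^sub>R (1 / (\<mu> + w * of_real (x powr \<alpha>)) ^ k))"
proof (rule Bochner_Integration.integrable_bound)
  let ?m = "min (Re \<mu>) (Re w)"
  show "integrable lborel (\<lambda>x::real. (1 / ?m ^ k) * (1 / (1 + \<bar>x\<bar> powr \<alpha>)))"
    by (intro integrable_mult_right integrable_inverse_one_plus_powr assms)
  show "AE x in lborel. norm (indicator {0<..} x *\<^sub>R (1 / (\<mu> + w * of_real (x powr \<alpha>)) ^ k)) \<le> norm ((1 / ?m ^ k) * (1 / (1 + \<bar>x\<bar> powr \<alpha>)))"
  proof (intro AE_I2)
    fix x :: real
    have "norm (1 / (\<mu> + w * of_real (x powr \<alpha>)) ^ k) \<le> (1 / ?m ^ k) * (1 / (1 + x powr \<alpha>))"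
      using assms by (intro affine_power_bound) auto
    then show "norm (indicator {0<..} x *\<^sub>R (1 / (\<mu> + w * of_real (x powr \<alpha>)) ^ k)) \<le> norm ((1 / ?m ^ k) * (1 / (1 + \<bar>x\<bar> powr \<alpha>)))"
      using assms by (cases "x > 0") auto
  qed
qed auto

text \<open>Integrating the derivative of \<open>x / (\<mu> + w x\<^sup>\<alpha>)\<^sup>k\<close>, which vanishes at both ends.\<close>

lemma half_int_rec:
  assumes \<alpha>: "\<alpha> > 1" and pos: "0 < Re \<mu>" "0 < Re w" and k: "k \<ge> 1"
  shows "of_nat k * of_real \<alpha> * \<mu> * half_int \<alpha> (Suc k) \<mu> w = (of_nat k * of_real \<alpha> - 1) * half_int \<alpha> k \<mu> w"
proof -
  define D where "D = (\<lambda>x::real. \<mu> + w * of_real (x powr \<alpha>))"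
  define F where "F = (\<lambda>x::real. of_real x * (1 / D x ^ k))"
  \<comment> \<open>The derivative of \<open>F\<close> after w x^\<alpha> is replaced by
    \<open>D x\<close> - \<mu>; only powers of 1/\<open>D x\<close> remain, so its integral is a
    combination of two values of \<open>half_int\<close>.\<close>
  define f where "f = (\<lambda>x::real. (1 - of_nat k * of_real \<alpha>) * (1 / D x ^ k) + of_nat k * of_real \<alpha> * \<mu> * (1 / D x ^ Suc k))"
  define m where "m = min (Re \<mu>) (Re w)"
  have m: "m > 0" using pos by (simp add: m_def)
  have D0: "D x \<noteq> 0" for x unfolding D_def by (rule affine_nonzero) (use pos in auto)
  have int1: "integrable lborel (\<lambda>x. indicator {0<..} x *\<^sub>R (1 / D x ^ j))" if "j \<ge> 1" for j
    unfolding D_def by (rule integrable_half_int) (use \<alpha> pos that in auto)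
  have f_eq: "indicator {0<..} x *\<^sub>R f x = (1 - of_nat k * of_real \<alpha>) * (indicator {0<..} x *\<^sub>R (1 / D x ^ k))
      + of_nat k * of_real \<alpha> * \<mu> * (indicator {0<..} x *\<^sub>R (1 / D x ^ Suc k))" for x
    by (simp only: f_def scaleR_conv_of_real distrib_left mult.left_commute)
  have F_bound: "norm (F x) \<le> (1 / m ^ k) * (x * (1 / (1 + x powr \<alpha>)))" if "x > 0" for x
  proof -
    have "norm (1 / D x ^ k) \<le> (1 / m ^ k) * (1 / (1 + x powr \<alpha>))"
      unfolding D_def using m k by (intro affine_power_bound) (auto simp: m_def)
    from mult_left_mono[OF this, of x] that show ?thesis by (simp add: F_def norm_mult norm_divide norm_power mult.left_commute)
  qed
  have "(LBINT x=0..\<infinity>. f x) = 0 - 0"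
  proof (rule interval_integral_FTC_integrable)
    fix x :: real assume "0 < ereal x"
    then have x: "x > 0" by simp
    have dD: "(D has_vector_derivative w * of_real (\<alpha> * x powr (\<alpha> - 1))) (at x)"
      unfolding D_def using x
      by (auto intro!: derivative_eq_intros has_vector_derivative_of_real has_real_derivative_powr)
    have "((\<lambda>z. 1 / z ^ k) has_field_derivative - (of_nat k / D x ^ Suc k)) (at (D x))"
    proof -
      obtain j where j: "k = Suc j" using k by (cases k) auto
      have "((\<lambda>z. z ^ Suc j) has_field_derivative of_nat (Suc j) * D x ^ j) (at (D x))"
        by (auto intro!: derivative_eq_intros simp del: power_Suc)
      from DERIV_divide[OF DERIV_const[of 1] this]
      have "((\<lambda>z. 1 / z ^ Suc j) has_field_derivative
          (0 * D x ^ Suc j - 1 * (of_nat (Suc j) * D x ^ j)) / (D x ^ Suc j * D x ^ Suc j)) (at (D x))"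
        using D0[of x] by simp
      also have "(0 * D x ^ Suc j - 1 * (of_nat (Suc j) * D x ^ j)) / (D x ^ Suc j * D x ^ Suc j) = - (of_nat k / D x ^ Suc k)"
        unfolding j using D0[of x] by (simp add: divide_simps del: of_nat_Suc)
      finally show ?thesis unfolding j .
    qed
    from field_vector_diff_chain_at[OF dD this]
    have dk: "((\<lambda>x. 1 / D x ^ k) has_vector_derivative w * of_real (\<alpha> * x powr (\<alpha> - 1)) * - (of_nat k / D x ^ Suc k)) (at x)"
      by (simp add: o_def)
    have "(F has_vector_derivative of_real x * (w * of_real (\<alpha> * x powr (\<alpha> - 1)) * - (of_nat k / D x ^ Suc k)) + 1 * (1 / D x ^ k)) (at x)"
      unfolding F_def
      by (rule has_vector_derivative_mult[OF _ dk]) (auto intro!: derivative_eq_intros has_vector_derivative_of_real)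
    moreover have "of_real x * (w * of_real (\<alpha> * x powr (\<alpha> - 1)) * - (of_nat k / D x ^ Suc k)) + 1 * (1 / D x ^ k) = f x"
    proof -
      have p: "x * x powr (\<alpha> - 1) = x powr \<alpha>" using x by (simp add: powr_diff)
      have "of_real x * (w * of_real (\<alpha> * x powr (\<alpha> - 1)) * - (of_nat k / D x ^ Suc k))
         = - (of_nat k * of_real \<alpha> * (w * of_real (x powr \<alpha>)) / D x ^ Suc k)"
        unfolding p[symmetric] by (simp add: field_simps)
      also have "w * of_real (x powr \<alpha>) = D x - \<mu>" by (simp add: D_def)
      finally have e: "of_real x * (w * of_real (\<alpha> * x powr (\<alpha> - 1)) * - (of_nat k / D x ^ Suc k))
         = - (of_nat k * of_real \<alpha> * (D x - \<mu>) / D x ^ Suc k)" .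
      have "- (K * (d - \<mu>) / d ^ Suc k) + 1 * (1 / d ^ k) = (1 - K) * (1 / d ^ k) + K * \<mu> * (1 / d ^ Suc k)"
        if "d \<noteq> 0" for d K :: complex
        using that by (simp add: field_simps)
      from this[OF D0] show ?thesis unfolding e f_def .
    qed
    ultimately show "(F has_vector_derivative f x) (at x)" by simp
    have "isCont D x" using dD by (rule has_vector_derivative_continuous)
    then show "isCont f x" unfolding f_def using D0[of x]
      by (intro continuous_intros) auto
  next
    show "set_integrable lborel (einterval 0 \<infinity>) f"
      unfolding set_integrable_def zero_ereal_def einterval_eq f_eq
      by (intro Bochner_Integration.integrable_add integrable_mult_right int1) (use k in auto)
  next
    have "(F \<longlongrightarrow> 0) (at_right 0)"
    proof (rule Lim_null_comparison)
      show "\<forall>\<^sub>F x in at_right 0. norm (F x) \<le> (1 / m ^ k) * x"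
        using eventually_at_right_less[of 0]
      proof eventually_elim
        case (elim x)
        have "1 / (1 + t) \<le> 1" if "t \<ge> 0" for t :: real using that by simp
        from this[of "x powr \<alpha>"] have "x * (1 / (1 + x powr \<alpha>)) \<le> x * 1"
          using elim by (intro mult_left_mono) simp_all
        with F_bound[OF elim] m show ?case by (smt (verit) mult_left_mono zero_le_divide_1_iff zero_le_power mult.right_neutral)
      qed
      show "((\<lambda>x. 1 / m ^ k * x) \<longlongrightarrow> 0) (at_right 0)"
        using m by (auto intro!: tendsto_eq_intros)
    qed
    then show "((F \<circ> real_of_ereal) \<longlongrightarrow> 0) (at_right 0)"
      by (simp add: zero_ereal_def ereal_tendsto_simps)
    \<comment> \<open>At infinity |\<open>F x\<close>| is at most a multiple of x^(1 - \<alpha>),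
      and \<alpha> > 1.\<close>
    have "(F \<longlongrightarrow> 0) at_top"
    proof (rule Lim_null_comparison)
      show "\<forall>\<^sub>F x in at_top. norm (F x) \<le> (1 / m ^ k) * x powr (1 - \<alpha>)"
        using eventually_gt_at_top[of 0]
      proof eventually_elim
        case (elim x)
        have "x * (1 / (1 + x powr \<alpha>)) \<le> x * (1 / x powr \<alpha>)" using elim by (intro mult_left_mono divide_left_mono mult_pos_pos) (auto simp: add_pos_pos)
        also have "\<dots> = x powr (1 - \<alpha>)" using elim by (simp add: powr_diff)
        finally show ?case using F_bound[OF elim] m by (smt (verit) mult_left_mono zero_le_divide_1_iff zero_le_power)
      qed
      have "((\<lambda>x::real. x powr (1 - \<alpha>)) \<longlongrightarrow> 0) at_top"
        using \<alpha> by (intro tendsto_neg_powr filterlim_ident) auto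
      from tendsto_mult[OF tendsto_const this, of "1 / m ^ k"]
      show "((\<lambda>x. 1 / m ^ k * x powr (1 - \<alpha>)) \<longlongrightarrow> 0) at_top" by simp
    qed
    then show "((F \<circ> real_of_ereal) \<longlongrightarrow> 0) (at_left \<infinity>)"
      by (simp add: ereal_tendsto_simps)
  qed auto
  then have zero: "(\<integral>x. indicator {0<..} x *\<^sub>R f x \<partial>lborel) = 0"
    unfolding zero_ereal_def interval_integral_to_infinity_eq by (simp add: set_lebesgue_integral_def)
  have half_int_D: "half_int \<alpha> j \<mu> w = (\<integral>x. indicator {0<..} x *\<^sub>R (1 / D x ^ j) \<partial>lborel)" for j
    by (simp add: half_int_def D_def)
  have "(\<integral>x. indicator {0<..} x *\<^sub>R f x \<partial>lborel) =
     (1 - of_nat k * of_real \<alpha>) * half_int \<alpha> k \<mu> w + of_nat k * of_real \<alpha> * \<mu> * half_int \<alpha> (Suc k) \<mu> w"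
    unfolding f_eq half_int_D
    by (subst Bochner_Integration.integral_add)
       (use k in \<open>auto simp only: integral_mult_right_zero intro!: integrable_mult_right int1\<close>)
  from this[unfolded zero] show ?thesis by (simp add: algebra_simps)
qed

text \<open>The difference quotient of the integrand is exactly -b/((a + z b)(a + \<zeta> b)), so
  domination is asked of this product and dominated convergence along sequences applies. Linearity
  in z covers both parameters of \<open>half_int\<close>: b = 1 for \<mu> and b = x^\<alpha> for
  w.\<close>

lemma has_field_derivative_integral_inverse:
  fixes a b :: "real \<Rightarrow> complex"
  assumes S: "open S" "\<zeta> \<in> S"
    and nz: "\<And>z x. z \<in> S \<Longrightarrow> x \<in> A \<Longrightarrow> a x + z * b x \<noteq> 0"
    and meas [measurable]: "a \<in> borel_measurable borel" "b \<in> borel_measurable borel" "A \<in> sets borel"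
    and int: "\<And>z. z \<in> S \<Longrightarrow> integrable lborel (\<lambda>x. indicator A x *\<^sub>R (1 / (a x + z * b x)))"
    and bound: "integrable lborel g" "\<And>z x. z \<in> S \<Longrightarrow> x \<in> A \<Longrightarrow> norm (b x / ((a x + z * b x) * (a x + \<zeta> * b x))) \<le> g x"
    and g: "\<And>x. g x \<ge> 0"
  shows "((\<lambda>z. \<integral>x. indicator A x *\<^sub>R (1 / (a x + z * b x)) \<partial>lborel) has_field_derivative
           - (\<integral>x. indicator A x *\<^sub>R (b x / (a x + \<zeta> * b x) ^ 2) \<partial>lborel)) (at \<zeta>)"
proof -
  let ?I = "\<lambda>z. \<integral>x. indicator A x *\<^sub>R (1 / (a x + z * b x)) \<partial>lborel"
  let ?q = "\<lambda>z x. indicator A x *\<^sub>R (b x / ((a x + z * b x) * (a x + \<zeta> * b x)))"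
  have quot: "(?I z - ?I \<zeta>) / (z - \<zeta>) = - (\<integral>x. ?q z x \<partial>lborel)" if "z \<in> S" "z \<noteq> \<zeta>" for z
  proof -
    have "?I z - ?I \<zeta> = (\<integral>x. indicator A x *\<^sub>R (1 / (a x + z * b x)) - indicator A x *\<^sub>R (1 / (a x + \<zeta> * b x)) \<partial>lborel)"
      by (rule Bochner_Integration.integral_diff[symmetric]) (use int that S in auto)
    also have "\<dots> = (\<integral>x. (\<zeta> - z) * ?q z x \<partial>lborel)"
    proof (rule Bochner_Integration.integral_cong[OF refl])
      fix x
      show "indicator A x *\<^sub>R (1 / (a x + z * b x)) - indicator A x *\<^sub>R (1 / (a x + \<zeta> * b x)) = (\<zeta> - z) * ?q z x"
        using nz[OF that(1), of x] nz[OF S(2), of x]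
        by (cases "x \<in> A") (auto simp: field_simps)
    qed
    also have "\<dots> = (\<zeta> - z) * (\<integral>x. ?q z x \<partial>lborel)" by (rule integral_mult_right_zero)
    finally show ?thesis using that by (simp add: divide_simps) (simp add: algebra_simps)
  qed
  have "((\<lambda>z. (?I z - ?I \<zeta>) / (z - \<zeta>)) \<longlongrightarrow> - (\<integral>x. indicator A x *\<^sub>R (b x / (a x + \<zeta> * b x) ^ 2) \<partial>lborel)) (at \<zeta> within S)"
    unfolding tendsto_at_iff_sequentially comp_def
  proof safe
    fix X assume X: "\<forall>i. X i \<in> S - {\<zeta>}" "X \<longlonglongrightarrow> \<zeta>"
    have "(\<lambda>i. - (\<integral>x. ?q (X i) x \<partial>lborel)) \<longlonglongrightarrow> - (\<integral>x. indicator A x *\<^sub>R (b x / (a x + \<zeta> * b x) ^ 2) \<partial>lborel)"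
    proof (intro tendsto_minus integral_dominated_convergence[OF _ _ bound(1)])
      show "AE x in lborel. (\<lambda>i. ?q (X i) x) \<longlonglongrightarrow> indicator A x *\<^sub>R (b x / (a x + \<zeta> * b x) ^ 2)"
      proof (intro AE_I2)
        fix x
        show "(\<lambda>i. ?q (X i) x) \<longlonglongrightarrow> indicator A x *\<^sub>R (b x / (a x + \<zeta> * b x) ^ 2)"
          using nz[OF S(2), of x]
          by (cases "x \<in> A") (auto intro!: tendsto_intros X simp: power2_eq_square)
      qed
      show "AE x in lborel. norm (?q (X i) x) \<le> g x" for i
        using bound(2) X g by (intro AE_I2) (auto split: split_indicator)
    qed auto
    moreover have "(?I (X i) - ?I \<zeta>) / (X i - \<zeta>) = - (\<integral>x. ?q (X i) x \<partial>lborel)" for i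
      using X by (intro quot) auto
    ultimately show "(\<lambda>i. (?I (X i) - ?I \<zeta>) / (X i - \<zeta>)) \<longlonglongrightarrow> - (\<integral>x. indicator A x *\<^sub>R (b x / (a x + \<zeta> * b x) ^ 2) \<partial>lborel)"
      by simp
  qed
  then show ?thesis unfolding has_field_derivative_iff using at_within_open[OF S(2,1)] by simp
qed

text \<open>On the half plane Re z > Re \<mu> / 2 both denominators have real part at least m (1 +
  x^\<alpha>). One factor of the product supplies the integrable majorant, the other is bounded by
  1/m.\<close>

lemma half_int_deriv_mu:
  assumes \<alpha>: "\<alpha> > 1" and pos: "0 < Re \<mu>" "0 < Re w"
  shows "((\<lambda>\<mu>. half_int \<alpha> 1 \<mu> w) has_field_derivative - half_int \<alpha> 2 \<mu> w) (at \<mu>)"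
proof -
  define m where "m = min (Re \<mu> / 2) (Re w)"
  have m: "m > 0" using pos by (simp add: m_def)
  have "((\<lambda>z. \<integral>x. indicator {0<..} x *\<^sub>R (1 / (w * of_real (x powr \<alpha>) + z * 1)) \<partial>lborel) has_field_derivative
           - (\<integral>x. indicator {0<..} x *\<^sub>R (1 / (w * of_real (x powr \<alpha>) + \<mu> * 1) ^ 2) \<partial>lborel)) (at \<mu>)"
  proof (rule has_field_derivative_integral_inverse[where S = "{z. Re z > Re \<mu> / 2}"])
    show "open {z. Re z > Re \<mu> / 2}" by (rule open_halfspace_Re_gt)
    show "integrable lborel (\<lambda>x. (1 / m ^ 2) * (1 / (1 + \<bar>x\<bar> powr \<alpha>)))"
      by (intro integrable_mult_right integrable_inverse_one_plus_powr \<alpha>)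
    fix z :: complex and x :: real assume z: "z \<in> {z. Re z > Re \<mu> / 2}"
    { assume "x \<in> {0<..}"
    then have x: "x > 0" by simp
    show "w * of_real (x powr \<alpha>) + z * 1 \<noteq> 0"
      using affine_nonzero[of "x powr \<alpha>" z w] z pos by (auto simp: algebra_simps)
    have 1: "norm (1 / (y + w * of_real (x powr \<alpha>)) ^ 1) \<le> (1 / m ^ 1) * (1 / (1 + x powr \<alpha>))" if "Re y > Re \<mu> / 2" for y
      using m that by (intro affine_power_bound) (auto simp: m_def)
    have "norm (1 / (z + w * of_real (x powr \<alpha>)) ^ 1) * norm (1 / (\<mu> + w * of_real (x powr \<alpha>)) ^ 1)
       \<le> ((1 / m ^ 1) * (1 / (1 + x powr \<alpha>))) * ((1 / m ^ 1) * 1)"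
    proof (rule mult_mono)
      have "(1 / m ^ 1) * (1 / (1 + x powr \<alpha>)) \<le> (1 / m ^ 1) * 1"
        using m by (intro mult_left_mono) (auto simp: field_simps add_pos_nonneg)
      with 1[of \<mu>] pos show "norm (1 / (\<mu> + w * of_real (x powr \<alpha>)) ^ 1) \<le> (1 / m ^ 1) * 1" by simp
    qed (use 1[of z] z m in auto)
    then show "norm (1 / ((w * of_real (x powr \<alpha>) + z * 1) * (w * of_real (x powr \<alpha>) + \<mu> * 1))) \<le> (1 / m ^ 2) * (1 / (1 + \<bar>x\<bar> powr \<alpha>))"
      using x by (simp add: norm_divide norm_mult power2_eq_square add.commute mult_ac) }
    show "integrable lborel (\<lambda>x. indicator {0<..} x *\<^sub>R (1 / (w * of_real (x powr \<alpha>) + z * 1)))"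
      using integrable_half_int[OF \<alpha>, of z w 1] pos z by (simp add: add.commute)
  qed (use pos m in \<open>auto\<close>)
  then show ?thesis unfolding half_int_def by (simp add: add.commute)
qed

text \<open>Differentiation puts x^\<alpha> into the numerator; it is absorbed by the second
  denominator, as x^\<alpha>/(1 + x^\<alpha>) \<le> 1. Writing w x^\<alpha> as the denominator minus
  \<mu> then expresses the derivative through \<open>half_int\<close> itself.\<close>

lemma half_int_deriv_w:
  assumes \<alpha>: "\<alpha> > 1" and pos: "0 < Re \<mu>" "0 < Re w"
  shows "((\<lambda>w. half_int \<alpha> 1 \<mu> w) has_field_derivative - (half_int \<alpha> 1 \<mu> w - \<mu> * half_int \<alpha> 2 \<mu> w) / w) (at w)"
proof -
  define m where "m = min (Re \<mu>) (Re w / 2)"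
  have m: "m > 0" using pos by (simp add: m_def)
  let ?p = "\<lambda>x. complex_of_real (x powr \<alpha>)"
  have "((\<lambda>z. \<integral>x. indicator {0<..} x *\<^sub>R (1 / (\<mu> + z * ?p x)) \<partial>lborel) has_field_derivative
           - (\<integral>x. indicator {0<..} x *\<^sub>R (?p x / (\<mu> + w * ?p x) ^ 2) \<partial>lborel)) (at w)"
  proof (rule has_field_derivative_integral_inverse[where S = "{z. Re z > Re w / 2}"])
    show "open {z. Re z > Re w / 2}" by (rule open_halfspace_Re_gt)
    show "integrable lborel (\<lambda>x. (1 / m ^ 2) * (1 / (1 + \<bar>x\<bar> powr \<alpha>)))"
      by (intro integrable_mult_right integrable_inverse_one_plus_powr \<alpha>)
    fix z :: complex and x :: real assume z: "z \<in> {z. Re z > Re w / 2}"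
    { assume "x \<in> {0<..}"
    then have x: "x > 0" by simp
    show "\<mu> + z * ?p x \<noteq> 0"
      using affine_nonzero[of "x powr \<alpha>" \<mu> z] z pos by auto
    have 1: "norm (1 / (\<mu> + y * ?p x) ^ 1) \<le> (1 / m ^ 1) * (1 / (1 + x powr \<alpha>))" if "Re y > Re w / 2" for y
      using m that by (intro affine_power_bound) (auto simp: m_def)
    have "norm (1 / (\<mu> + z * ?p x) ^ 1) * norm (1 / (\<mu> + w * ?p x) ^ 1)
       \<le> ((1 / m ^ 1) * (1 / (1 + x powr \<alpha>))) * ((1 / m ^ 1) * (1 / (1 + x powr \<alpha>)))"
      using z pos m by (intro mult_mono 1) auto
    from mult_left_mono[OF this, of "x powr \<alpha>"]
    have "norm (?p x / ((\<mu> + z * ?p x) * (\<mu> + w * ?p x))) \<le> (1 / m ^ 2) * (1 / (1 + x powr \<alpha>)) * (x powr \<alpha> / (1 + x powr \<alpha>))"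
      using x by (simp add: norm_divide norm_mult power2_eq_square mult_ac)
    also have "\<dots> \<le> (1 / m ^ 2) * (1 / (1 + x powr \<alpha>)) * 1"
    proof (rule mult_left_mono)
      have "0 < 1 + x powr \<alpha>" by (simp add: add_pos_nonneg)
      then show "x powr \<alpha> / (1 + x powr \<alpha>) \<le> 1" "0 \<le> (1 / m ^ 2) * (1 / (1 + x powr \<alpha>))" by simp_all
    qed
    finally show "norm (?p x / ((\<mu> + z * ?p x) * (\<mu> + w * ?p x))) \<le> (1 / m ^ 2) * (1 / (1 + \<bar>x\<bar> powr \<alpha>))"
      using x by simp }
    show "integrable lborel (\<lambda>x. indicator {0<..} x *\<^sub>R (1 / (\<mu> + z * ?p x)))"
      using integrable_half_int[OF \<alpha>, of \<mu> z 1] pos z by simp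
  qed (use pos m in \<open>auto\<close>)
  moreover have "(\<integral>x. indicator {0<..} x *\<^sub>R (?p x / (\<mu> + w * ?p x) ^ 2) \<partial>lborel)
      = (half_int \<alpha> 1 \<mu> w - \<mu> * half_int \<alpha> 2 \<mu> w) / w"
  proof -
    have w: "w \<noteq> 0" using pos by auto
    have "(\<integral>x. indicator {0<..} x *\<^sub>R (?p x / (\<mu> + w * ?p x) ^ 2) \<partial>lborel)
       = (\<integral>x. (indicator {0<..} x *\<^sub>R (1 / (\<mu> + w * ?p x) ^ 1) - \<mu> * (indicator {0<..} x *\<^sub>R (1 / (\<mu> + w * ?p x) ^ 2))) / w \<partial>lborel)"
    proof (rule Bochner_Integration.integral_cong[OF refl])
      fix x :: real
      have "?p x / (\<mu> + w * ?p x) ^ 2 = (1 / (\<mu> + w * ?p x) ^ 1 - \<mu> * (1 / (\<mu> + w * ?p x) ^ 2)) / w"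
      proof -
        define d where "d = \<mu> + w * ?p x"
        have "d \<noteq> 0" using affine_nonzero[of "x powr \<alpha>" \<mu> w] pos by (simp add: d_def)
        moreover have p: "?p x = (d - \<mu>) / w" using w by (simp add: d_def)
        ultimately show ?thesis unfolding d_def[symmetric] p using w by (simp add: field_simps power2_eq_square)
      qed
      then show "indicator {0<..} x *\<^sub>R (?p x / (\<mu> + w * ?p x) ^ 2) = (indicator {0<..} x *\<^sub>R (1 / (\<mu> + w * ?p x) ^ 1) - \<mu> * (indicator {0<..} x *\<^sub>R (1 / (\<mu> + w * ?p x) ^ 2))) / w"
        by (cases "x > 0") auto
    qed
    also have "\<dots> = (half_int \<alpha> 1 \<mu> w - \<mu> * half_int \<alpha> 2 \<mu> w) / w"
      unfolding half_int_def integral_divide_zero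
      using integrable_half_int[OF \<alpha> pos, of 1] integrable_half_int[OF \<alpha> pos, of 2]
      by (subst Bochner_Integration.integral_diff)
         (auto simp only: integral_mult_right_zero intro!: integrable_mult_right)
    finally show ?thesis .
  qed
  ultimately show ?thesis unfolding half_int_def by (simp only: power_one_right minus_divide_left)
qed

text \<open>For real \<mu> this is a substitution. For complex \<mu> the product of \<mu>^(1 -
  1/\<alpha>) with the integral has derivative 0 by the recursion from k = 1 to k = 2, hence is
  constant on the convex right half plane; no contour has to be rotated.\<close>

lemma half_int_powr_mu:
  assumes \<alpha>: "\<alpha> > 1" and pos: "0 < Re \<mu>" "0 < Re w"
  shows "half_int \<alpha> 1 \<mu> w = \<mu> powr (- of_real (1 - 1 / \<alpha>)) * half_int \<alpha> 1 1 w"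
proof -
  define \<beta> where "\<beta> = complex_of_real (1 - 1 / \<alpha>)"
  let ?S = "{z. Re z > 0}"
  let ?g = "\<lambda>z. z powr \<beta> * half_int \<alpha> 1 z w"
  have "\<exists>c. \<forall>x\<in>?S. ?g x = c"
  proof (rule has_field_derivative_zero_constant)
    show "convex ?S" by (rule convex_halfspace_Re_gt)
    fix z assume "z \<in> ?S"
    then have z: "Re z > 0" "z \<noteq> 0" by auto
    have "of_real \<alpha> * z * half_int \<alpha> 2 z w = (of_real \<alpha> - 1) * half_int \<alpha> 1 z w"
      using half_int_rec[OF \<alpha> z(1) pos(2), of 1] by (simp add: numeral_2_eq_2)
    then have rec: "half_int \<alpha> 2 z w = \<beta> * half_int \<alpha> 1 z w / z"
      using z \<alpha> by (simp add: \<beta>_def field_simps)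
    have "(?g has_field_derivative (\<beta> * z powr (\<beta> - 1)) * half_int \<alpha> 1 z w + (- half_int \<alpha> 2 z w) * z powr \<beta>) (at z)"
      by (rule DERIV_mult has_field_derivative_powr half_int_deriv_mu \<alpha> pos z | use z in \<open>force simp: complex_nonpos_Reals_iff\<close>)+
    moreover have "(\<beta> * z powr (\<beta> - 1)) * half_int \<alpha> 1 z w + (- half_int \<alpha> 2 z w) * z powr \<beta> = 0"
      using z unfolding rec by (simp add: powr_diff)
    ultimately show "(?g has_field_derivative 0) (at z within ?S)"
      by (metis has_field_derivative_at_within)
  qed
  then obtain c where "\<forall>x\<in>?S. ?g x = c" ..
  from bspec[OF this, of \<mu>] bspec[OF this, of 1] have "?g \<mu> = ?g 1" using pos by simp
  then have "\<mu> powr (-\<beta>) * (\<mu> powr \<beta> * half_int \<alpha> 1 \<mu> w) = \<mu> powr (-\<beta>) * half_int \<alpha> 1 1 w" by simp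
  moreover have "\<mu> powr (-\<beta>) * \<mu> powr \<beta> = 1" using pos by (auto simp: powr_minus intro!: left_inverse)
  ultimately show ?thesis unfolding \<beta>_def[symmetric] by (metis mult.assoc mult_1_left)
qed

text \<open>The same argument in w: at \<mu> = 1 the recursion turns the difference of the integrals
  for k = 1 and k = 2 into 1/\<alpha> times the first, so w^(1/\<alpha>) times the integral has
  derivative 0.\<close>

lemma half_int_powr_w:
  assumes \<alpha>: "\<alpha> > 1" and pos: "0 < Re w"
  shows "half_int \<alpha> 1 1 w = w powr (- of_real (1 / \<alpha>)) * half_int \<alpha> 1 1 1"
proof -
  define \<beta> where "\<beta> = complex_of_real (1 / \<alpha>)"
  let ?S = "{z. Re z > 0}"
  let ?g = "\<lambda>z. z powr \<beta> * half_int \<alpha> 1 1 z"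
  have "\<exists>c. \<forall>x\<in>?S. ?g x = c"
  proof (rule has_field_derivative_zero_constant)
    show "convex ?S" by (rule convex_halfspace_Re_gt)
    fix z assume "z \<in> ?S"
    then have z: "Re z > 0" "z \<noteq> 0" by auto
    have "of_real \<alpha> * half_int \<alpha> 2 1 z = (of_real \<alpha> - 1) * half_int \<alpha> 1 1 z"
      using half_int_rec[OF \<alpha> _ z(1), of 1 1] by (simp add: numeral_2_eq_2)
    then have rec: "half_int \<alpha> 1 1 z - 1 * half_int \<alpha> 2 1 z = \<beta> * half_int \<alpha> 1 1 z"
      using \<alpha> by (simp add: \<beta>_def field_simps)
    have "(?g has_field_derivative (\<beta> * z powr (\<beta> - 1)) * half_int \<alpha> 1 1 z + (- (half_int \<alpha> 1 1 z - 1 * half_int \<alpha> 2 1 z) / z) * z powr \<beta>) (at z)"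
      by (rule DERIV_mult has_field_derivative_powr half_int_deriv_w \<alpha> pos z | use z in \<open>force simp: complex_nonpos_Reals_iff\<close>)+
    moreover have "(\<beta> * z powr (\<beta> - 1)) * half_int \<alpha> 1 1 z + (- (half_int \<alpha> 1 1 z - 1 * half_int \<alpha> 2 1 z) / z) * z powr \<beta> = 0"
      using z unfolding rec by (simp add: powr_diff)
    ultimately show "(?g has_field_derivative 0) (at z within ?S)"
      by (metis has_field_derivative_at_within)
  qed
  then obtain c where "\<forall>x\<in>?S. ?g x = c" ..
  from bspec[OF this, of w] bspec[OF this, of 1] have "?g w = ?g 1" using pos by simp
  then have "w powr (-\<beta>) * (w powr \<beta> * half_int \<alpha> 1 1 w) = w powr (-\<beta>) * half_int \<alpha> 1 1 1" by simp
  moreover have "w powr (-\<beta>) * w powr \<beta> = 1" using pos by (auto simp: powr_minus intro!: left_inverse)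
  ultimately show ?thesis unfolding \<beta>_def[symmetric] by (metis mult.assoc mult_1_left)
qed

text \<open>The substitution u = x^\<alpha>/(1 + x^\<alpha>) pulls the integrand of Beta
  (1/\<alpha>) (1 - 1/\<alpha>) back to \<alpha>/(1 + x^\<alpha>) on the half line; Euler's
  reflection formula evaluates the Beta value.\<close>

lemma half_int_one:
  assumes \<alpha>: "\<alpha> > 1"
  shows "half_int \<alpha> 1 1 1 = of_real (pi / (\<alpha> * sin (pi / \<alpha>)))"
proof -
  define p :: "real \<Rightarrow> real" where "p = (\<lambda>x. x powr \<alpha>)"
  define g where "g = (\<lambda>x. p x / (1 + p x))"
  define g' where "g' = (\<lambda>x. \<alpha> * x powr (\<alpha> - 1) / (1 + p x)\<^sup>2)"
  define f where "f = (\<lambda>u::real. u powr (1 / \<alpha> - 1) * (1 - u) powr (1 - 1 / \<alpha> - 1))"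
  have p1: "1 + p x > 0" for x by (simp add: p_def add_pos_nonneg)
  have fg: "f (g x) * g' x = \<alpha> * (1 / (1 + p x))" if "x > 0" for x
  proof -
    have pp: "p x > 0" using that by (simp add: p_def)
    have 1: "1 - g x = 1 / (1 + p x)" using p1[of x] by (simp add: g_def field_simps)
    have "g x powr (1 / \<alpha> - 1) = (p x powr (1 / \<alpha>) / p x) * ((1 + p x) / (1 + p x) powr (1 / \<alpha>))"
      unfolding g_def using pp p1[of x] by (simp add: powr_divide powr_diff field_simps)
    moreover have "p x powr (1 / \<alpha>) = x" using that \<alpha> by (simp add: p_def powr_powr)
    moreover have "(1 - g x) powr (1 - 1 / \<alpha> - 1) = (1 + p x) powr (1 / \<alpha>)"
      unfolding 1 using p1[of x] by (simp add: powr_divide powr_minus field_simps)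
    ultimately have "f (g x) = x / p x * (1 + p x)"
      unfolding f_def using p1[of x] by simp
    moreover have "g' x = \<alpha> * (p x / x) / (1 + p x)\<^sup>2" using that by (simp add: g'_def p_def powr_diff)
    ultimately have "f (g x) * g' x = (x / p x * (1 + p x)) * (\<alpha> * (p x / x) / ((1 + p x) * (1 + p x)))"
      by (simp add: power2_eq_square)
    also have "\<dots> = \<alpha> * (1 / (1 + p x))" using that pp p1[of x] by (simp add: divide_simps)
    finally show ?thesis .
  qed
  have int: "integrable lborel (\<lambda>x. indicator {0<..} x *\<^sub>R (f (g x) * g' x))"
  proof -
    have "integrable lborel (\<lambda>x. indicator {0<..} x *\<^sub>R (\<alpha> * (1 / (1 + \<bar>x\<bar> powr \<alpha>))))"
      by (intro integrable_mult_indicator integrable_mult_right integrable_inverse_one_plus_powr \<alpha>) auto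
    also have "(\<lambda>x. indicator {0<..} x *\<^sub>R (\<alpha> * (1 / (1 + \<bar>x\<bar> powr \<alpha>)))) = (\<lambda>x. indicator {0<..} x *\<^sub>R (f (g x) * g' x))"
      by (auto simp: fun_eq_iff fg p_def split: split_indicator)
    finally show ?thesis .
  qed
  have dp: "(p has_real_derivative \<alpha> * x powr (\<alpha> - 1)) (at x)" if "x > 0" for x
    unfolding p_def using that by (auto intro!: derivative_eq_intros)
  have p0: "(p \<longlongrightarrow> 0) (at_right 0)"
    unfolding p_def using \<alpha> by (intro tendsto_zero_powrI[of _ _ _ \<alpha>] tendsto_intros) (auto intro!: eventually_at_rightI[of 0 1])
  have h1: "DERIV g x :> g' x" and h2: "isCont f (g x)" and h3: "isCont g' x" and h4: "0 \<le> f (g x)"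
    if "0 < ereal x" for x
  proof -
    from that have x: "x > 0" by simp
    show "DERIV g x :> g' x"
      unfolding g_def g'_def using p1[of x] x
      by (auto intro!: derivative_eq_intros dp simp: power2_eq_square field_simps)
    have gx: "0 < g x" "g x < 1" using x p1[of x] by (auto simp: g_def p_def)
    show "isCont f (g x)" unfolding f_def using gx by (intro continuous_intros) auto
    show "0 \<le> f (g x)" unfolding f_def by simp
    have "isCont p x" using dp[OF x] by (rule DERIV_isCont)
    then show "isCont g' x" unfolding g'_def using p1[of x] x by (intro continuous_intros) auto
  qed
  have h5: "0 \<le> g' x" for x unfolding g'_def using \<alpha> by simp
  have "(g \<longlongrightarrow> 0 / (1 + 0)) (at_right 0)" unfolding g_def by (intro tendsto_intros p0) auto
  then have h6: "((ereal \<circ> g \<circ> real_of_ereal) \<longlongrightarrow> 0) (at_right 0)"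
    by (simp add: zero_ereal_def ereal_tendsto_simps)
  have h7: "((ereal \<circ> g \<circ> real_of_ereal) \<longlongrightarrow> 1) (at_left \<infinity>)"
  proof -
    have "((\<lambda>x. 1 / (1 + p x)) \<longlongrightarrow> 0) at_top"
    proof (rule Lim_null_comparison)
      show "\<forall>\<^sub>F x in at_top. norm (1 / (1 + p x)) \<le> x powr (-\<alpha>)"
        using eventually_gt_at_top[of 0]
      proof eventually_elim
        case (elim x)
        have "1 / (1 + p x) \<le> 1 / p x" using elim by (intro divide_left_mono mult_pos_pos p1) (auto simp: p_def)
        then show ?case using p1[of x] by (simp add: p_def powr_minus_divide abs_of_pos)
      qed
      show "((\<lambda>x::real. x powr (-\<alpha>)) \<longlongrightarrow> 0) at_top"
        using \<alpha> by (intro tendsto_neg_powr filterlim_ident) auto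
    qed
    from tendsto_diff[OF tendsto_const this, of 1] have "((\<lambda>x. 1 - 1 / (1 + p x)) \<longlongrightarrow> 1) at_top" by simp
    also have "(\<lambda>x. 1 - 1 / (1 + p x)) = g"
    proof
      fix x
      have "1 + p x \<noteq> 0" using p1[of x] by simp
      then show "1 - 1 / (1 + p x) = g x" unfolding g_def by (simp add: field_simps)
    qed
    finally show ?thesis by (simp add: one_ereal_def ereal_tendsto_simps)
  qed
  have h8: "set_integrable lborel (einterval 0 \<infinity>) (\<lambda>x. f (g x) * g' x)"
    unfolding set_integrable_def zero_ereal_def einterval_eq using int by simp
  have "(0::ereal) < \<infinity>" by simp
  note subst = interval_integral_substitution_nonneg[OF this h1 h2 h3 h4 h5 h6 h7 h8]
  have si: "set_integrable lborel {0<..<1} f" and eq: "(LBINT x=0..1. f x) = (LBINT x=0..\<infinity>. f (g x) * g' x)"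
    using subst by (simp_all add: zero_ereal_def one_ereal_def)
  have "(f has_integral Beta (1/\<alpha>) (1 - 1/\<alpha>)) {0..1}"
    unfolding f_def by (rule has_integral_Beta_real) (use \<alpha> in auto)
  then have "integral {0<..<1} f = Beta (1/\<alpha>) (1 - 1/\<alpha>)"
    by (simp add: has_integral_Icc_iff_Ioo integral_unique)
  then have "(LBINT x=0..1. f x) = Beta (1/\<alpha>) (1 - 1/\<alpha>)"
    using set_borel_integral_eq_integral(2)[OF si]
    by (simp add: zero_ereal_def one_ereal_def interval_integral_Ioo)
  also have "\<dots> = Gamma (1/\<alpha>) * Gamma (1 - 1/\<alpha>)" by (simp add: Beta_def)
  also have "\<dots> = pi / sin (pi / \<alpha>)"
  proof -
    have "complex_of_real (Gamma (1/\<alpha>) * Gamma (1 - 1/\<alpha>)) = Gamma (of_real (1/\<alpha>)) * Gamma (1 - of_real (1/\<alpha>))"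
      by (metis Gamma_complex_of_real of_real_1 of_real_diff of_real_mult)
    also have "\<dots> = of_real (pi / sin (pi / \<alpha>))"
      unfolding Gamma_reflection_complex by (simp add: sin_of_real[symmetric])
    finally show ?thesis by (simp only: of_real_eq_iff)
  qed
  finally have "(\<integral>x. indicator {0<..} x *\<^sub>R (f (g x) * g' x) \<partial>lborel) = pi / sin (pi / \<alpha>)"
    unfolding eq unfolding zero_ereal_def interval_integral_to_infinity_eq by (simp add: set_lebesgue_integral_def)
  moreover have "(\<lambda>x. indicator {0<..} x *\<^sub>R (f (g x) * g' x)) = (\<lambda>x. \<alpha> * (indicator {0<..} x * (1 / (1 + p x))))"
    by (auto simp: fun_eq_iff fg split: split_indicator)
  ultimately have "(\<integral>x. \<alpha> * (indicator {0<..} x * (1 / (1 + p x))) \<partial>lborel) = pi / sin (pi / \<alpha>)" by (simp only:)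
  then have "\<alpha> * (\<integral>x. indicator {0<..} x * (1 / (1 + p x)) \<partial>lborel) = pi / sin (pi / \<alpha>)"
    by (simp only: integral_mult_right_zero)
  moreover have "X = pi / (\<alpha> * sin (pi / \<alpha>))" if "\<alpha> * X = pi / sin (pi / \<alpha>)" for X
    using that \<alpha> by (metis divide_divide_eq_left mult.commute nonzero_mult_div_cancel_left not_one_less_zero)
  ultimately have *: "(\<integral>x. indicator {0<..} x * (1 / (1 + p x)) \<partial>lborel) = pi / (\<alpha> * sin (pi / \<alpha>))"
    by blast
  have "half_int \<alpha> 1 1 1 = (\<integral>x. complex_of_real (indicator {0<..} x * (1 / (1 + p x))) \<partial>lborel)"
    unfolding half_int_def p_def by (intro Bochner_Integration.integral_cong) (auto simp: scaleR_conv_of_real)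
  also have "\<dots> = of_real (\<integral>x. indicator {0<..} x * (1 / (1 + p x)) \<partial>lborel)"
    by (rule integral_complex_of_real)
  finally show ?thesis unfolding * .
qed

section \<open>Characteristic functions with a power singularity at 0\<close>

text \<open>Isolates the facts about the characteristic function that the analysis uses. Strong
  aperiodicity enters only as \<open>norm_phi_less_1\<close>.\<close>

locale stable_char =
  fixes \<phi> :: "real \<Rightarrow> complex" and \<alpha> \<gamma> c :: real
  assumes cont: "continuous_on UNIV \<phi>"
    and phi_0: "\<phi> 0 = 1"
    and norm_phi_le_1: "norm (\<phi> \<theta>) \<le> 1"
    and norm_phi_less_1: "0 < \<bar>\<theta>\<bar> \<Longrightarrow> \<bar>\<theta>\<bar> \<le> pi \<Longrightarrow> norm (\<phi> \<theta>) < 1"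
    and alpha: "1 < \<alpha>" "\<alpha> < 2"
    and gamma: "\<bar>\<gamma>\<bar> \<le> 2 - \<alpha>"
    and c: "c > 0"
    and phi_right: "((\<lambda>\<theta>. (1 - \<phi> \<theta>) / complex_of_real (\<bar>\<theta>\<bar> powr \<alpha>)) \<longlongrightarrow> of_real c * cis (pi * \<gamma> / 2)) (at_right 0)"
    and phi_left: "((\<lambda>\<theta>. (1 - \<phi> \<theta>) / complex_of_real (\<bar>\<theta>\<bar> powr \<alpha>)) \<longlongrightarrow> of_real c * cis (- (pi * \<gamma> / 2))) (at_left 0)"
begin

section \<open>Size of 1 - \<phi> and of 1 - z \<phi>, and the integrals controlled by it\<close>

lemma borel_measurable_phi [measurable]: "\<phi> \<in> borel_measurable borel"
  using cont by (rule borel_measurable_continuous_onI)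

definition Wp :: complex where "Wp = of_real c * cis (pi * \<gamma> / 2)"
definition Wm :: complex where "Wm = of_real c * cis (- (pi * \<gamma> / 2))"

text \<open>From |\<gamma>| \<le> 2 - \<alpha> < 1 the angle lies strictly between -\<pi>/2 and
  \<pi>/2. This is what places \<open>Wp\<close> and \<open>Wm\<close> in the open right half
  plane.\<close>

lemma cos_gamma_pos: "cos (pi * \<gamma> / 2) > 0"
proof -
  have "pi * \<bar>\<gamma>\<bar> < pi * 1" using gamma alpha by (intro mult_strict_left_mono) auto
  then have "\<bar>pi * \<gamma>\<bar> < pi" unfolding abs_mult by simp
  then show ?thesis by (intro cos_gt_zero_pi) (auto simp: abs_less_iff)
qed

lemma Re_W_pos: "Re Wp > 0" "Re Wm > 0"
  unfolding Wp_def Wm_def using c cos_gamma_pos by auto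

text \<open>Rests on 1 - |\<phi>|^2 = 2 Re (1 - \<phi>) - |1 - \<phi>|^2: the first term is of order
  |\<theta>|^\<alpha>, the second of order |\<theta>|^(2 \<alpha>) and negligible. The passage from
  |\<phi>|^2 to |\<phi>| costs a factor 2.\<close>

lemma phi_near_zero:
  "\<forall>\<^sub>F \<theta> in at 0. (c * cos (pi * \<gamma> / 2) / 4) * \<bar>\<theta>\<bar> powr \<alpha> \<le> 1 - norm (\<phi> \<theta>) \<and> norm (1 - \<phi> \<theta>) \<le> 2 * c * \<bar>\<theta>\<bar> powr \<alpha>"
proof -
  define r where "r = c * cos (pi * \<gamma> / 2)"
  have r: "r > 0" using c cos_gamma_pos by (simp add: r_def)
  let ?q = "\<lambda>\<theta>. (1 - \<phi> \<theta>) / complex_of_real (\<bar>\<theta>\<bar> powr \<alpha>)"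
  have q: "\<forall>\<^sub>F \<theta> in at 0. Re (?q \<theta>) > r / 2 \<and> norm (?q \<theta>) < 2 * c"
  proof -
    have "\<forall>\<^sub>F \<theta> in at_right 0. Re (?q \<theta>) > r / 2" "\<forall>\<^sub>F \<theta> in at_left 0. Re (?q \<theta>) > r / 2"
      using r by (intro order_tendstoD(1)[OF tendsto_Re[OF phi_right]] order_tendstoD(1)[OF tendsto_Re[OF phi_left]]; simp add: r_def)+
    moreover have "\<forall>\<^sub>F \<theta> in at_right 0. norm (?q \<theta>) < 2 * c" "\<forall>\<^sub>F \<theta> in at_left 0. norm (?q \<theta>) < 2 * c"
      using c by (intro order_tendstoD(2)[OF tendsto_norm[OF phi_right]] order_tendstoD(2)[OF tendsto_norm[OF phi_left]]; simp add: norm_mult)+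
    ultimately show ?thesis unfolding eventually_at_split eventually_conj_iff by blast
  qed
  have "((\<lambda>\<theta>::real. \<bar>\<theta>\<bar> powr \<alpha>) \<longlongrightarrow> 0) (at 0)"
    using alpha by (intro tendsto_zero_powrI[of _ _ _ \<alpha>]) (auto intro!: tendsto_eq_intros)
  \<comment> \<open>The threshold gives (2 c p)^2 \<le> (r/2) p for p = |\<theta>|^\<alpha>, so the
    quadratic term takes away at most half of the lower bound r p for 2 Re (1 - \<phi>).\<close>
  then have "\<forall>\<^sub>F \<theta>::real in at 0. \<bar>\<theta>\<bar> powr \<alpha> < r / (8 * c\<^sup>2)"
    by (rule order_tendstoD(2)) (use r c in auto)
  moreover have "\<forall>\<^sub>F \<theta>::real in at 0. \<theta> \<noteq> 0" by (simp add: eventually_at_filter)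
  ultimately show ?thesis using q
  proof eventually_elim
    case elim: (elim \<theta>)
    define p where "p = \<bar>\<theta>\<bar> powr \<alpha>"
    have p: "p > 0" using elim by (simp add: p_def)
    define Q where "Q = ?q \<theta>"
    have Q: "Re Q > r / 2" "norm Q < 2 * c" using elim by (auto simp: Q_def)
    have eq: "1 - \<phi> \<theta> = Q * of_real p" using p by (simp add: Q_def p_def)
    have n: "norm (1 - \<phi> \<theta>) \<le> 2 * c * p"
      unfolding eq norm_mult using Q p by (auto intro!: mult_right_mono)
    have "Re (1 - \<phi> \<theta>) = Re Q * p" unfolding eq by simp
    then have R: "Re (1 - \<phi> \<theta>) \<ge> r / 2 * p"
      using Q p by simp
    have e1: "1 - (norm (\<phi> \<theta>))\<^sup>2 = 2 * Re (1 - \<phi> \<theta>) - (norm (1 - \<phi> \<theta>))\<^sup>2"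
      unfolding cmod_power2 by (simp add: power2_eq_square algebra_simps)
    have e2: "(norm (1 - \<phi> \<theta>))\<^sup>2 \<le> r / 2 * p"
    proof -
      have "(norm (1 - \<phi> \<theta>))\<^sup>2 \<le> (2 * c * p)\<^sup>2" using n by (intro power_mono) auto
      also have "\<dots> = (4 * c\<^sup>2 * p) * p" by (simp add: power2_eq_square)
      also have "\<dots> \<le> (r / 2) * p"
        using elim(1) p c by (intro mult_right_mono) (auto simp: p_def[symmetric] field_simps)
      finally show ?thesis .
    qed
    have e3: "1 - (norm (\<phi> \<theta>))\<^sup>2 \<le> 2 * (1 - norm (\<phi> \<theta>))"
    proof -
      have "0 \<le> (1 - norm (\<phi> \<theta>))\<^sup>2" by simp
      then show ?thesis by (simp add: power2_eq_square algebra_simps)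
    qed
    have "r / 4 * p \<le> 1 - norm (\<phi> \<theta>)"
    proof -
      have q: "r / 2 * p = 2 * (r / 4 * p)" by simp
      have "q \<le> m" if "a = 2 * R - N" "N \<le> 2 * q" "a \<le> 2 * m" "2 * q \<le> R" for a R N q m :: real
        using that by linarith
      from this[OF e1 e2[unfolded q] e3 R[unfolded q]] show ?thesis .
    qed
    with n show ?case by (simp add: p_def r_def)
  qed
qed

text \<open>Near 0 the local estimate applies. On the rest of [-\<pi>, \<pi>], a compact set,
  |\<phi>| attains a maximum, which is below 1.\<close>

lemma phi_bounds:
  obtains c2 C1 where "c2 > 0" "C1 > 0"
    "\<And>\<theta>. \<bar>\<theta>\<bar> \<le> pi \<Longrightarrow> c2 * \<bar>\<theta>\<bar> powr \<alpha> \<le> 1 - norm (\<phi> \<theta>)"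
    "\<And>\<theta>. \<bar>\<theta>\<bar> \<le> pi \<Longrightarrow> norm (1 - \<phi> \<theta>) \<le> C1 * \<bar>\<theta>\<bar> powr \<alpha>"
proof -
  define r where "r = c * cos (pi * \<gamma> / 2) / 4"
  have r: "r > 0" using c cos_gamma_pos by (simp add: r_def)
  obtain \<delta> where \<delta>: "\<delta> > 0" "\<And>\<theta>. \<theta> \<noteq> 0 \<Longrightarrow> \<bar>\<theta>\<bar> < \<delta> \<Longrightarrow> r * \<bar>\<theta>\<bar> powr \<alpha> \<le> 1 - norm (\<phi> \<theta>) \<and> norm (1 - \<phi> \<theta>) \<le> 2 * c * \<bar>\<theta>\<bar> powr \<alpha>"
    using phi_near_zero unfolding eventually_at r_def[symmetric] by (auto simp: dist_real_def)
  define d where "d = min \<delta> pi"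
  have d: "0 < d" "d \<le> \<delta>" "d \<le> pi" using \<delta> by (auto simp: d_def)
  define S where "S = {-pi..-d} \<union> {d..pi}"
  have "\<exists>x\<in>S. \<forall>y\<in>S. norm (\<phi> y) \<le> norm (\<phi> x)"
    by (rule continuous_attains_sup) (use d cont in \<open>auto simp: S_def intro!: continuous_on_norm elim: continuous_on_subset\<close>)
  then obtain x where x: "x \<in> S" "\<And>y. y \<in> S \<Longrightarrow> norm (\<phi> y) \<le> norm (\<phi> x)" by blast
  define m where "m = 1 - norm (\<phi> x)"
  have m: "m > 0" using x(1) d norm_phi_less_1[of x] by (auto simp: S_def m_def)
  \<comment> \<open>On \<open>S\<close> the power |\<theta>|^\<alpha> lies between d^\<alpha> and
    \<pi>^\<alpha>, while 1 - |\<phi>| \<ge> m and |1 - \<phi>| \<le> 2; this yields the second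
    entries of the minimum and of the maximum.\<close>
  define c2 where "c2 = min r (m / pi powr \<alpha>)"
  define C1 where "C1 = max (2 * c) (2 / d powr \<alpha>)"
  have "c2 > 0" "C1 > 0" using r m c by (auto simp: c2_def C1_def)
  moreover have "c2 * \<bar>\<theta>\<bar> powr \<alpha> \<le> 1 - norm (\<phi> \<theta>) \<and> norm (1 - \<phi> \<theta>) \<le> C1 * \<bar>\<theta>\<bar> powr \<alpha>" if "\<bar>\<theta>\<bar> \<le> pi" for \<theta>
  proof -
    have "\<theta> = 0 \<or> \<bar>\<theta>\<bar> < d \<or> \<theta> \<in> S" using that by (auto simp: S_def abs_if split: if_splits)
    then consider "\<theta> = 0" | "\<theta> \<noteq> 0" "\<bar>\<theta>\<bar> < d" | "\<theta> \<in> S" by blast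

    then show ?thesis
    proof cases
      case 1
      then show ?thesis using phi_0 by simp
    next
      case 2
      have "c2 * \<bar>\<theta>\<bar> powr \<alpha> \<le> r * \<bar>\<theta>\<bar> powr \<alpha>" "2 * c * \<bar>\<theta>\<bar> powr \<alpha> \<le> C1 * \<bar>\<theta>\<bar> powr \<alpha>"
        by (intro mult_right_mono; simp add: c2_def C1_def)+
      with \<delta>(2)[of \<theta>] 2 d show ?thesis by linarith
    next
      case 3
      have "c2 * \<bar>\<theta>\<bar> powr \<alpha> \<le> (m / pi powr \<alpha>) * pi powr \<alpha>"
        using that alpha m by (intro mult_mono powr_mono2) (auto simp: c2_def)
      also have "\<dots> = m" by simp
      also have "\<dots> \<le> 1 - norm (\<phi> \<theta>)" using x(2)[OF 3] by (simp add: m_def)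
      finally have 4: "c2 * \<bar>\<theta>\<bar> powr \<alpha> \<le> 1 - norm (\<phi> \<theta>)" .
      have "norm (1 - \<phi> \<theta>) \<le> norm (1::complex) + norm (\<phi> \<theta>)" by (rule norm_triangle_ineq4)
      also have "\<dots> \<le> 2" using norm_phi_le_1[of \<theta>] by simp
      also have "2 = (2 / d powr \<alpha>) * d powr \<alpha>" using d by simp
      also have "\<dots> \<le> C1 * \<bar>\<theta>\<bar> powr \<alpha>"
        using 3 d alpha c by (intro mult_mono powr_mono2) (auto simp: S_def C1_def)
      finally show ?thesis using 4 by blast
    qed
  qed
  ultimately show ?thesis using that by blast
qed

text \<open>Let N = |1 - z \<phi>|. From N \<ge> 1 - |\<phi>| one gets |\<theta>|^\<alpha> \<le>
  N/c2, and 1 - z = (1 - z \<phi>) - z (1 - \<phi>) gives |1 - z| \<le> N + C1 |\<theta>|^\<alpha>.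
  Adding the two explains the value of \<kappa>; the bound is uniform in the disc, with no
  restriction to a sector.\<close>

lemma denominator_bound:
  obtains \<kappa> where "\<kappa> > 0" "\<And>z \<theta>. norm z < 1 \<Longrightarrow> \<bar>\<theta>\<bar> \<le> pi \<Longrightarrow> \<kappa> * (norm (1 - z) + \<bar>\<theta>\<bar> powr \<alpha>) \<le> norm (1 - z * \<phi> \<theta>)"
proof -
  obtain c2 C1 where c2: "c2 > 0" "C1 > 0"
    "\<And>\<theta>. \<bar>\<theta>\<bar> \<le> pi \<Longrightarrow> c2 * \<bar>\<theta>\<bar> powr \<alpha> \<le> 1 - norm (\<phi> \<theta>)"
    "\<And>\<theta>. \<bar>\<theta>\<bar> \<le> pi \<Longrightarrow> norm (1 - \<phi> \<theta>) \<le> C1 * \<bar>\<theta>\<bar> powr \<alpha>"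
    using phi_bounds by blast
  define \<kappa> where "\<kappa> = 1 / (1 + C1 / c2 + 1 / c2)"
  have K: "1 + C1 / c2 + 1 / c2 > 0" using c2 by (simp add: add_pos_pos)
  then have "\<kappa> > 0" by (simp add: \<kappa>_def)
  moreover have "\<kappa> * (norm (1 - z) + \<bar>\<theta>\<bar> powr \<alpha>) \<le> norm (1 - z * \<phi> \<theta>)" if z: "norm z < 1" and \<theta>: "\<bar>\<theta>\<bar> \<le> pi" for z \<theta>
  proof -
    let ?N = "norm (1 - z * \<phi> \<theta>)" and ?p = "\<bar>\<theta>\<bar> powr \<alpha>"
    have "norm (z * \<phi> \<theta>) \<le> norm (\<phi> \<theta>)"
      unfolding norm_mult using z by (intro mult_left_le_one_le) auto
    then have "c2 * ?p \<le> 1 - norm (z * \<phi> \<theta>)" using c2(3)[OF \<theta>] by linarith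
    also have "\<dots> \<le> ?N" using norm_triangle_ineq2[of 1 "z * \<phi> \<theta>"] by simp
    finally have p: "?p \<le> ?N / c2" using c2(1) by (simp add: field_simps)
    have "1 - z = (1 - z * \<phi> \<theta>) - z * (1 - \<phi> \<theta>)" by (simp add: algebra_simps)
    then have "norm (1 - z) \<le> ?N + norm (z * (1 - \<phi> \<theta>))" by (metis norm_triangle_ineq4)
    also have "norm (z * (1 - \<phi> \<theta>)) \<le> norm (1 - \<phi> \<theta>)"
      unfolding norm_mult using z by (intro mult_left_le_one_le) auto
    also have "\<dots> \<le> C1 * ?p" by (rule c2(4)[OF \<theta>])
    also have "\<dots> \<le> C1 * (?N / c2)" using p c2 by (intro mult_left_mono) auto
    finally have "norm (1 - z) + ?p \<le> (1 + C1 / c2 + 1 / c2) * ?N" using p by (simp add: algebra_simps)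
    then show ?thesis using K unfolding \<kappa>_def by (simp add: field_simps)
  qed
  ultimately show ?thesis using that by blast
qed

text \<open>For (j, k) = (0, 1), (1, 2), (2, 3) these are 2 \<pi> U, 2 \<pi> U' and \<pi> U''. The
  numerator affects neither the growth bound nor the scaling limit at z = 1, because |\<phi>| \<le>
  1 and \<phi>(0) = 1.\<close>

definition resolvent_int :: "nat \<Rightarrow> nat \<Rightarrow> complex \<Rightarrow> complex" where
  "resolvent_int j k z = (\<integral>\<theta>. indicator {-pi..pi} \<theta> *\<^sub>R (\<phi> \<theta> ^ j / (1 - z * \<phi> \<theta>) ^ k) \<partial>lborel)"

lemma norm_z_phi: "norm z < 1 \<Longrightarrow> norm (z * \<phi> \<theta>) < 1"
  using norm_phi_le_1[of \<theta>] mult_left_le[of "norm (\<phi> \<theta>)" "norm z"] by (simp add: norm_mult)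

lemma inverse_power_le:
  fixes u :: complex
  assumes "0 < b" "b \<le> norm u" "norm p \<le> 1"
  shows "norm (p / u ^ k) \<le> 1 / b ^ k"
proof -
  have "norm (p / u ^ k) = norm p / norm u ^ k" by (simp add: norm_divide norm_power)
  also have "\<dots> \<le> 1 / b ^ k" using assms by (intro frac_le power_mono zero_less_power) auto
  finally show ?thesis .
qed

lemma integrable_resolvent_int:
  assumes z: "norm z < 1"
  shows "integrable lborel (\<lambda>\<theta>. indicator {-pi..pi} \<theta> *\<^sub>R (\<phi> \<theta> ^ j / (1 - z * \<phi> \<theta>) ^ k))"
proof (rule Bochner_Integration.integrable_bound)
  show "integrable lborel (\<lambda>\<theta>. indicator {-pi..pi} \<theta> *\<^sub>R (1 / (1 - norm z) ^ k))" by simp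
  have "norm (\<phi> \<theta> ^ j / (1 - z * \<phi> \<theta>) ^ k) \<le> 1 / (1 - norm z) ^ k" for \<theta>
  proof (rule inverse_power_le)
    have "norm (z * \<phi> \<theta>) \<le> norm z" unfolding norm_mult using norm_phi_le_1[of \<theta>] by (intro mult_left_le) auto
    then show "1 - norm z \<le> norm (1 - z * \<phi> \<theta>)" using norm_triangle_ineq2[of 1 "z * \<phi> \<theta>"] by simp
    show "norm (\<phi> \<theta> ^ j) \<le> 1" unfolding norm_power by (intro power_le_one norm_phi_le_1) auto
  qed (use z in auto)
  then show "AE \<theta> in lborel. norm (indicator {-pi..pi} \<theta> *\<^sub>R (\<phi> \<theta> ^ j / (1 - z * \<phi> \<theta>) ^ k)) \<le> norm (indicator {-pi..pi} \<theta> *\<^sub>R (1 / (1 - norm z) ^ k))"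
    using z by (auto split: split_indicator simp: abs_of_nonneg)
qed measurable

text \<open>With \<tau> = |1 - z| and \<theta> = t x, where t = \<tau>^(1/\<alpha>), the lower bound
  for the denominator becomes \<kappa> \<tau> (1 + |x|^\<alpha>). The k-th power gives \<tau>^(-k)
  and the Jacobian gives t.\<close>

lemma resolvent_int_upper:
  assumes k: "k \<ge> 1"
  obtains C where "C \<ge> 0" "\<And>z. norm z < 1 \<Longrightarrow> norm (resolvent_int j k z) \<le> C * norm (1 - z) powr (1 / \<alpha> - real k)"
proof -
  obtain \<kappa> where \<kappa>: "\<kappa> > 0" "\<And>z \<theta>. norm z < 1 \<Longrightarrow> \<bar>\<theta>\<bar> \<le> pi \<Longrightarrow> \<kappa> * (norm (1 - z) + \<bar>\<theta>\<bar> powr \<alpha>) \<le> norm (1 - z * \<phi> \<theta>)"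
    using denominator_bound by blast
  define K where "K = (\<integral>x. 1 / (1 + \<bar>x::real\<bar> powr \<alpha>) \<partial>lborel)"
  have K: "K \<ge> 0" unfolding K_def by (intro integral_nonneg_AE) (auto intro!: add_nonneg_nonneg)
  have "norm (resolvent_int j k z) \<le> (K / \<kappa> ^ k) * norm (1 - z) powr (1 / \<alpha> - real k)" if z: "norm z < 1" for z
  proof -
    define \<tau> where "\<tau> = norm (1 - z)"
    have \<tau>: "\<tau> > 0" using z by (auto simp: \<tau>_def)
    define t where "t = \<tau> powr (1 / \<alpha>)"
    have t: "t > 0" "t powr \<alpha> = \<tau>" using \<tau> alpha by (auto simp: t_def powr_powr)
    let ?f = "\<lambda>\<theta>. indicator {-pi..pi} \<theta> *\<^sub>R (\<phi> \<theta> ^ j / (1 - z * \<phi> \<theta>) ^ k)"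
    have fb: "norm (?f (0 + t * x)) \<le> (1 / (\<kappa> ^ k * \<tau> ^ k)) * (1 / (1 + \<bar>x\<bar> powr \<alpha>))" for x
    proof (cases "\<bar>t * x\<bar> \<le> pi")
      case True
      have e: "\<bar>t * x\<bar> powr \<alpha> = \<tau> * \<bar>x\<bar> powr \<alpha>" using t by (simp add: abs_mult powr_mult)
      have "norm (\<phi> (t * x) ^ j / (1 - z * \<phi> (t * x)) ^ k) \<le> 1 / (\<kappa> * (\<tau> * (1 + \<bar>x\<bar> powr \<alpha>))) ^ k"
      proof (rule inverse_power_le)
        show "0 < \<kappa> * (\<tau> * (1 + \<bar>x\<bar> powr \<alpha>))" using \<kappa> \<tau> by (intro mult_pos_pos add_pos_nonneg) auto
        show "\<kappa> * (\<tau> * (1 + \<bar>x\<bar> powr \<alpha>)) \<le> norm (1 - z * \<phi> (t * x))"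
          using \<kappa>(2)[OF z True] unfolding e \<tau>_def[symmetric] by (simp add: algebra_simps)
        show "norm (\<phi> (t * x) ^ j) \<le> 1" unfolding norm_power by (intro power_le_one norm_phi_le_1) auto
      qed
      also have "\<dots> = (1 / (\<kappa> ^ k * \<tau> ^ k)) * (1 / (1 + \<bar>x\<bar> powr \<alpha>) ^ k)" by (simp add: power_mult_distrib)
      also have "\<dots> \<le> (1 / (\<kappa> ^ k * \<tau> ^ k)) * (1 / (1 + \<bar>x\<bar> powr \<alpha>))"
        using \<kappa> \<tau> k self_le_power[of "1 + \<bar>x\<bar> powr \<alpha>" k] by (intro mult_left_mono divide_left_mono mult_pos_pos zero_less_power add_pos_nonneg) auto
      finally show ?thesis using True by (simp add: abs_le_iff)
    next
      case False
      then have "norm (?f (0 + t * x)) = 0" by (auto split: split_indicator)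
      also have "0 \<le> (1 / (\<kappa> ^ k * \<tau> ^ k)) * (1 / (1 + \<bar>x\<bar> powr \<alpha>))"
        using \<kappa> \<tau> by (intro mult_nonneg_nonneg divide_nonneg_nonneg add_nonneg_nonneg) auto
      finally show ?thesis .
    qed
    have "resolvent_int j k z = \<bar>t\<bar> *\<^sub>R (\<integral>x. ?f (0 + t * x) \<partial>lborel)"
      unfolding resolvent_int_def by (rule lborel_integral_real_affine) (use t in auto)
    then have nV: "norm (resolvent_int j k z) = t * norm (\<integral>x. ?f (0 + t * x) \<partial>lborel)" using t by simp
    have "norm (\<integral>x. ?f (0 + t * x) \<partial>lborel) \<le> (\<integral>x. (1 / (\<kappa> ^ k * \<tau> ^ k)) * (1 / (1 + \<bar>x\<bar> powr \<alpha>)) \<partial>lborel)"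
    proof (rule Bochner_Integration.integral_norm_bound_integral)
      show "integrable lborel (\<lambda>x. ?f (0 + t * x))"
        by (rule lborel_integrable_real_affine[OF integrable_resolvent_int[OF z]]) (use t in auto)
      show "integrable lborel (\<lambda>x. (1 / (\<kappa> ^ k * \<tau> ^ k)) * (1 / (1 + \<bar>x\<bar> powr \<alpha>)))"
        by (intro integrable_mult_right integrable_inverse_one_plus_powr alpha)
    qed (rule fb)
    also have "\<dots> = (1 / (\<kappa> ^ k * \<tau> ^ k)) * K" unfolding K_def by (rule integral_mult_right_zero)
    finally have "norm (resolvent_int j k z) \<le> t * ((1 / (\<kappa> ^ k * \<tau> ^ k)) * K)"
      unfolding nV using t(1) by (rule mult_left_mono[OF _ less_imp_le])
    also have "\<dots> = (K / \<kappa> ^ k) * (t / \<tau> ^ k)" by simp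
    also have "t / \<tau> ^ k = \<tau> powr (1 / \<alpha> - real k)" using \<tau> by (simp add: t_def powr_diff powr_realpow)
    finally show ?thesis by (simp add: \<tau>_def)
  qed
  moreover have "K / \<kappa> ^ k \<ge> 0" using K \<kappa> by simp
  ultimately show ?thesis using that by blast
qed

text \<open>Needed because U occurs in the denominators of F''. The real part of 1/(1 - z \<phi>) is
  nonnegative, so nothing cancels and it is enough to integrate over [t/2, t] with t = |1 -
  z|^(1/\<alpha>), where numerator and denominator are both controlled.\<close>

lemma resolvent_int_lower:
  obtains C where "C > 0" "\<And>z. norm z < 1 \<Longrightarrow> C * norm (1 - z) powr (1 / \<alpha> - 1) \<le> norm (resolvent_int 0 1 z)"
proof -
  obtain c2 C1 where c2: "c2 > 0" "C1 > 0"
    "\<And>\<theta>. \<bar>\<theta>\<bar> \<le> pi \<Longrightarrow> c2 * \<bar>\<theta>\<bar> powr \<alpha> \<le> 1 - norm (\<phi> \<theta>)"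
    "\<And>\<theta>. \<bar>\<theta>\<bar> \<le> pi \<Longrightarrow> norm (1 - \<phi> \<theta>) \<le> C1 * \<bar>\<theta>\<bar> powr \<alpha>"
    using phi_bounds by blast
  \<comment> \<open>On [t/2, t] the denominator u satisfies Re u \<ge> c2 \<tau> / 2^\<alpha> and
    |u| \<le> (1 + C1) \<tau>, so Re (1/u) = Re u / |u|^2 \<ge> B/\<tau>.\<close>
  define B where "B = c2 / (2 powr \<alpha> * (1 + C1)\<^sup>2)"
  have B: "B > 0" using c2 by (simp add: B_def)
  have "B / 2 * norm (1 - z) powr (1 / \<alpha> - 1) \<le> norm (resolvent_int 0 1 z)" if z: "norm z < 1" for z
  proof -
    define \<tau> where "\<tau> = norm (1 - z)"
    have \<tau>: "\<tau> > 0" using z by (auto simp: \<tau>_def)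
    have \<tau>2: "\<tau> \<le> 2" using norm_triangle_ineq4[of 1 z] z by (simp add: \<tau>_def)
    define t where "t = \<tau> powr (1 / \<alpha>)"
    have t: "t > 0" "t powr \<alpha> = \<tau>" using \<tau> alpha by (auto simp: t_def powr_powr)
    \<comment> \<open>Since 2 < \<pi>, the interval [t/2, t] stays inside the domain of
      integration.\<close>
    have t2: "t \<le> 2"
    proof -
      have "t \<le> 2 powr (1 / \<alpha>)" unfolding t_def using \<tau> \<tau>2 alpha by (intro powr_mono2) auto
      also have "\<dots> \<le> 2 powr 1" using alpha by (intro powr_mono) auto
      finally show ?thesis by simp
    qed
    let ?f = "\<lambda>\<theta>. indicator {-pi..pi} \<theta> *\<^sub>R (\<phi> \<theta> ^ 0 / (1 - z * \<phi> \<theta>) ^ 1)"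
    have Re_ge: "c2 * \<bar>\<theta>\<bar> powr \<alpha> \<le> Re (1 - z * \<phi> \<theta>)" if "\<bar>\<theta>\<bar> \<le> pi" for \<theta>
    proof -
      have "Re (z * \<phi> \<theta>) \<le> norm (z * \<phi> \<theta>)" by (rule complex_Re_le_cmod)
      also have "\<dots> \<le> norm (\<phi> \<theta>)"
        unfolding norm_mult using z by (intro mult_left_le_one_le) auto
      finally show ?thesis using c2(3)[OF that] by simp
    qed
    have Re_inv: "Re (1 / u) = Re u / (norm u)\<^sup>2" for u :: complex
      by (simp add: Re_divide cmod_power2)
    have low: "indicator {t/2..t} \<theta> * (B / \<tau>) \<le> Re (?f \<theta>)" for \<theta>
    proof (cases "\<theta> \<in> {-pi..pi}")
      case True
      then have th: "\<bar>\<theta>\<bar> \<le> pi" by auto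
      have nn: "0 \<le> Re (1 - z * \<phi> \<theta>)" using Re_ge[OF th] c2 by (meson mult_nonneg_nonneg order_trans powr_ge_zero less_imp_le)
      show ?thesis
      proof (cases "\<theta> \<in> {t/2..t}")
        case True
        define u where "u = 1 - z * \<phi> \<theta>"
        have "u \<noteq> 0" using norm_z_phi[OF z, of \<theta>] by (auto simp: u_def)
        have p1: "\<bar>\<theta>\<bar> powr \<alpha> \<le> \<tau>" unfolding t(2)[symmetric] using True t alpha by (intro powr_mono2) auto
        have "(t / 2) powr \<alpha> \<le> \<bar>\<theta>\<bar> powr \<alpha>" using True t alpha by (intro powr_mono2) auto
        then have p2: "\<tau> / 2 powr \<alpha> \<le> \<bar>\<theta>\<bar> powr \<alpha>" using t by (simp add: powr_divide)
        have "u = (1 - z) + z * (1 - \<phi> \<theta>)" by (simp add: u_def algebra_simps)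
        then have "norm u \<le> \<tau> + norm (z * (1 - \<phi> \<theta>))" unfolding \<tau>_def by (metis norm_triangle_ineq)
        also have "norm (z * (1 - \<phi> \<theta>)) \<le> norm (1 - \<phi> \<theta>)"
          unfolding norm_mult using z by (intro mult_left_le_one_le) auto
        also have "\<dots> \<le> C1 * \<bar>\<theta>\<bar> powr \<alpha>" by (rule c2(4)[OF th])
        also have "\<dots> \<le> C1 * \<tau>" using p1 c2 by (intro mult_left_mono) auto
        finally have nu: "norm u \<le> (1 + C1) * \<tau>" by (simp add: algebra_simps)
        have "c2 * (\<tau> / 2 powr \<alpha>) \<le> c2 * \<bar>\<theta>\<bar> powr \<alpha>" using p2 c2 by (intro mult_left_mono) auto
        also have "\<dots> \<le> Re u" unfolding u_def by (rule Re_ge[OF th])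
        finally have ru: "c2 * (\<tau> / 2 powr \<alpha>) \<le> Re u" .
        have "B / \<tau> = c2 * (\<tau> / 2 powr \<alpha>) / ((1 + C1) * \<tau>)\<^sup>2"
        proof -
          have "c / (p * K\<^sup>2) / \<tau> = c * (\<tau> / p) / (K * \<tau>)\<^sup>2" for c p K :: real
            using \<tau> by (simp add: power2_eq_square)
          then show ?thesis unfolding B_def .
        qed
        also have "\<dots> \<le> Re u / (norm u)\<^sup>2"
          using ru nu \<open>u \<noteq> 0\<close> order_trans[OF _ ru] c2 \<tau> by (intro frac_le power_mono) auto
        also have "\<dots> = Re (1 / u)" by (rule Re_inv[symmetric])
        finally show ?thesis using True th by (auto simp: u_def split: split_indicator)
      next
        case False
        then show ?thesis using nn Re_inv[of "1 - z * \<phi> \<theta>"] th by (auto simp del: complex_Re_of_int split: split_indicator)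
      qed
    next
      case False
      then have "\<theta> \<notin> {t/2..t}" using t t2 pi_gt3 by auto
      then show ?thesis using False by simp
    qed
    have "B / 2 * \<tau> powr (1 / \<alpha> - 1) = (t - t/2) * (B / \<tau>)"
      using \<tau> by (simp add: t_def powr_diff)
    also have "\<dots> = (\<integral>\<theta>. indicator {t/2..t} \<theta> * (B / \<tau>) \<partial>lborel)" using t by simp
    also have "\<dots> \<le> (\<integral>\<theta>. Re (?f \<theta>) \<partial>lborel)"
    proof (rule integral_mono)
      show "integrable lborel (\<lambda>\<theta>. indicator {t/2..t} \<theta> * (B / \<tau>))" by (intro integrable_mult_left integrable_real_indicator) (auto simp: emeasure_lborel_Icc_eq)
      show "integrable lborel (\<lambda>\<theta>. Re (?f \<theta>))" by (rule integrable_Re[OF integrable_resolvent_int[OF z]])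
    qed (rule low)
    also have "\<dots> = Re (resolvent_int 0 1 z)" unfolding resolvent_int_def by (rule integral_Re[OF integrable_resolvent_int[OF z]])
    also have "\<dots> \<le> norm (resolvent_int 0 1 z)" by (rule complex_Re_le_cmod)
    finally show ?thesis by (simp add: \<tau>_def)
  qed
  moreover have "B / 2 > 0" using B by simp
  ultimately show ?thesis using that by blast
qed

section \<open>The scaling limit of the resolvent integrals\<close>

definition full_int :: "nat \<Rightarrow> complex \<Rightarrow> complex" where
  "full_int k \<mu> = half_int \<alpha> k \<mu> Wp + half_int \<alpha> k \<mu> Wm"

lemma full_int_eq:
  assumes "0 < Re \<mu>" "k \<ge> 1"
  shows "(\<integral>x. 1 / (\<mu> + (if x > 0 then Wp else Wm) * of_real (\<bar>x\<bar> powr \<alpha>)) ^ k \<partial>lborel) = full_int k \<mu>"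
proof -
  let ?h = "\<lambda>W x. indicator {0<..} x *\<^sub>R (1 / (\<mu> + W * of_real (x powr \<alpha>)) ^ k)"
  have "(\<integral>x. 1 / (\<mu> + (if x > 0 then Wp else Wm) * of_real (\<bar>x\<bar> powr \<alpha>)) ^ k \<partial>lborel)
      = (\<integral>x. ?h Wp x + ?h Wm (0 + (-1) * x) \<partial>lborel)"
  proof (rule integral_cong_AE)
    show "AE x in lborel. 1 / (\<mu> + (if x > 0 then Wp else Wm) * of_real (\<bar>x\<bar> powr \<alpha>)) ^ k = ?h Wp x + ?h Wm (0 + (-1) * x)"
      using AE_lborel_singleton[of 0] by eventually_elim (auto split: split_indicator)
  qed measurable
  also have "\<dots> = (\<integral>x. ?h Wp x \<partial>lborel) + (\<integral>x. ?h Wm (0 + (-1) * x) \<partial>lborel)"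
    by (intro Bochner_Integration.integral_add lborel_integrable_real_affine[of "?h Wm"] integrable_half_int)
       (use alpha assms Re_W_pos in auto)
  also have "(\<integral>x. ?h Wm (0 + (-1) * x) \<partial>lborel) = (\<integral>x. ?h Wm x \<partial>lborel)"
    using lborel_integral_real_affine[of "-1" "?h Wm" 0] by simp
  finally show ?thesis by (simp add: full_int_def half_int_def)
qed

text \<open>Substitute \<theta> = n^(-1/\<alpha>) x. Then n (1 - z \<phi>) = n (1 - z) + z n (1 -
  \<phi>), where the last part tends to \<open>Wp\<close> or \<open>Wm\<close> times |x|^\<alpha>
  according to the sign of x. The uniform lower bound on 1 - z \<phi> supplies the majorant.\<close>

lemma resolvent_int_limit:
  fixes z :: "nat \<Rightarrow> complex"
  assumes z: "\<And>n. n \<ge> 1 \<Longrightarrow> norm (z n) < 1"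
    and lim: "(\<lambda>n. of_nat n * (1 - z n)) \<longlonglongrightarrow> \<mu>" and \<mu>: "0 < Re \<mu>" and k: "k \<ge> 1"
  shows "(\<lambda>n. of_real (real n powr (1 / \<alpha> - real k)) * resolvent_int j k (z n)) \<longlonglongrightarrow> full_int k \<mu>"
proof -
  obtain \<kappa> where \<kappa>: "\<kappa> > 0" "\<And>z \<theta>. norm z < 1 \<Longrightarrow> \<bar>\<theta>\<bar> \<le> pi \<Longrightarrow> \<kappa> * (norm (1 - z) + \<bar>\<theta>\<bar> powr \<alpha>) \<le> norm (1 - z * \<phi> \<theta>)"
    using denominator_bound by blast
  define s where "s = (\<lambda>n. 1 / real n powr (1 / \<alpha>))"
  have s0: "s n > 0" if "n \<ge> 1" for n using that by (simp add: s_def)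
  have sa: "s n powr \<alpha> = 1 / real n" if "n \<ge> 1" for n
    using that alpha by (simp add: s_def powr_divide powr_powr)
  have s_lim: "s \<longlonglongrightarrow> 0"
  proof -
    have "(\<lambda>n. real n powr (- (1 / \<alpha>))) \<longlonglongrightarrow> 0"
      using alpha by (intro tendsto_neg_powr filterlim_real_sequentially) auto
    then show ?thesis by (simp add: s_def powr_minus_divide)
  qed
  define f where "f = (\<lambda>n x. indicator {-pi..pi} (s n * x) *\<^sub>R (\<phi> (s n * x) ^ j / (of_nat n * (1 - z n * \<phi> (s n * x))) ^ k))"
  have eq: "of_real (real n powr (1 / \<alpha> - real k)) * resolvent_int j k (z n) = (\<integral>x. f n x \<partial>lborel)" if n: "n \<ge> 1" for n
  proof -
    let ?g = "\<lambda>\<theta>. indicator {-pi..pi} \<theta> *\<^sub>R (\<phi> \<theta> ^ j / (1 - z n * \<phi> \<theta>) ^ k)"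
    have "resolvent_int j k (z n) = \<bar>s n\<bar> *\<^sub>R (\<integral>x. ?g (0 + s n * x) \<partial>lborel)"
      unfolding resolvent_int_def by (rule lborel_integral_real_affine) (use s0[OF n] in auto)
    also have "(\<lambda>x. ?g (0 + s n * x)) = (\<lambda>x. of_nat n ^ k * f n x)"
      using n by (auto simp: f_def fun_eq_iff power_mult_distrib split: split_indicator)
    also have "(\<integral>x. of_nat n ^ k * f n x \<partial>lborel) = of_nat n ^ k * (\<integral>x. f n x \<partial>lborel)"
      by (rule integral_mult_right_zero)
    finally have e: "resolvent_int j k (z n) = of_real (s n * real n ^ k) * (\<integral>x. f n x \<partial>lborel)"
      using s0[OF n] by (simp add: scaleR_conv_of_real)
    have "real n powr (1 / \<alpha> - real k) * (s n * real n ^ k) = 1"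
      using n by (simp add: s_def powr_diff powr_realpow)
    then show ?thesis unfolding e mult.assoc[symmetric] of_real_mult[symmetric] by simp
  qed
  have zlim: "z \<longlonglongrightarrow> 1"
  proof -
    have "(\<lambda>n. 1 - (of_nat n * (1 - z n)) * of_real (1 / real n)) \<longlonglongrightarrow> 1 - \<mu> * of_real 0"
      by (intro tendsto_intros lim lim_const_over_n)
    then show ?thesis
    proof (rule Lim_transform_eventually[OF tendsto_eq_rhs])
      show "\<forall>\<^sub>F n in sequentially. 1 - (of_nat n * (1 - z n)) * of_real (1 / real n) = z n"
        using eventually_gt_at_top[of 0] by eventually_elim auto
    qed simp
  qed
  \<comment> \<open>Chosen so that, once n |1 - z n| exceeds |\<mu>|/2, its sum with |x|^\<alpha> is
    at least \<nu> (1 + |x|^\<alpha>). The shift by \<open>Suc N\<close> below secures this and n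
    \<ge> 1.\<close>
  define \<nu> where "\<nu> = min (norm \<mu> / 2) 1"
  have \<nu>: "\<nu> > 0" using \<mu> by (auto simp: \<nu>_def)
  have "\<forall>\<^sub>F n in sequentially. norm (of_nat n * (1 - z n)) > norm \<mu> / 2"
    by (rule order_tendstoD(1)[OF tendsto_norm[OF lim]]) (use \<mu> in auto)
  then obtain N where N: "\<And>n. n \<ge> N \<Longrightarrow> norm (of_nat n * (1 - z n)) > norm \<mu> / 2"
    unfolding eventually_sequentially by blast
  have "(\<lambda>n. \<integral>x. f (n + Suc N) x \<partial>lborel) \<longlonglongrightarrow> (\<integral>x. 1 / (\<mu> + (if x > 0 then Wp else Wm) * of_real (\<bar>x\<bar> powr \<alpha>)) ^ k \<partial>lborel)"
  proof (rule integral_dominated_convergence)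
    show "integrable lborel (\<lambda>x. (1 / (\<kappa> * \<nu>) ^ k) * (1 / (1 + \<bar>x\<bar> powr \<alpha>)))"
      by (intro integrable_mult_right integrable_inverse_one_plus_powr alpha)
    show "f (n + Suc N) \<in> borel_measurable lborel" for n unfolding f_def by measurable
    have fb: "norm (f n x) \<le> (1 / (\<kappa> * \<nu>) ^ k) * (1 / (1 + \<bar>x\<bar> powr \<alpha>))" if n: "n \<ge> Suc N" for n x
    proof (cases "s n * x \<in> {-pi..pi}")
      case True
      have n1: "n \<ge> 1" using n by simp
      from True have th: "\<bar>s n * x\<bar> \<le> pi" by auto
      have "\<bar>s n * x\<bar> powr \<alpha> = \<bar>x\<bar> powr \<alpha> / real n"
        using s0[OF n1] sa[OF n1] by (simp add: abs_mult powr_mult)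
      with \<kappa>(2)[OF z[OF n1] th] have "\<kappa> * (norm (1 - z n) + \<bar>x\<bar> powr \<alpha> / real n) \<le> norm (1 - z n * \<phi> (s n * x))" by simp
      from mult_left_mono[OF this, of "real n"]
      have b: "\<kappa> * (norm (of_nat n * (1 - z n)) + \<bar>x\<bar> powr \<alpha>) \<le> norm (of_nat n * (1 - z n * \<phi> (s n * x)))"
        using n1 unfolding norm_mult by (simp add: distrib_left mult.left_commute)
      have "\<nu> * (1 + \<bar>x\<bar> powr \<alpha>) \<le> norm (of_nat n * (1 - z n)) + \<bar>x\<bar> powr \<alpha>"
      proof -
        have "\<nu> \<le> norm (of_nat n * (1 - z n))" using N[of n] n by (simp add: \<nu>_def)
        moreover have "\<nu> * \<bar>x\<bar> powr \<alpha> \<le> 1 * \<bar>x\<bar> powr \<alpha>" by (intro mult_right_mono) (auto simp: \<nu>_def)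
        ultimately show ?thesis by (simp add: algebra_simps)
      qed
      from mult_left_mono[OF this, of \<kappa>] b \<kappa>(1)
      have b2: "\<kappa> * \<nu> * (1 + \<bar>x\<bar> powr \<alpha>) \<le> norm (of_nat n * (1 - z n * \<phi> (s n * x)))" unfolding mult.assoc by linarith
      have "norm (\<phi> (s n * x) ^ j / (of_nat n * (1 - z n * \<phi> (s n * x))) ^ k) \<le> 1 / (\<kappa> * \<nu> * (1 + \<bar>x\<bar> powr \<alpha>)) ^ k"
      proof (rule inverse_power_le[OF _ b2])
        show "0 < \<kappa> * \<nu> * (1 + \<bar>x\<bar> powr \<alpha>)" using \<kappa> \<nu> by (intro mult_pos_pos add_pos_nonneg) auto
        show "norm (\<phi> (s n * x) ^ j) \<le> 1" unfolding norm_power by (intro power_le_one norm_phi_le_1) auto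
      qed
      also have "\<dots> = (1 / (\<kappa> * \<nu>) ^ k) * (1 / (1 + \<bar>x\<bar> powr \<alpha>) ^ k)" by (simp add: power_mult_distrib)
      also have "\<dots> \<le> (1 / (\<kappa> * \<nu>) ^ k) * (1 / (1 + \<bar>x\<bar> powr \<alpha>))"
        using \<kappa> \<nu> k self_le_power[of "1 + \<bar>x\<bar> powr \<alpha>" k] by (intro mult_left_mono divide_left_mono mult_pos_pos zero_less_power add_pos_nonneg) auto
      finally show ?thesis using True by (simp add: f_def)
    next
      case False
      then show ?thesis using \<kappa> \<nu> by (auto simp: f_def intro!: add_nonneg_nonneg)
    qed
    show "AE x in lborel. norm (f (n + Suc N) x) \<le> (1 / (\<kappa> * \<nu>) ^ k) * (1 / (1 + \<bar>x\<bar> powr \<alpha>))" for n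
      by (intro AE_I2 fb) simp
    have flim: "(\<lambda>n. f n x) \<longlonglongrightarrow> 1 / (\<mu> + (if x > 0 then Wp else Wm) * of_real (\<bar>x\<bar> powr \<alpha>)) ^ k" if x: "x \<noteq> 0" for x
    proof -
      let ?W = "if x > 0 then Wp else Wm"
      have sx: "(\<lambda>n. s n * x) \<longlonglongrightarrow> 0" using tendsto_mult[OF s_lim tendsto_const, of x] by simp
      have q: "(\<lambda>n. (1 - \<phi> (s n * x)) / of_real (\<bar>s n * x\<bar> powr \<alpha>)) \<longlonglongrightarrow> ?W"
      proof (cases "x > 0")
        case True
        have "filterlim (\<lambda>n. s n * x) (at_right 0) sequentially"
          using sx s0 True by (auto simp: filterlim_at eventually_sequentially less_imp_neq[symmetric] intro!: exI[of _ 1])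
        from filterlim_compose[OF phi_right this] True show ?thesis by (simp add: Wp_def)
      next
        case False
        have "filterlim (\<lambda>n. s n * x) (at_left 0) sequentially"
          using sx s0 False x by (auto simp: filterlim_at eventually_sequentially mult_pos_neg less_imp_neq[symmetric] intro!: exI[of _ 1])
        from filterlim_compose[OF phi_left this] False show ?thesis by (simp add: Wm_def)
      qed
      have p1: "(\<lambda>n. \<phi> (s n * x)) \<longlonglongrightarrow> 1"
        using continuous_on_tendsto_compose[OF cont sx] phi_0 by simp
      have den: "(\<lambda>n. of_nat n * (1 - z n) + z n * (((1 - \<phi> (s n * x)) / of_real (\<bar>s n * x\<bar> powr \<alpha>)) * of_real (\<bar>x\<bar> powr \<alpha>))) \<longlonglongrightarrow> \<mu> + 1 * (?W * of_real (\<bar>x\<bar> powr \<alpha>))"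
        by (intro tendsto_intros lim zlim q)
      have den': "(\<lambda>n. of_nat n * (1 - z n * \<phi> (s n * x))) \<longlonglongrightarrow> \<mu> + ?W * of_real (\<bar>x\<bar> powr \<alpha>)"
      proof (rule Lim_transform_eventually[OF tendsto_eq_rhs[OF den]])
        show "\<forall>\<^sub>F n in sequentially. of_nat n * (1 - z n) + z n * (((1 - \<phi> (s n * x)) / of_real (\<bar>s n * x\<bar> powr \<alpha>)) * of_real (\<bar>x\<bar> powr \<alpha>)) = of_nat n * (1 - z n * \<phi> (s n * x))"
          using eventually_ge_at_top[of 1]
        proof eventually_elim
          case (elim n)
          have "\<bar>s n * x\<bar> powr \<alpha> = \<bar>x\<bar> powr \<alpha> / real n"
            using s0[OF elim] sa[OF elim] by (simp add: abs_mult powr_mult)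
          then have e: "((1 - \<phi> (s n * x)) / of_real (\<bar>s n * x\<bar> powr \<alpha>)) * of_real (\<bar>x\<bar> powr \<alpha>) = of_nat n * (1 - \<phi> (s n * x))"
            using x by simp
          show ?case unfolding e by (simp add: algebra_simps)
        qed
      qed simp
      have "\<mu> + ?W * of_real (\<bar>x\<bar> powr \<alpha>) \<noteq> 0"
        using affine_nonzero[of "\<bar>x\<bar> powr \<alpha>" \<mu> ?W] \<mu> Re_W_pos by auto
      then have l: "(\<lambda>n. \<phi> (s n * x) ^ j / (of_nat n * (1 - z n * \<phi> (s n * x))) ^ k) \<longlonglongrightarrow> 1 ^ j / (\<mu> + ?W * of_real (\<bar>x\<bar> powr \<alpha>)) ^ k"
        by (intro tendsto_intros p1 den') auto
      have "\<forall>\<^sub>F n in sequentially. s n * x \<in> {-pi<..<pi}"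
        by (rule topological_tendstoD[OF sx]) auto
      then show ?thesis
        by (intro Lim_transform_eventually[OF tendsto_eq_rhs[OF l]]) (auto simp: f_def elim!: eventually_mono)
    qed
    show "AE x in lborel. (\<lambda>n. f (n + Suc N) x) \<longlonglongrightarrow> 1 / (\<mu> + (if x > 0 then Wp else Wm) * of_real (\<bar>x\<bar> powr \<alpha>)) ^ k"
      using AE_lborel_singleton[of 0] by eventually_elim (intro LIMSEQ_ignore_initial_segment flim)
  qed measurable
  then have "(\<lambda>n. \<integral>x. f n x \<partial>lborel) \<longlonglongrightarrow> full_int k \<mu>"
    unfolding full_int_eq[OF \<mu> k] by (rule LIMSEQ_offset)
  then show ?thesis
  proof (rule Lim_transform_eventually)
    show "\<forall>\<^sub>F n in sequentially. (\<integral>x. f n x \<partial>lborel) = of_real (real n powr (1 / \<alpha> - real k)) * resolvent_int j k (z n)"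
      using eventually_ge_at_top[of 1] by eventually_elim (simp add: eq)
  qed
qed

end

section \<open>The renewal equation\<close>

text \<open>Formulated with \<open>deriv f\<close> in place of a sum, so that the conclusion has the
  shape of the hypothesis and the lemma can be applied a second time.\<close>

lemma power_series_deriv:
  fixes c :: "nat \<Rightarrow> complex"
  assumes sums: "\<And>z. norm z < 1 \<Longrightarrow> (\<lambda>n. c n * z ^ n) sums f z" and z: "norm z < 1"
  shows "(\<lambda>n. diffs c n * z ^ n) sums deriv f z" "(f has_field_derivative deriv f z) (at z)"
proof -
  have s: "summable (\<lambda>n. c n * w ^ n)" if "norm w < 1" for w using sums[OF that] by (simp add: sums_iff)
  have d0: "((\<lambda>w. \<Sum>n. c n * w ^ n) has_field_derivative (\<Sum>n. diffs c n * z ^ n)) (at z)"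
    by (rule termdiffs_strong'[OF s z])
  have e0: "(\<Sum>n. c n * w ^ n) = f w" if "w \<in> ball 0 1" for w
    using sums[of w] that by (simp add: sums_iff)
  have d: "(f has_field_derivative (\<Sum>n. diffs c n * z ^ n)) (at z)"
    by (rule has_field_derivative_transform_within_open[OF d0 open_ball[of 0 1] _ e0]) (use z in auto)
  then have e: "deriv f z = (\<Sum>n. diffs c n * z ^ n)" by (rule DERIV_imp_deriv)
  with d show "(f has_field_derivative deriv f z) (at z)" by simp
  have "summable (\<lambda>n. diffs c n * z ^ n)"
    by (rule termdiff_converges[OF z s])
  then show "(\<lambda>n. diffs c n * z ^ n) sums deriv f z" unfolding e by (rule summable_sums)
qed

lemma geometric_second_deriv_sums:
  fixes z :: complex
  assumes "norm z < 1"
  shows "(\<lambda>n. of_nat ((n + 1) * (n + 2)) * z ^ n) sums (2 * (1 / (1 - z) ^ 3))"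
proof -
  have g: "(\<lambda>n. of_nat (Suc n) * w ^ n) sums (1 / (1 - w) ^ 2)" if "norm w < 1" for w :: complex
    by (rule geometric_deriv_sums[OF that])
  have "((\<lambda>w. 1 / (1 - w) ^ 2) has_field_derivative 2 * (1 / (1 - z) ^ 3)) (at z)"
  proof -
    have nz: "1 - z \<noteq> 0" using assms by auto
    have "((\<lambda>w. (1 - w) ^ 2) has_field_derivative - (2 * (1 - z))) (at z)"
      by (auto intro!: derivative_eq_intros)
    from DERIV_divide[OF DERIV_const[of 1] this] nz
    have "((\<lambda>w. 1 / (1 - w) ^ 2) has_field_derivative (0 * (1 - z) ^ 2 - 1 * (- (2 * (1 - z)))) / ((1 - z) ^ 2 * (1 - z) ^ 2)) (at z)"
      by simp
    moreover have "(0 * y ^ 2 - 1 * (- (2 * y))) / (y ^ 2 * y ^ 2) = 2 * (1 / y ^ 3)" if "y \<noteq> 0" for y :: complex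
      using that by (simp add: divide_simps power2_eq_square power3_eq_cube)
    from this[OF nz] have "(0 * (1 - z) ^ 2 - 1 * (- (2 * (1 - z)))) / ((1 - z) ^ 2 * (1 - z) ^ 2) = 2 * (1 / (1 - z) ^ 3)" .
    ultimately show ?thesis by (simp only:)
  qed
  then have "deriv (\<lambda>w. 1 / (1 - w) ^ 2) z = 2 * (1 / (1 - z) ^ 3)" by (rule DERIV_imp_deriv)
  with power_series_deriv(1)[OF g assms] show ?thesis
    by (simp add: diffs_def algebra_simps)
qed

section \<open>Resolvent integrals as derivatives of the generating function of return
  probabilities\<close>

context stable_char
begin

text \<open>For the walk this is 2 \<pi> P[S_n = 0], since \<phi>^n is the characteristic function
  of S_n.\<close>

definition char_power_int :: "nat \<Rightarrow> complex" where
  "char_power_int n = (\<integral>\<theta>. indicator {-pi..pi} \<theta> *\<^sub>R \<phi> \<theta> ^ n \<partial>lborel)"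

text \<open>One interchange of sum and integral for all weights: with G(w) = 1/(1 - w), 1/(1 - w)^2
  and 2/(1 - w)^3 it gives the series of U and of its first two derivatives. As |\<phi>| \<le> 1,
  absolute convergence at z dominates uniformly in \<theta>.\<close>

lemma char_power_int_series:
  fixes a :: "nat \<Rightarrow> complex"
  assumes a: "\<And>w. norm w < 1 \<Longrightarrow> (\<lambda>n. a n * w ^ n) sums G w" and z: "norm z < 1"
  shows "(\<lambda>n. a n * char_power_int (n + j) * z ^ n) sums (\<integral>\<theta>. indicator {-pi..pi} \<theta> *\<^sub>R (\<phi> \<theta> ^ j * G (z * \<phi> \<theta>)) \<partial>lborel)"
proof -
  define R where "R = (1 + norm z) / 2"
  have R: "norm z < R" "R < 1" "0 < R" using z by (auto simp: R_def intro: add_pos_nonneg)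
  have "summable (\<lambda>n. a n * of_real R ^ n)"
    using a[of "of_real R"] R by (auto simp: sums_iff)
  then have abs: "summable (\<lambda>n. norm (a n * z ^ n))"
    by (rule powser_insidea) (use R in auto)
  let ?g = "\<lambda>n \<theta>. indicator {-pi..pi} \<theta> *\<^sub>R (a n * z ^ n * \<phi> \<theta> ^ (n + j))"
  have phi_pow: "norm (\<phi> \<theta> ^ m) \<le> 1" for \<theta> m unfolding norm_power by (intro power_le_one norm_phi_le_1) auto
  have g_le: "norm (?g n \<theta>) \<le> indicator {-pi..pi} \<theta> * norm (a n * z ^ n)" for n \<theta>
  proof -
    have "norm (a n * z ^ n) * norm (\<phi> \<theta> ^ (n + j)) \<le> norm (a n * z ^ n)" using phi_pow by (intro mult_left_le) auto
    then show ?thesis unfolding norm_scaleR norm_mult[of "a n * z ^ n"] by (auto split: split_indicator)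
  qed
  have ind: "integrable lborel (\<lambda>\<theta>. indicator {-pi..pi} \<theta> * x)" for x :: real
    by (intro integrable_mult_left integrable_real_indicator) (auto simp: emeasure_lborel_Icc_eq)
  have int_g: "integrable lborel (?g n)" for n
    by (rule Bochner_Integration.integrable_bound[OF ind[of "norm (a n * z ^ n)"]])
       (use g_le in \<open>auto simp del: norm_scaleR intro!: AE_I2 order_trans[OF g_le]\<close>)
  have "(\<lambda>n. integral\<^sup>L lborel (?g n)) sums (\<integral>\<theta>. (\<Sum>n. ?g n \<theta>) \<partial>lborel)"
  proof (rule sums_integral[OF int_g])
    show "AE \<theta> in lborel. summable (\<lambda>n. norm (?g n \<theta>))"
    proof (intro AE_I2)
      fix \<theta> :: real
      show "summable (\<lambda>n. norm (?g n \<theta>))"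
        by (rule summable_comparison_test'[OF summable_mult[OF abs, of "indicator {-pi..pi} \<theta>"], of 0])
           (use g_le in simp)
    qed
    show "summable (\<lambda>n. \<integral>\<theta>. norm (?g n \<theta>) \<partial>lborel)"
    proof (rule summable_comparison_test'[OF summable_mult[OF abs, of "2 * pi"], of 0])
      fix n :: nat
      have "(\<integral>\<theta>. norm (?g n \<theta>) \<partial>lborel) \<le> (\<integral>\<theta>. indicator {-pi..pi} \<theta> * norm (a n * z ^ n) \<partial>lborel)"
        by (intro integral_mono integrable_norm int_g ind g_le)
      also have "\<dots> = 2 * pi * norm (a n * z ^ n)" by simp
      finally show "norm (\<integral>\<theta>. norm (?g n \<theta>) \<partial>lborel) \<le> 2 * pi * norm (a n * z ^ n)"
        by (simp add: integral_nonneg_AE del: norm_scaleR)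
    qed
  qed
  moreover have "integral\<^sup>L lborel (?g n) = a n * char_power_int (n + j) * z ^ n" for n
  proof -
    have "integral\<^sup>L lborel (?g n) = (\<integral>\<theta>. (a n * z ^ n) * (indicator {-pi..pi} \<theta> *\<^sub>R \<phi> \<theta> ^ (n + j)) \<partial>lborel)"
      by (intro Bochner_Integration.integral_cong) auto
    also have "\<dots> = (a n * z ^ n) * char_power_int (n + j)" unfolding char_power_int_def by (rule integral_mult_right_zero)
    finally show ?thesis by (simp add: mult_ac)
  qed
  moreover have "(\<Sum>n. ?g n \<theta>) = indicator {-pi..pi} \<theta> *\<^sub>R (\<phi> \<theta> ^ j * G (z * \<phi> \<theta>))" for \<theta>
  proof -
    have "(\<lambda>n. indicator {-pi..pi} \<theta> *\<^sub>R (\<phi> \<theta> ^ j * (a n * (z * \<phi> \<theta>) ^ n))) sums (indicator {-pi..pi} \<theta> *\<^sub>R (\<phi> \<theta> ^ j * G (z * \<phi> \<theta>)))"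
      by (intro sums_scaleR_right sums_mult a norm_z_phi z)
    moreover have "\<phi> \<theta> ^ j * (a n * (z * \<phi> \<theta>) ^ n) = a n * z ^ n * \<phi> \<theta> ^ (n + j)" for n
      by (simp add: power_mult_distrib power_add)
    ultimately show ?thesis by (simp add: sums_iff)
  qed
  ultimately show ?thesis by simp
qed

lemma char_power_int_sums:
  assumes z: "norm z < 1"
  shows "(\<lambda>n. char_power_int n * z ^ n) sums resolvent_int 0 1 z"
    and "(\<lambda>n. of_nat (n + 1) * char_power_int (n + 1) * z ^ n) sums resolvent_int 1 2 z"
    and "(\<lambda>n. of_nat ((n + 1) * (n + 2)) * char_power_int (n + 2) * z ^ n) sums (2 * resolvent_int 2 3 z)"
proof -
  have 1: "(\<lambda>n. 1 * w ^ n) sums (1 / (1 - w))" if "norm w < 1" for w :: complex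
    using geometric_sums[OF that] by simp
  show "(\<lambda>n. char_power_int n * z ^ n) sums resolvent_int 0 1 z"
    using char_power_int_series[OF 1 z, of 0] by (simp add: resolvent_int_def)
  have 2: "(\<lambda>n. of_nat (n + 1) * w ^ n) sums (1 / (1 - w) ^ 2)" if "norm w < 1" for w :: complex
    using geometric_deriv_sums[OF that] by simp
  show "(\<lambda>n. of_nat (n + 1) * char_power_int (n + 1) * z ^ n) sums resolvent_int 1 2 z"
    using char_power_int_series[OF 2 z, of 1] by (simp add: resolvent_int_def)
  have "(\<integral>\<theta>. indicator {-pi..pi} \<theta> *\<^sub>R (\<phi> \<theta> ^ 2 * (2 * (1 / (1 - z * \<phi> \<theta>) ^ 3))) \<partial>lborel)
     = (\<integral>\<theta>. 2 * (indicator {-pi..pi} \<theta> *\<^sub>R (\<phi> \<theta> ^ 2 / (1 - z * \<phi> \<theta>) ^ 3)) \<partial>lborel)"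
    by (intro Bochner_Integration.integral_cong) auto
  also have "\<dots> = 2 * resolvent_int 2 3 z" unfolding resolvent_int_def by (rule integral_mult_right_zero)
  finally show "(\<lambda>n. of_nat ((n + 1) * (n + 2)) * char_power_int (n + 2) * z ^ n) sums (2 * resolvent_int 2 3 z)"
    using char_power_int_series[OF geometric_second_deriv_sums z, of 2] by simp
qed

text \<open>This is U''/U^2 - 2 U'^2/U^3, the second derivative of 1 - 1/U, written through the
  resolvent integrals. The outer factor 2 \<pi> stems from U being a resolvent integral divided by 2
  \<pi>.\<close>

definition second_deriv :: "complex \<Rightarrow> complex" where
  "second_deriv z = of_real (2 * pi) * (2 * resolvent_int 2 3 z / (resolvent_int 0 1 z) ^ 2 - 2 * (resolvent_int 1 2 z) ^ 2 / (resolvent_int 0 1 z) ^ 3)"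

lemma resolvent_int_nonzero: "norm z < 1 \<Longrightarrow> resolvent_int 0 1 z \<noteq> 0"
proof -
  assume z: "norm z < 1"
  obtain C where C: "C > 0" "\<And>z. norm z < 1 \<Longrightarrow> C * norm (1 - z) powr (1 / \<alpha> - 1) \<le> norm (resolvent_int 0 1 z)"
    using resolvent_int_lower by blast
  have "1 - z \<noteq> 0" using z by auto
  then have "0 < C * norm (1 - z) powr (1 / \<alpha> - 1)" using C by simp
  with C(2)[OF z] show ?thesis by auto
qed

text \<open>With \<tau> = |1 - z| and a = \<tau>^(1/\<alpha>) the three integrals have orders
  a/\<tau>, a/\<tau>^2 and a/\<tau>^3, the first from both sides in norm. Both terms of F'' are then
  of order 1/(\<tau> a).\<close>

lemma second_deriv_bound:
  obtains C where "\<And>z. norm z < 1 \<Longrightarrow> norm (second_deriv z) \<le> C * norm (1 - z) powr (- (1 + 1 / \<alpha>))"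
proof -
  obtain A where A: "A > 0" "\<And>z. norm z < 1 \<Longrightarrow> A * norm (1 - z) powr (1 / \<alpha> - 1) \<le> norm (resolvent_int 0 1 z)"
    using resolvent_int_lower by blast
  obtain B2 where B2: "B2 \<ge> 0" "\<And>z. norm z < 1 \<Longrightarrow> norm (resolvent_int 1 2 z) \<le> B2 * norm (1 - z) powr (1 / \<alpha> - real 2)"
    using resolvent_int_upper[of 2 1] by auto
  obtain B3 where B3: "B3 \<ge> 0" "\<And>z. norm z < 1 \<Longrightarrow> norm (resolvent_int 2 3 z) \<le> B3 * norm (1 - z) powr (1 / \<alpha> - real 3)"
    using resolvent_int_upper[of 3 2] by auto
  define C where "C = 2 * pi * (2 * B3 / A ^ 2 + 2 * B2 ^ 2 / A ^ 3)"
  have "norm (second_deriv z) \<le> C * norm (1 - z) powr (- (1 + 1 / \<alpha>))" if z: "norm z < 1" for z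
  proof -
    define \<tau> where "\<tau> = norm (1 - z)"
    have \<tau>: "\<tau> > 0" using z by (auto simp: \<tau>_def)
    define a where "a = \<tau> powr (1 / \<alpha>)"
    have a: "a > 0" using \<tau> by (simp add: a_def)
    have pw: "\<tau> powr (1 / \<alpha> - real k) = a / \<tau> ^ k" for k
      using \<tau> by (simp add: a_def powr_diff powr_realpow)
    have pw1: "\<tau> powr (1 / \<alpha> - 1) = a / \<tau>" using pw[of 1] by simp
    have pwd: "\<tau> powr (- (1 + 1 / \<alpha>)) = 1 / (\<tau> * a)"
      using \<tau> unfolding a_def powr_minus_divide powr_add by simp
    have l: "A * (a / \<tau>) \<le> norm (resolvent_int 0 1 z)" using A(2)[OF z] unfolding \<tau>_def[symmetric] pw1 .
    have l0: "0 < A * (a / \<tau>)" using A a \<tau> by simp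
    have u2: "norm (resolvent_int 1 2 z) \<le> B2 * (a / \<tau> ^ 2)" using B2(2)[OF z] unfolding \<tau>_def[symmetric] pw .
    have u3: "norm (resolvent_int 2 3 z) \<le> B3 * (a / \<tau> ^ 3)" using B3(2)[OF z] unfolding \<tau>_def[symmetric] pw .
    have "norm (2 * resolvent_int 2 3 z / (resolvent_int 0 1 z) ^ 2) = 2 * norm (resolvent_int 2 3 z) / norm (resolvent_int 0 1 z) ^ 2"
      by (simp add: norm_divide norm_mult norm_power)
    also have "\<dots> \<le> 2 * (B3 * (a / \<tau> ^ 3)) / (A * (a / \<tau>)) ^ 2"
      using u3 l l0 B3 a \<tau> by (intro frac_le power_mono mult_left_mono zero_less_power) auto
    also have "\<dots> = (2 * B3 / A ^ 2) * (1 / (\<tau> * a))"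
      using A a \<tau> by (simp add: field_simps power2_eq_square power3_eq_cube)
    finally have t1: "norm (2 * resolvent_int 2 3 z / (resolvent_int 0 1 z) ^ 2) \<le> (2 * B3 / A ^ 2) * (1 / (\<tau> * a))" .
    have "norm (2 * (resolvent_int 1 2 z) ^ 2 / (resolvent_int 0 1 z) ^ 3) = 2 * norm (resolvent_int 1 2 z) ^ 2 / norm (resolvent_int 0 1 z) ^ 3"
      by (simp add: norm_divide norm_mult norm_power)
    also have "\<dots> \<le> 2 * (B2 * (a / \<tau> ^ 2)) ^ 2 / (A * (a / \<tau>)) ^ 3"
      using u2 l l0 B2 a \<tau> by (intro frac_le power_mono mult_left_mono zero_less_power) auto
    also have "\<dots> = (2 * B2 ^ 2 / A ^ 3) * (1 / (\<tau> * a))"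
      using A a \<tau> by (simp add: field_simps power2_eq_square power3_eq_cube)
    finally have t2: "norm (2 * (resolvent_int 1 2 z) ^ 2 / (resolvent_int 0 1 z) ^ 3) \<le> (2 * B2 ^ 2 / A ^ 3) * (1 / (\<tau> * a))" .
    have "norm (second_deriv z) = 2 * pi * norm (2 * resolvent_int 2 3 z / (resolvent_int 0 1 z) ^ 2 - 2 * (resolvent_int 1 2 z) ^ 2 / (resolvent_int 0 1 z) ^ 3)"
      unfolding second_deriv_def norm_mult by simp
    also have "\<dots> \<le> 2 * pi * ((2 * B3 / A ^ 2) * (1 / (\<tau> * a)) + (2 * B2 ^ 2 / A ^ 3) * (1 / (\<tau> * a)))"
      by (intro mult_left_mono order_trans[OF norm_triangle_ineq4] add_mono t1 t2) auto
    also have "\<dots> = C * (1 / (\<tau> * a))" by (simp add: C_def algebra_simps)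
    finally show ?thesis unfolding \<tau>_def[symmetric] pwd .
  qed
  then show ?thesis by (rule that)
qed

text \<open>The value \<open>full_int 1 1\<close>: the Beta integral \<pi>/(\<alpha> sin
  (\<pi>/\<alpha>)) times the sum of the powers -1/\<alpha> of \<open>Wp\<close> and
  \<open>Wm\<close>, which is 2 c^(-1/\<alpha>) cos (\<pi> \<gamma>/(2 \<alpha>)).\<close>

definition full_int_const :: real where "full_int_const = 2 * pi * c powr (- (1 / \<alpha>)) * cos (pi * \<gamma> / (2 * \<alpha>)) / (\<alpha> * sin (pi / \<alpha>))"

lemma full_int_one:
  assumes "0 < Re \<mu>"
  shows "full_int 1 \<mu> = of_real full_int_const * \<mu> powr (- of_real (1 - 1 / \<alpha>))"
proof -
  \<comment> \<open>The bound on x makes ln c + \<i> x the principal logarithm, so that the power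
    acts on modulus and argument separately.\<close>
  have W: "(of_real c * cis x) powr (- of_real (1 / \<alpha>)) = of_real (c powr (- (1 / \<alpha>))) * cis (- (x / \<alpha>))"
    if "\<bar>x\<bar> < pi" for x
  proof -
    have "Ln (of_real c * cis x) = of_real (ln c) + \<i> * of_real x"
    proof (rule Ln_unique)
      show "exp (complex_of_real (ln c) + \<i> * of_real x) = of_real c * cis x"
        using c by (simp add: exp_add cis_conv_exp exp_of_real)
    qed (use that in auto)
    then have "(of_real c * cis x) powr (- of_real (1 / \<alpha>)) = exp (- of_real (1 / \<alpha>) * (of_real (ln c) + \<i> * of_real x))"
      using c by (simp add: powr_def)
    also have "\<dots> = exp (of_real (- (1 / \<alpha>) * ln c)) * exp (\<i> * of_real (- (x / \<alpha>)))"
      unfolding exp_add[symmetric] by (simp add: algebra_simps)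
    also have "exp (complex_of_real (- (1 / \<alpha>) * ln c)) = of_real (c powr (- (1 / \<alpha>)))"
    proof -
      have "c powr (- (1 / \<alpha>)) = exp (- (1 / \<alpha>) * ln c)" using c by (simp add: powr_def)
      then show ?thesis by (simp only: exp_of_real)
    qed
    finally show ?thesis by (simp only: cis_conv_exp)
  qed
  have "pi * \<bar>\<gamma>\<bar> < pi * 2" using gamma alpha by (intro mult_strict_left_mono) auto
  then have g: "\<bar>pi * \<gamma> / 2\<bar> < pi" by (simp add: abs_mult)
  have "full_int 1 \<mu> = \<mu> powr (- of_real (1 - 1 / \<alpha>)) * (Wp powr (- of_real (1 / \<alpha>)) + Wm powr (- of_real (1 / \<alpha>))) * half_int \<alpha> 1 1 1"
    unfolding full_int_def half_int_powr_mu[OF alpha(1) assms Re_W_pos(1)] half_int_powr_mu[OF alpha(1) assms Re_W_pos(2)]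
      half_int_powr_w[OF alpha(1) Re_W_pos(1)] half_int_powr_w[OF alpha(1) Re_W_pos(2)]
    by (simp only: distrib_left distrib_right mult.assoc)
  also have "Wp powr (- of_real (1 / \<alpha>)) + Wm powr (- of_real (1 / \<alpha>)) = of_real (c powr (- (1 / \<alpha>)) * (2 * cos (pi * \<gamma> / (2 * \<alpha>))))"
    unfolding Wp_def Wm_def using W[of "pi * \<gamma> / 2"] W[of "- (pi * \<gamma> / 2)"] g
    by (simp add: complex_eq_iff algebra_simps)
  finally show ?thesis unfolding half_int_one[OF alpha(1)] by (simp add: full_int_const_def mult_ac)
qed

text \<open>The factor in \<open>half_int_rec\<close> does not involve w, so the recursion survives
  summation over the two half lines.\<close>

lemma full_int_rec:
  assumes "0 < Re \<mu>" "k \<ge> 1"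
  shows "full_int (Suc k) \<mu> = (of_nat k * of_real \<alpha> - 1) / (of_nat k * of_real \<alpha> * \<mu>) * full_int k \<mu>"
proof -
  have nz: "of_nat k * of_real \<alpha> * \<mu> \<noteq> 0" using assms alpha by auto
  have "half_int \<alpha> (Suc k) \<mu> W = (of_nat k * of_real \<alpha> - 1) / (of_nat k * of_real \<alpha> * \<mu>) * half_int \<alpha> k \<mu> W" if "0 < Re W" for W
    using half_int_rec[OF alpha(1) assms(1) that assms(2)] nz by (simp add: field_simps)
  then show ?thesis unfolding full_int_def using Re_W_pos by (simp add: distrib_left)
qed

section \<open>Evaluation of the constants and the limit of F'' on the rescaled circle\<close>

lemma alpha_trig_pos: "cos (pi * \<gamma> / (2 * \<alpha>)) > 0" "sin (pi / \<alpha>) > 0"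
proof -
  have "pi * \<bar>\<gamma>\<bar> < pi * \<alpha>" using gamma alpha by (intro mult_strict_left_mono) auto
  then have "\<bar>pi * \<gamma>\<bar> < pi * \<alpha>" unfolding abs_mult by simp
  then show "cos (pi * \<gamma> / (2 * \<alpha>)) > 0"
    using alpha by (intro cos_gt_zero_pi) (auto simp: abs_less_iff field_simps)
  show "sin (pi / \<alpha>) > 0" using alpha by (intro sin_gt_zero) (auto simp: field_simps)
qed

lemma full_int_const_pos: "full_int_const > 0"
  unfolding full_int_const_def using alpha_trig_pos alpha c by (intro divide_pos_pos mult_pos_pos) auto

lemma kappa_eq: "kappa \<alpha> \<gamma> = (\<alpha> - 1) * sin (pi / \<alpha>) / (Gamma (1 / \<alpha>) * cos (pi * \<gamma> / (2 * \<alpha>)))"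
proof -
  have "pi * (\<alpha> - \<gamma>) / (2 * \<alpha>) = pi / 2 - pi * \<gamma> / (2 * \<alpha>)" using alpha by (simp add: field_simps)
  then show ?thesis unfolding kappa_def by (simp add: sin_diff)
qed

text \<open>The constant in \<open>F''(z) \<sim> A (1 - z)\<close> to the power \<open>-(1 + 1/\<alpha>)\<close>.\<close>

definition singular_const :: real where "singular_const = 2 * pi * ((1 - 1 / \<alpha>) * (1 / \<alpha>)) / full_int_const"

lemma singular_const_eq: "singular_const / Gamma (1 + 1 / \<alpha>) = kappa \<alpha> \<gamma> * c powr (1 / \<alpha>)"
proof -
  have G: "Gamma (1 + 1 / \<alpha>) = Gamma (1 / \<alpha>) / \<alpha>"
  proof -
    have "1 / \<alpha> > 0" using alpha by simp
    then have "1 / \<alpha> \<notin> \<int>\<^sub>\<le>\<^sub>0" using nonpos_Ints_nonpos[of "1 / \<alpha>"] by linarith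
    from Gamma_plus1[OF this] show ?thesis by (simp add: add.commute)
  qed
  have "Gamma (1 / \<alpha>) > 0" using alpha by (intro Gamma_real_pos) auto
  moreover have cp: "c powr (- (1 / \<alpha>)) = 1 / c powr (1 / \<alpha>)" by (rule powr_minus_divide)
  moreover have "c powr (1 / \<alpha>) > 0" using c by simp
  \<comment> \<open>The algebra behind the constant, with p = \<pi>, a = \<alpha>, q =
    c^(1/\<alpha>), x the cosine, s the sine and g = Gamma (1/\<alpha>).\<close>
  moreover have "2 * p * ((1 - 1 / a) * (1 / a)) / (2 * p * (1 / q) * x / (a * s)) / (g / a) = (a - 1) * s / (g * x) * q"
    if "p > 0" "a > 0" "q > 0" "x > 0" "s > 0" "g > 0" for p a q x s g :: real
    using that by (simp add: divide_simps) (simp add: algebra_simps)?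
  ultimately show ?thesis unfolding singular_const_def full_int_const_def kappa_eq G cp using alpha alpha_trig_pos by simp
qed

text \<open>The normalising exponents of both terms agree: (1/\<alpha> - 3) - 2 (1/\<alpha> - 1) and
  2 (1/\<alpha> - 2) - 3 (1/\<alpha> - 1) both equal -(1 + 1/\<alpha>). Rescaling each resolvent
  integral therefore divides F'' by n^(1 + 1/\<alpha>).\<close>

lemma second_deriv_limit: "(\<lambda>n. second_deriv (circ n s) / of_real (real n powr (1 + 1 / \<alpha>))) \<longlonglongrightarrow> of_real singular_const * (1 - \<i> * of_real s) powr (- of_real (1 + 1 / \<alpha>))"
proof -
  define \<mu> where "\<mu> = 1 - \<i> * of_real s"
  have \<mu>: "0 < Re \<mu>" "\<mu> \<noteq> 0" by (auto simp: \<mu>_def complex_eq_iff)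
  have resolvent_int: "(\<lambda>n. of_real (real n powr (1 / \<alpha> - real k)) * resolvent_int j k (circ n s)) \<longlonglongrightarrow> full_int k \<mu>" if "k \<ge> 1" for j k
    by (rule resolvent_int_limit[OF norm_circ_less_1 tendsto_circ[of s, folded \<mu>_def] \<mu>(1) that])
  have I1: "full_int 1 \<mu> \<noteq> 0" unfolding full_int_one[OF \<mu>(1)] using full_int_const_pos \<mu> by simp
  have L: "(\<lambda>n. of_real (2 * pi) * (2 * (of_real (real n powr (1 / \<alpha> - real 3)) * resolvent_int 2 3 (circ n s)) / (of_real (real n powr (1 / \<alpha> - real 1)) * resolvent_int 0 1 (circ n s)) ^ 2
      - 2 * (of_real (real n powr (1 / \<alpha> - real 2)) * resolvent_int 1 2 (circ n s)) ^ 2 / (of_real (real n powr (1 / \<alpha> - real 1)) * resolvent_int 0 1 (circ n s)) ^ 3))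
    \<longlonglongrightarrow> of_real (2 * pi) * (2 * full_int 3 \<mu> / full_int 1 \<mu> ^ 2 - 2 * full_int 2 \<mu> ^ 2 / full_int 1 \<mu> ^ 3)"
    by (intro tendsto_intros resolvent_int) (use I1 in auto)
  have "of_real (2 * pi) * (2 * full_int 3 \<mu> / full_int 1 \<mu> ^ 2 - 2 * full_int 2 \<mu> ^ 2 / full_int 1 \<mu> ^ 3)
      = of_real singular_const * \<mu> powr (- of_real (1 + 1 / \<alpha>))"
  proof -
    define J where "J = full_int 1 \<mu>"
    define q where "q = complex_of_real \<alpha>"
    have q: "q \<noteq> 0" using alpha by (simp add: q_def)
    have r2: "full_int 2 \<mu> = (q - 1) / (q * \<mu>) * J"
      using full_int_rec[OF \<mu>(1), of 1] by (simp add: q_def J_def numeral_2_eq_2)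
    have r3: "full_int 3 \<mu> = (2 * q - 1) / (2 * q * \<mu>) * full_int 2 \<mu>"
      using full_int_rec[OF \<mu>(1), of 2] by (simp add: q_def numeral_3_eq_3 numeral_2_eq_2)
    have J: "J \<noteq> 0" using I1 by (simp add: J_def)
    \<comment> \<open>After the recursion the two terms share the factor (q - 1)/(q^2 \<mu>^2 J) and
      differ by (2 q - 1) - 2 (q - 1) = 1.\<close>
    have "2 * full_int 3 \<mu> / J ^ 2 - 2 * full_int 2 \<mu> ^ 2 / J ^ 3 = (1 - 1 / q) * (1 / q) / (\<mu> ^ 2 * J)"
      unfolding r3 r2 using J q \<mu>(2) by (simp add: divide_simps power2_eq_square power3_eq_cube) (simp add: algebra_simps)
    also have "\<mu> ^ 2 * J = of_real full_int_const * (\<mu> ^ 2 * \<mu> powr (- of_real (1 - 1 / \<alpha>)))"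
      unfolding J_def full_int_one[OF \<mu>(1)] by simp
    also have "\<mu> ^ 2 * \<mu> powr (- of_real (1 - 1 / \<alpha>)) = \<mu> powr (of_real (1 + 1 / \<alpha>))"
    proof -
      have "\<mu> ^ 2 = \<mu> powr 2" using \<mu>(2) powr_nat[of \<mu> 2] by simp
      moreover have "complex_of_real (1 + 1 / \<alpha>) = 2 + - of_real (1 - 1 / \<alpha>)" by simp
      ultimately show ?thesis by (simp only: powr_add)
    qed
    finally have e: "2 * full_int 3 \<mu> / J ^ 2 - 2 * full_int 2 \<mu> ^ 2 / J ^ 3 = (1 - 1 / q) * (1 / q) / (of_real full_int_const * \<mu> powr (of_real (1 + 1 / \<alpha>)))" .
    show ?thesis unfolding J_def[symmetric] e powr_minus singular_const_def q_def by (simp add: divide_inverse mult_ac)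
  qed
  from L[unfolded this] show ?thesis unfolding \<mu>_def[symmetric]
  proof (rule Lim_transform_eventually)
    show "\<forall>\<^sub>F n in sequentially. of_real (2 * pi) * (2 * (of_real (real n powr (1 / \<alpha> - real 3)) * resolvent_int 2 3 (circ n s)) / (of_real (real n powr (1 / \<alpha> - real 1)) * resolvent_int 0 1 (circ n s)) ^ 2
      - 2 * (of_real (real n powr (1 / \<alpha> - real 2)) * resolvent_int 1 2 (circ n s)) ^ 2 / (of_real (real n powr (1 / \<alpha> - real 1)) * resolvent_int 0 1 (circ n s)) ^ 3) = second_deriv (circ n s) / of_real (real n powr (1 + 1 / \<alpha>))"
      using eventually_ge_at_top[of 1]
    proof eventually_elim
      case (elim n)
      define x where "x = complex_of_real (real n)"
      define a where "a = complex_of_real (real n powr (1 / \<alpha>))"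
      have nz: "x \<noteq> 0" "a \<noteq> 0" using elim by (auto simp: x_def a_def)
      have v: "resolvent_int 0 1 (circ n s) \<noteq> 0" by (rule resolvent_int_nonzero[OF norm_circ_less_1[OF elim]])
      have p: "complex_of_real (real n powr (1 / \<alpha> - real k)) = a / x ^ k" for k
        using elim by (simp add: a_def x_def powr_diff powr_realpow)
      have pp: "complex_of_real (real n powr (1 + 1 / \<alpha>)) = x * a"
        using elim by (simp add: a_def x_def powr_add)
      show ?case unfolding p pp second_deriv_def using nz v
        by (simp add: divide_simps power2_eq_square power3_eq_cube) (simp add: algebra_simps)?
    qed
  qed
qed

text \<open>The analytic half of the result, for any sequences tied by a renewal equation to the
  Fourier integrals of \<phi>^n. The renewal equation gives F U = U - 1, which identifies F'' with
  \<open>second_deriv\<close>, and the asymptotics are read off its coefficients.\<close>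

theorem renewal_coefficients:
  fixes u f :: "nat \<Rightarrow> complex"
  assumes u: "\<And>n. char_power_int n = of_real (2 * pi) * u n" and u0: "u 0 = 1" and f0: "f 0 = 0"
    and f_bound: "\<And>n. norm (f n) \<le> 1"
    and renewal: "\<And>n. n \<ge> 1 \<Longrightarrow> u n = (\<Sum>k\<le>n. f k * u (n - k))"
  shows "(\<lambda>n. f n / of_real (real n powr (1 / \<alpha> - 2))) \<longlonglongrightarrow> of_real (kappa \<alpha> \<gamma> * c powr (1 / \<alpha>))"
proof -
  define U where "U = (\<lambda>z. resolvent_int 0 1 z / of_real (2 * pi))"
  define F where "F = (\<lambda>z. \<Sum>n. f n * z ^ n)"
  have abs_f: "summable (\<lambda>n. norm (f n * z ^ n))" if "norm z < 1" for z
  proof (rule summable_comparison_test'[of "\<lambda>n. norm z ^ n" 0])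
    show "summable (\<lambda>n. norm z ^ n)" by (rule summable_geometric) (use that in simp)
    show "norm (norm (f n * z ^ n)) \<le> norm z ^ n" for n
    proof -
      have "norm (f n) * norm (z ^ n) \<le> 1 * norm (z ^ n)" by (intro mult_right_mono f_bound) auto
      then show ?thesis by (simp add: norm_mult norm_power)
    qed
  qed
  have F: "(\<lambda>n. f n * z ^ n) sums F z" if "norm z < 1" for z
    unfolding F_def by (rule summable_sums[OF summable_norm_cancel[OF abs_f[OF that]]])
  have U: "(\<lambda>n. u n * z ^ n) sums U z" if z: "norm z < 1" for z
    using sums_divide[OF char_power_int_sums(1)[OF z], of "of_real (2 * pi)"] by (simp add: u U_def)
  have U': "(\<lambda>n. diffs u n * z ^ n) sums (resolvent_int 1 2 z / of_real (2 * pi))" if z: "norm z < 1" for z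
  proof -
    have "diffs u n * z ^ n = of_nat (n + 1) * char_power_int (n + 1) * z ^ n / of_real (2 * pi)" for n
      by (simp add: u diffs_def)
    then show ?thesis using sums_divide[OF char_power_int_sums(2)[OF z], of "of_real (2 * pi)"] by (simp only:)
  qed
  have U'': "(\<lambda>n. diffs (diffs u) n * z ^ n) sums (2 * resolvent_int 2 3 z / of_real (2 * pi))" if z: "norm z < 1" for z
  proof -
    have "diffs (diffs u) n * z ^ n = of_nat ((n + 1) * (n + 2)) * char_power_int (n + 2) * z ^ n / of_real (2 * pi)" for n
    proof -
      have "diffs (diffs u) n = of_nat ((n + 1) * (n + 2)) * u (n + 2)" by (simp add: diffs_def algebra_simps)
      then show ?thesis by (simp add: u del: of_nat_mult of_nat_add of_nat_Suc)
    qed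
    then show ?thesis using sums_divide[OF char_power_int_sums(3)[OF z], of "of_real (2 * pi)"] by (simp only:)
  qed
  have U0: "U z \<noteq> 0" if "norm z < 1" for z using resolvent_int_nonzero[OF that] by (simp add: U_def)
  have FU: "F z = 1 - 1 / U z" if z: "norm z < 1" for z
  proof -
    define R where "R = (1 + norm z) / 2"
    have R: "norm z < R" "R < 1" "0 < R" using z by (auto simp: R_def intro: add_pos_nonneg)
    have "summable (\<lambda>n. u n * of_real R ^ n)" using U[of "of_real R"] R by (auto simp: sums_iff)
    then have abs_u: "summable (\<lambda>n. norm (u n * z ^ n))" by (rule powser_insidea) (use R in auto)
    have "(\<lambda>n. \<Sum>k\<le>n. (f k * z ^ k) * (u (n - k) * z ^ (n - k))) sums ((\<Sum>n. f n * z ^ n) * (\<Sum>n. u n * z ^ n))"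
      by (rule Cauchy_product_sums[OF abs_f[OF z] abs_u])
    \<comment> \<open>The renewal equation starts at n = 1. At n = 0 the convolution is 0 while
      \<open>u 0\<close> = 1, which is the source of the constant 1 in F = 1 - 1/U.\<close>
    moreover have "(\<Sum>k\<le>n. (f k * z ^ k) * (u (n - k) * z ^ (n - k))) = u n * z ^ n - (if n = 0 then 1 else 0)" for n
    proof (cases "n = 0")
      case True
      then show ?thesis using f0 u0 by simp
    next
      case False
      have "(\<Sum>k\<le>n. (f k * z ^ k) * (u (n - k) * z ^ (n - k))) = (\<Sum>k\<le>n. f k * u (n - k)) * z ^ n"
        unfolding sum_distrib_right by (intro sum.cong refl) (simp add: power_add[symmetric])
      then show ?thesis using renewal[of n] False by simp
    qed
    moreover have "(\<lambda>n. u n * z ^ n - (if n = 0 then 1 else 0)) sums (U z - 1)"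
      by (intro sums_diff U z) (use sums_single[of 0 "\<lambda>_. 1::complex"] in simp)
    ultimately have "U z - 1 = F z * U z"
      using sums_unique2 U[OF z] unfolding F_def by (simp add: sums_iff)
    then show ?thesis using U0[OF z] by (simp add: field_simps)
  qed
  have dU: "deriv U z = resolvent_int 1 2 z / of_real (2 * pi)" "(U has_field_derivative resolvent_int 1 2 z / of_real (2 * pi)) (at z)" if z: "norm z < 1" for z
    using power_series_deriv[OF U z] sums_unique2[OF U'[OF z]] by auto
  have dU': "((\<lambda>z. resolvent_int 1 2 z / of_real (2 * pi)) has_field_derivative 2 * resolvent_int 2 3 z / of_real (2 * pi)) (at z)" if z: "norm z < 1" for z
    using power_series_deriv[OF U' z] sums_unique2[OF U''[OF z]] by auto
  have dF: "deriv F z = (resolvent_int 1 2 z / of_real (2 * pi)) / U z ^ 2" if z: "norm z < 1" for z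
  proof (rule DERIV_imp_deriv)
    have "((\<lambda>z. 1 - 1 / U z) has_field_derivative (resolvent_int 1 2 z / of_real (2 * pi)) / U z ^ 2) (at z)"
      using U0[OF z] by (auto intro!: derivative_eq_intros dU z simp: power2_eq_square)
    then show "(F has_field_derivative (resolvent_int 1 2 z / of_real (2 * pi)) / U z ^ 2) (at z)"
      by (rule has_field_derivative_transform_within_open[OF _ open_ball[of 0 1]]) (simp_all add: z FU)
  qed
  have dF': "deriv (deriv F) z = second_deriv z" if z: "norm z < 1" for z
  proof (rule DERIV_imp_deriv)
    have "((\<lambda>z. (resolvent_int 1 2 z / of_real (2 * pi)) / U z ^ 2) has_field_derivative
       ((2 * resolvent_int 2 3 z / of_real (2 * pi)) * U z ^ 2 - (resolvent_int 1 2 z / of_real (2 * pi)) * (2 * U z * (resolvent_int 1 2 z / of_real (2 * pi)))) / (U z ^ 2 * U z ^ 2)) (at z)"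
    proof -
      have "((\<lambda>z. U z ^ 2) has_field_derivative 2 * U z * (resolvent_int 1 2 z / of_real (2 * pi))) (at z)"
        by (auto intro!: derivative_eq_intros dU(2) z)
      from DERIV_divide[OF dU'[OF z] this] U0[OF z] show ?thesis by simp
    qed
    also have "((2 * resolvent_int 2 3 z / of_real (2 * pi)) * U z ^ 2 - (resolvent_int 1 2 z / of_real (2 * pi)) * (2 * U z * (resolvent_int 1 2 z / of_real (2 * pi)))) / (U z ^ 2 * U z ^ 2) = second_deriv z"
    proof -
      have "((2 * v3 / p) * (v / p) ^ 2 - (v2 / p) * (2 * (v / p) * (v2 / p))) / ((v / p) ^ 2 * (v / p) ^ 2) = p * (2 * v3 / v ^ 2 - 2 * v2 ^ 2 / v ^ 3)"
        if "p \<noteq> 0" "v \<noteq> 0" for p v v2 v3 :: complex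
        using that by (simp add: divide_simps power2_eq_square power3_eq_cube) (simp add: algebra_simps)
      from this[OF _ resolvent_int_nonzero[OF z], of "of_real (2 * pi)"] show ?thesis by (simp add: second_deriv_def U_def)
    qed
    finally have "((\<lambda>z. (resolvent_int 1 2 z / of_real (2 * pi)) / U z ^ 2) has_field_derivative second_deriv z) (at z)" .
    then show "(deriv F has_field_derivative second_deriv z) (at z)"
      by (rule has_field_derivative_transform_within_open[OF _ open_ball[of 0 1]]) (simp_all add: z dF)
  qed
  have sums_H: "(\<lambda>n. diffs (diffs f) n * z ^ n) sums second_deriv z" if z: "norm z < 1" for z
    using power_series_deriv(1)[OF power_series_deriv(1)[OF F] z] dF'[OF z] by simp
  obtain C where C: "\<And>z. norm z < 1 \<Longrightarrow> norm (second_deriv z) \<le> C * norm (1 - z) powr (- (1 + 1 / \<alpha>))"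
    using second_deriv_bound by blast
  have "(\<lambda>n. diffs (diffs f) n / of_real (real n powr (1 + 1 / \<alpha> - 1))) \<longlonglongrightarrow> of_real singular_const / of_real (Gamma (1 + 1 / \<alpha>))"
    by (rule coeff_asymptotics[OF sums_H _ C second_deriv_limit]) (use alpha in auto)
  then have l1: "(\<lambda>n. diffs (diffs f) n / of_real (real n powr (1 / \<alpha>))) \<longlonglongrightarrow> of_real (kappa \<alpha> \<gamma> * c powr (1 / \<alpha>))"
    unfolding singular_const_eq[symmetric] by simp
  \<comment> \<open>Two formal derivatives put (n + 1)(n + 2) f (n + 2) at index n; this ratio
    trades the normalisation at n for the one at n + 2.\<close>
  have l2: "(\<lambda>n. real n powr (1 / \<alpha>) / (real (n + 2) powr (1 / \<alpha> - 2) * (real (n + 1) * real (n + 2)))) \<longlonglongrightarrow> 1"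
    by real_asymp
  have "(\<lambda>n. f (n + 2) / of_real (real (n + 2) powr (1 / \<alpha> - 2))) \<longlonglongrightarrow> of_real (kappa \<alpha> \<gamma> * c powr (1 / \<alpha>)) * of_real 1"
  proof (rule Lim_transform_eventually[OF tendsto_mult[OF l1 tendsto_of_real[OF l2]]])
    show "\<forall>\<^sub>F n in sequentially. diffs (diffs f) n / of_real (real n powr (1 / \<alpha>)) *
        of_real (real n powr (1 / \<alpha>) / (real (n + 2) powr (1 / \<alpha> - 2) * (real (n + 1) * real (n + 2)))) = f (n + 2) / of_real (real (n + 2) powr (1 / \<alpha> - 2))"
      using eventually_ge_at_top[of 1]
    proof eventually_elim
      case (elim n)
      define a where "a = complex_of_real (real n powr (1 / \<alpha>))"
      define b where "b = complex_of_real (real (n + 2) powr (1 / \<alpha> - 2))"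
      define d where "d = complex_of_real (real (n + 1) * real (n + 2))"
      have nz: "a \<noteq> 0" "b \<noteq> 0" "d \<noteq> 0" using elim by (auto simp: a_def b_def d_def simp del: of_real_mult of_nat_add)
      have "diffs (diffs f) n = d * f (n + 2)" by (simp add: diffs_def d_def algebra_simps)
      then show ?case unfolding of_real_divide of_real_mult[of "real (n + 2) powr (1 / \<alpha> - 2)"] a_def[symmetric] b_def[symmetric] d_def[symmetric]
        using nz by simp
    qed
  qed
  from LIMSEQ_offset[of "\<lambda>n. f n / of_real (real n powr (1 / \<alpha> - 2))", OF this] show ?thesis by simp
qed

end

section \<open>Return times of the random walk\<close>

context prob_space
begin

lemma char_distr_eq:
  assumes [measurable]: "Z \<in> borel_measurable M"
  shows "char (distr M borel Z) \<theta> = (\<integral>\<omega>. cis (\<theta> * Z \<omega>) \<partial>M)"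
  unfolding char_def by (subst integral_distr) (auto simp: cis_conv_exp)

text \<open>By Fubini, with a bounded integrand on a finite product, the integral over \<theta> may
  be taken inside the expectation; orthogonality then leaves 2 \<pi> times the indicator of the
  event that Y vanishes.\<close>

lemma fourier_inversion_int:
  fixes Y :: "'a \<Rightarrow> int"
  assumes Y: "(\<lambda>\<omega>. real_of_int (Y \<omega>)) \<in> borel_measurable M"
  shows "(\<integral>\<theta>. indicator {-pi..pi} \<theta> *\<^sub>R char (distr M borel (\<lambda>\<omega>. real_of_int (Y \<omega>))) \<theta> \<partial>lborel)
           = of_real (2 * pi * prob {\<omega> \<in> space M. Y \<omega> = 0})"
proof -
  note [measurable] = Y
  have ev: "{\<omega> \<in> space M. Y \<omega> = 0} \<in> events"
  proof -
    have "{\<omega> \<in> space M. real_of_int (Y \<omega>) = 0} \<in> events" by measurable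
    then show ?thesis by simp
  qed
  interpret P: pair_sigma_finite lborel M ..
  let ?f = "\<lambda>\<theta> \<omega>. indicator {-pi..pi} \<theta> *\<^sub>R cis (\<theta> * real_of_int (Y \<omega>))"
  have ind: "integrable lborel (indicat_real {-pi..pi})"
    by (rule integrable_real_indicator) (auto simp: emeasure_lborel_Icc_eq)
  have int: "integrable (lborel \<Otimes>\<^sub>M M) (case_prod ?f)"
  proof (rule P.Fubini_integrable)
    have "(\<lambda>\<theta>. \<integral>\<omega>. norm (case (\<theta>, \<omega>) of (\<theta>, \<omega>) \<Rightarrow> ?f \<theta> \<omega>) \<partial>M) = indicat_real {-pi..pi}"
      by (auto simp: fun_eq_iff prob_space)
    with ind show "integrable lborel (\<lambda>\<theta>. \<integral>\<omega>. norm (case (\<theta>, \<omega>) of (\<theta>, \<omega>) \<Rightarrow> ?f \<theta> \<omega>) \<partial>M)" by simp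
    show "AE \<theta> in lborel. integrable M (\<lambda>\<omega>. case (\<theta>, \<omega>) of (\<theta>, \<omega>) \<Rightarrow> ?f \<theta> \<omega>)"
      by (intro AE_I2 integrable_const_bound[where B = 1]) (auto split: split_indicator)
  qed measurable
  have "(\<integral>\<theta>. indicator {-pi..pi} \<theta> *\<^sub>R char (distr M borel (\<lambda>\<omega>. real_of_int (Y \<omega>))) \<theta> \<partial>lborel)
      = (\<integral>\<theta>. (\<integral>\<omega>. ?f \<theta> \<omega> \<partial>M) \<partial>lborel)"
    by (intro Bochner_Integration.integral_cong refl) (simp add: char_distr_eq)
  also have "\<dots> = (\<integral>\<omega>. (\<integral>\<theta>. ?f \<theta> \<omega> \<partial>lborel) \<partial>M)"
    by (rule P.Fubini_integral[OF int, symmetric])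
  also have "\<dots> = (\<integral>\<omega>. of_real (2 * pi * indicator {\<omega> \<in> space M. Y \<omega> = 0} \<omega>) \<partial>M)"
  proof (rule Bochner_Integration.integral_cong[OF refl])
    fix \<omega> assume "\<omega> \<in> space M"
    have "(\<integral>\<theta>. ?f \<theta> \<omega> \<partial>lborel) = (\<integral>\<theta>. indicator {-pi..pi} \<theta> *\<^sub>R cis (of_int (Y \<omega>) * \<theta>) \<partial>lborel)"
      by (simp add: mult.commute)
    then show "(\<integral>\<theta>. ?f \<theta> \<omega> \<partial>lborel) = of_real (2 * pi * indicator {\<omega> \<in> space M. Y \<omega> = 0} \<omega>)"
      using integral_cis_int[of "Y \<omega>"] \<open>\<omega> \<in> space M\<close> by (simp split: split_indicator)
  qed
  also have "\<dots> = of_real (\<integral>\<omega>. 2 * pi * indicator {\<omega> \<in> space M. Y \<omega> = 0} \<omega> \<partial>M)"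
    by (rule integral_complex_of_real)
  also have "(\<integral>\<omega>. 2 * pi * indicator {\<omega> \<in> space M. Y \<omega> = 0} \<omega> \<partial>M) = 2 * pi * prob {\<omega> \<in> space M. Y \<omega> = 0}"
    using ev by (simp add: measure_def[symmetric])
  finally show ?thesis .
qed

text \<open>Equality in |E cis (\<theta> Y)| \<le> 1 forces cis (\<theta> Y) to equal its mean W
  almost surely. That Y takes the value 0 gives W = 1, and the value 1 then gives cis \<theta> = 1,
  impossible for 0 < |\<theta>| \<le> \<pi>.\<close>

lemma norm_char_neq_1:
  fixes Y :: "'a \<Rightarrow> int"
  assumes Y: "(\<lambda>\<omega>. real_of_int (Y \<omega>)) \<in> borel_measurable M"
    and p0: "prob {\<omega> \<in> space M. Y \<omega> = 0} > 0" and p1: "prob {\<omega> \<in> space M. Y \<omega> = 1} > 0"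
    and \<theta>: "0 < \<bar>\<theta>\<bar>" "\<bar>\<theta>\<bar> \<le> pi"
  shows "norm (char (distr M borel (\<lambda>\<omega>. real_of_int (Y \<omega>))) \<theta>) \<noteq> 1"
proof
  note [measurable] = Y
  define W where "W = char (distr M borel (\<lambda>\<omega>. real_of_int (Y \<omega>))) \<theta>"
  assume "norm (char (distr M borel (\<lambda>\<omega>. real_of_int (Y \<omega>))) \<theta>) = 1"
  then have W1: "norm W = 1" by (simp add: W_def)
  let ?c = "\<lambda>\<omega>. cis (\<theta> * real_of_int (Y \<omega>))"
  have int: "integrable M ?c" by (intro integrable_const_bound[where B = 1]) auto
  have W: "W = (\<integral>\<omega>. ?c \<omega> \<partial>M)" unfolding W_def by (rule char_distr_eq) simp
  have WW: "cnj W * W = 1" using W1 by (simp add: complex_norm_square[symmetric] mult.commute)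
  \<comment> \<open>The integrand is nonnegative because |W| = 1, and its integral is 1 - |W|^2 = 0,
    so it vanishes almost surely.\<close>
  have "(\<integral>\<omega>. 1 - Re (cnj W * ?c \<omega>) \<partial>M) = (\<integral>\<omega>. 1 \<partial>M) - (\<integral>\<omega>. Re (cnj W * ?c \<omega>) \<partial>M)"
    by (intro Bochner_Integration.integral_diff integrable_Re integrable_mult_right int) auto
  also have "(\<integral>\<omega>. Re (cnj W * ?c \<omega>) \<partial>M) = Re (\<integral>\<omega>. cnj W * ?c \<omega> \<partial>M)"
    by (intro integral_Re integrable_mult_right int)
  also have "(\<integral>\<omega>. cnj W * ?c \<omega> \<partial>M) = 1" unfolding integral_mult_right_zero W[symmetric] WW ..
  finally have z: "(\<integral>\<omega>. 1 - Re (cnj W * ?c \<omega>) \<partial>M) = 0" by (simp add: prob_space)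
  have le: "Re (cnj W * ?c \<omega>) \<le> 1" for \<omega>
    using complex_Re_le_cmod[of "cnj W * ?c \<omega>"] W1 by (simp only: norm_mult complex_mod_cnj norm_cis mult_1_right)
  have "integrable M (\<lambda>\<omega>. 1 - Re (cnj W * ?c \<omega>))"
    by (rule Bochner_Integration.integrable_diff[OF _ integrable_Re[OF integrable_mult_right[OF int]]]) simp
  from iffD1[OF integral_nonneg_eq_0_iff_AE[OF this] z] le
  have "AE \<omega> in M. 1 - Re (cnj W * ?c \<omega>) = 0" by (simp only: diff_ge_0_iff_ge AE_I2)
  then have AE: "AE \<omega> in M. ?c \<omega> = W"
  proof eventually_elim
    case (elim \<omega>)
    define v where "v = cnj W * ?c \<omega>"
    have "Re v = 1" "norm v = 1" using elim W1 by (auto simp: v_def norm_mult)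
    then have "v = 1" by (simp add: complex_eq_iff cmod_def)
    have "?c \<omega> = (cnj W * W) * ?c \<omega>" unfolding WW by simp
    also have "\<dots> = v * W" by (simp add: v_def mult_ac)
    finally show ?case using \<open>v = 1\<close> by simp
  qed
  \<comment> \<open>A value of positive probability must be taken at some point where the almost
    sure identity holds.\<close>
  have ex: "\<exists>\<omega>. Y \<omega> = y \<and> ?c \<omega> = W" if p: "prob {\<omega> \<in> space M. Y \<omega> = y} > 0" for y
  proof (rule ccontr)
    assume n: "\<not> ?thesis"
    have "AE \<omega> in M. \<not> Y \<omega> = y" using AE by eventually_elim (use n in auto)
    moreover have "{\<omega> \<in> space M. Y \<omega> = y} \<in> events"
    proof -
      have "{\<omega> \<in> space M. real_of_int (Y \<omega>) = of_int y} \<in> events" by measurable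
      then show ?thesis by simp
    qed
    ultimately have "prob {\<omega> \<in> space M. Y \<omega> = y} = 0" by (subst prob_Collect_eq_0) auto
    with p show False by simp
  qed
  from ex[OF p0] have "W = 1" by auto
  with ex[OF p1] have "cis \<theta> = 1" by auto
  \<comment> \<open>The case r = 1 of the distance estimate keeps cis \<theta> away from 1.\<close>
  with cmod_one_minus_rcis_ge[of 1 \<theta>] \<theta> show False by simp
qed

text \<open>The first return at k depends on the increments up to k, the later sum on those after k.
  Restrictions to disjoint index blocks are independent, and both conditions are measurable
  predicates of the restrictions.\<close>

lemma prob_first_return_inter:
  fixes Z :: "nat \<Rightarrow> 'a \<Rightarrow> real"
  assumes indep: "indep_vars (\<lambda>_. borel) Z {1..}" and k: "k \<le> n"
  shows "prob {\<omega> \<in> space M. (\<forall>j\<in>{1..<k}. (\<Sum>i=1..j. Z i \<omega>) \<noteq> 0) \<and> (\<Sum>i=1..k. Z i \<omega>) = 0 \<and> (\<Sum>i=Suc k..n. Z i \<omega>) = 0}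
     = prob {\<omega> \<in> space M. (\<forall>j\<in>{1..<k}. (\<Sum>i=1..j. Z i \<omega>) \<noteq> 0) \<and> (\<Sum>i=1..k. Z i \<omega>) = 0} * prob {\<omega> \<in> space M. (\<Sum>i=Suc k..n. Z i \<omega>) = 0}"
proof -
  let ?A = "{1..k}" and ?B = "{Suc k..n}"
  let ?Y1 = "\<lambda>f :: nat \<Rightarrow> real. (\<forall>j\<in>{1..<k}. (\<Sum>i=1..j. f i) \<noteq> 0) \<and> (\<Sum>i=1..k. f i) = 0"
  let ?Y2 = "\<lambda>f :: nat \<Rightarrow> real. (\<Sum>i\<in>?B. f i) = 0"
  have s: "(\<lambda>f :: nat \<Rightarrow> real. \<Sum>i\<in>C. f i) \<in> borel_measurable (PiM D (\<lambda>_. borel))" if "C \<subseteq> D" for C D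
    by (intro borel_measurable_sum measurable_component_singleton) (use that in auto)
  have s0: "(\<lambda>f :: nat \<Rightarrow> real. (\<Sum>i\<in>C. f i) = 0) \<in> measurable (PiM D (\<lambda>_. borel)) (count_space UNIV)" if "C \<subseteq> D" for C D
  proof -
    note s[OF that, measurable]
    show ?thesis by measurable
  qed
  have m1: "?Y1 \<in> measurable (PiM ?A (\<lambda>_. borel)) (count_space UNIV)"
    by (intro pred_intros_logic pred_intros_finite s0) auto
  have m2: "?Y2 \<in> measurable (PiM ?B (\<lambda>_. borel)) (count_space UNIV)"
    by (rule s0) auto
  have "indep_var (PiM ?A (\<lambda>_. borel)) (\<lambda>\<omega>. restrict (\<lambda>i. Z i \<omega>) ?A) (PiM ?B (\<lambda>_. borel)) (\<lambda>\<omega>. restrict (\<lambda>i. Z i \<omega>) ?B)"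
    by (rule indep_var_restrict[OF indep]) auto
  from indep_var_compose[OF this m1 m2]
  have "indep_var (count_space UNIV) (\<lambda>\<omega>. ?Y1 (restrict (\<lambda>i. Z i \<omega>) ?A)) (count_space UNIV) (\<lambda>\<omega>. ?Y2 (restrict (\<lambda>i. Z i \<omega>) ?B))"
    by (simp add: o_def)
  also have "(\<lambda>\<omega>. ?Y1 (restrict (\<lambda>i. Z i \<omega>) ?A)) = (\<lambda>\<omega>. ?Y1 (\<lambda>i. Z i \<omega>))"
    by (intro ext) (auto intro!: sum.cong)
  also have "(\<lambda>\<omega>. ?Y2 (restrict (\<lambda>i. Z i \<omega>) ?B)) = (\<lambda>\<omega>. ?Y2 (\<lambda>i. Z i \<omega>))"
    by (intro ext) (auto intro!: sum.cong)
  finally have "indep_var (count_space UNIV) (\<lambda>\<omega>. ?Y1 (\<lambda>i. Z i \<omega>)) (count_space UNIV) (\<lambda>\<omega>. ?Y2 (\<lambda>i. Z i \<omega>))" .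
  from indep_varD[OF this, of "{True}" "{True}"] show ?thesis
    by (simp add: vimage_def Int_def conj_commute conj_left_commute cong: conj_cong)
qed

end

text \<open>A finite infimum in \<open>enat\<close> is attained: the empty set has infimum
  \<infinity>, and a nonempty set of extended naturals has a least element. This turns the hitting
  time into finitely many conditions on partial sums.\<close>

lemma hit_time_eq_iff:
  "hit_time X 0 \<omega> = enat k \<longleftrightarrow> k \<ge> 1 \<and> (\<forall>j\<in>{1..<k}. walk X 0 j \<omega> \<noteq> 0) \<and> walk X 0 k \<omega> = 0"
proof -
  let ?S = "{enat k | k. k \<ge> 1 \<and> walk X 0 k \<omega> = 0}"
  show ?thesis
  proof
    assume h: "hit_time X 0 \<omega> = enat k"
    then have "?S \<noteq> {}" unfolding hit_time_def by (intro notI) (simp only: Inf_enat_def, simp)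
    then have "Inf ?S \<in> ?S" by (metis (no_types, lifting) Inf_enat_def LeastI_ex ex_in_conv)
    with h have k: "k \<ge> 1" "walk X 0 k \<omega> = 0" unfolding hit_time_def by auto
    have "walk X 0 j \<omega> \<noteq> 0" if "j \<in> {1..<k}" for j
    proof
      assume "walk X 0 j \<omega> = 0"
      then have "Inf ?S \<le> enat j" using that by (intro Inf_lower) auto
      then show False using h that unfolding hit_time_def by simp
    qed
    with k show "k \<ge> 1 \<and> (\<forall>j\<in>{1..<k}. walk X 0 j \<omega> \<noteq> 0) \<and> walk X 0 k \<omega> = 0" by blast
  next
    assume k: "k \<ge> 1 \<and> (\<forall>j\<in>{1..<k}. walk X 0 j \<omega> \<noteq> 0) \<and> walk X 0 k \<omega> = 0"
    show "hit_time X 0 \<omega> = enat k" unfolding hit_time_def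
    proof (rule antisym)
      show "Inf ?S \<le> enat k" using k by (intro Inf_lower) auto
      show "enat k \<le> Inf ?S"
      proof (rule Inf_greatest)
        fix x assume "x \<in> ?S"
        then obtain j where "x = enat j" "j \<ge> 1" "walk X 0 j \<omega> = 0" by auto
        with k show "enat k \<le> x" by (cases "j < k") auto
      qed
    qed
  qed
qed

theorem theorem1:
  fixes M :: "'a measure" and X :: "nat \<Rightarrow> 'a \<Rightarrow> int"
    and \<alpha> \<gamma> c :: real and \<phi> :: "real \<Rightarrow> complex"
  assumes "prob_space M"
    and indep: "prob_space.indep_vars M (\<lambda>_. count_space UNIV) X {1..}"
    and ident: "\<And>i. i \<ge> 1 \<Longrightarrow>
          distr M (count_space UNIV) (X i) = distr M (count_space UNIV) (X 1)"
    and alpha: "1 < \<alpha>" "\<alpha> < 2"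
    and gamma: "\<bar>\<gamma>\<bar> \<le> 2 - \<alpha>"
    and c: "c > 0"
    and phi: "\<And>\<theta>. \<phi> \<theta> = char (distr M borel (\<lambda>\<omega>. real_of_int (X 1 \<omega>))) \<theta>"
    and phi_right: "((\<lambda>\<theta>. (1 - \<phi> \<theta>) / complex_of_real (\<bar>\<theta>\<bar> powr \<alpha>)) \<longlongrightarrow>
          complex_of_real c * exp (\<i> * complex_of_real (pi * \<gamma> / 2))) (at_right 0)"
    and phi_left: "((\<lambda>\<theta>. (1 - \<phi> \<theta>) / complex_of_real (\<bar>\<theta>\<bar> powr \<alpha>)) \<longlongrightarrow>
          complex_of_real c * exp (- \<i> * complex_of_real (pi * \<gamma> / 2))) (at_left 0)"
    and aperiodic: "\<And>x :: int. eventually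
          (\<lambda>n. measure M {\<omega> \<in> space M. walk X 0 n \<omega> = x} > 0) sequentially"
  shows "(\<lambda>n. hit_prob M X 0 n) \<sim>[sequentially]
           (\<lambda>n. kappa \<alpha> \<gamma> * c powr (1 / \<alpha>) / real n powr (2 - 1 / \<alpha>))"
proof -
  interpret prob_space M by fact
  \<comment> \<open>Real-valued copy of the increments, to which the product formula for
    characteristic functions of independent sums applies.\<close>
  define Z where "Z = (\<lambda>i \<omega>. real_of_int (X i \<omega>))"
  have X_meas: "X i \<in> measurable M (count_space UNIV)" if "i \<ge> 1" for i
    using indep that unfolding indep_vars_def by auto
  have Z_meas: "Z i \<in> borel_measurable M" if "i \<ge> 1" for i
    unfolding Z_def by (rule measurable_compose[OF X_meas[OF that]]) simp
  have indep_Z: "indep_vars (\<lambda>_. borel) Z {1..}"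
    unfolding Z_def by (rule indep_vars_compose2[OF indep]) simp
  have char_Z: "char (distr M borel (Z i)) \<theta> = \<phi> \<theta>" if "i \<ge> 1" for i \<theta>
  proof -
    have "distr M borel (Z i) = distr (distr M (count_space UNIV) (X i)) borel real_of_int" if "i \<ge> 1" for i
      unfolding Z_def by (subst distr_distr) (use X_meas[OF that] in \<open>auto simp: o_def\<close>)
    from this[OF that] this[of 1] ident[OF that] show ?thesis
      unfolding phi by (simp add: Z_def)
  qed
  have char_sum: "char (distr M borel (\<lambda>\<omega>. real_of_int (\<Sum>i\<in>A. X i \<omega>))) \<theta> = \<phi> \<theta> ^ card A" if "A \<subseteq> {1..}" for A \<theta>
  proof -
    have "char (distr M borel (\<lambda>\<omega>. \<Sum>i\<in>A. Z i \<omega>)) \<theta> = (\<Prod>i\<in>A. char (distr M borel (Z i)) \<theta>)"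
      by (rule char_distr_sum[OF indep_vars_subset[OF indep_Z that]])
    also have "\<dots> = (\<Prod>i\<in>A. \<phi> \<theta>)" by (intro prod.cong refl char_Z) (use that in auto)
    finally show ?thesis by (simp add: Z_def)
  qed
  have sum_meas: "(\<lambda>\<omega>. real_of_int (\<Sum>i\<in>A. X i \<omega>)) \<in> borel_measurable M" if "A \<subseteq> {1..}" for A
    unfolding of_int_sum using Z_meas that unfolding Z_def by (intro borel_measurable_sum) auto
  interpret R: real_distribution "distr M borel (Z 1)"
    unfolding real_distribution_def real_distribution_axioms_def using Z_meas[of 1] by (auto intro: prob_space_distr)
  have phi_char: "\<phi> = char (distr M borel (Z 1))" using char_Z[of 1] by auto
  have walk_eq: "walk X 0 n \<omega> = (\<Sum>i=1..n. X i \<omega>)" for n \<omega> by (simp add: walk_def)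
  interpret stable_char \<phi> \<alpha> \<gamma> c
  proof
    show "continuous_on UNIV \<phi>" unfolding phi_char
      by (intro continuous_at_imp_continuous_on ballI R.isCont_char)
    show "\<phi> 0 = 1" unfolding phi_char by (rule R.char_zero)
    show le1: "norm (\<phi> \<theta>) \<le> 1" for \<theta> unfolding phi_char by (rule R.cmod_char_le_1)
    show "norm (\<phi> \<theta>) < 1" if \<theta>: "0 < \<bar>\<theta>\<bar>" "\<bar>\<theta>\<bar> \<le> pi" for \<theta>
    proof -
      \<comment> \<open>Strong aperiodicity supplies one n for which S_n takes both values 0 and 1
        with positive probability. Hence |\<phi>|^n, and so |\<phi>|, differs from 1 at the given
        \<theta>.\<close>
      have "\<forall>\<^sub>F n in sequentially. prob {\<omega> \<in> space M. walk X 0 n \<omega> = 0} > 0 \<and> prob {\<omega> \<in> space M. walk X 0 n \<omega> = 1} > 0"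
        by (intro eventually_conj aperiodic)
      then obtain n where n: "prob {\<omega> \<in> space M. walk X 0 n \<omega> = 0} > 0" "prob {\<omega> \<in> space M. walk X 0 n \<omega> = 1} > 0"
        using eventually_happens'[OF sequentially_bot] by blast
      have "norm (char (distr M borel (\<lambda>\<omega>. real_of_int (\<Sum>i=1..n. X i \<omega>))) \<theta>) \<noteq> 1"
        by (rule norm_char_neq_1[OF sum_meas _ _ \<theta>]) (use n in \<open>auto simp: walk_eq\<close>)
      moreover have "char (distr M borel (\<lambda>\<omega>. real_of_int (\<Sum>i=1..n. X i \<omega>))) \<theta> = \<phi> \<theta> ^ n"
        by (subst char_sum) auto
      ultimately have "norm (\<phi> \<theta>) ^ n \<noteq> 1" by (simp add: norm_power)
      then have "norm (\<phi> \<theta>) \<noteq> 1" by auto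
      with le1[of \<theta>] show ?thesis by linarith
    qed
    show "((\<lambda>\<theta>. (1 - \<phi> \<theta>) / complex_of_real (\<bar>\<theta>\<bar> powr \<alpha>)) \<longlongrightarrow> of_real c * cis (pi * \<gamma> / 2)) (at_right 0)"
      using phi_right by (simp add: cis_conv_exp)
    show "((\<lambda>\<theta>. (1 - \<phi> \<theta>) / complex_of_real (\<bar>\<theta>\<bar> powr \<alpha>)) \<longlongrightarrow> of_real c * cis (- (pi * \<gamma> / 2))) (at_left 0)"
      using phi_left by (simp add: cis_conv_exp)
  qed fact+
  have char_power_int_prob: "char_power_int (card A) = of_real (2 * pi * prob {\<omega> \<in> space M. (\<Sum>i\<in>A. X i \<omega>) = 0})" if "A \<subseteq> {1..}" for A
    using fourier_inversion_int[OF sum_meas[OF that]] unfolding char_sum[OF that] char_power_int_def .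
  define u where "u = (\<lambda>n. prob {\<omega> \<in> space M. (\<Sum>i=1..n. X i \<omega>) = 0})"
  \<comment> \<open>Both probabilities are given by the same Fourier integral, which depends only on
    the number of summands in the block; identical distribution thus yields stationarity without
    comparing joint laws.\<close>
  have u_shift: "prob {\<omega> \<in> space M. (\<Sum>i=Suc k..n. X i \<omega>) = 0} = u (n - k)" for k n
  proof -
    have "of_real (2 * pi * prob {\<omega> \<in> space M. (\<Sum>i=Suc k..n. X i \<omega>) = 0}) = (of_real (2 * pi * u (n - k)) :: complex)"
      unfolding u_def using char_power_int_prob[of "{Suc k..n}"] char_power_int_prob[of "{1..n-k}"] by simp
    then show ?thesis by (simp only: of_real_eq_iff) simp
  qed
  let ?E = "\<lambda>k. {\<omega> \<in> space M. (\<forall>j\<in>{1..<k}. (\<Sum>i=1..j. Z i \<omega>) \<noteq> 0) \<and> (\<Sum>i=1..k. Z i \<omega>) = 0}"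
  have Z_sum_0: "(\<Sum>i\<in>A. Z i \<omega>) = 0 \<longleftrightarrow> (\<Sum>i\<in>A. X i \<omega>) = 0" for A \<omega>
    unfolding Z_def of_int_sum[symmetric] by (rule of_int_eq_0_iff)
  have hit: "hit_prob M X 0 k = prob (?E k)" if "k \<ge> 1" for k
    unfolding hit_prob_def hit_time_eq_iff walk_eq Z_sum_0 using that by simp
  have hit_0: "hit_prob M X 0 0 = 0"
    unfolding hit_prob_def hit_time_eq_iff by simp
  have renewal: "u n = (\<Sum>k\<le>n. hit_prob M X 0 k * u (n - k))" if n: "n \<ge> 1" for n
  proof -
    let ?G = "\<lambda>k. {\<omega> \<in> space M. (\<forall>j\<in>{1..<k}. (\<Sum>i=1..j. Z i \<omega>) \<noteq> 0) \<and> (\<Sum>i=1..k. Z i \<omega>) = 0 \<and> (\<Sum>i=Suc k..n. Z i \<omega>) = 0}"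
    have split: "(\<Sum>i=1..n. Z i \<omega>) = (\<Sum>i=1..k. Z i \<omega>) + (\<Sum>i=Suc k..n. Z i \<omega>)" if "k \<le> n" for k \<omega>
      using sum.ub_add_nat[of 1 k "\<lambda>i. Z i \<omega>" "n - k"] that by simp
    have Z_sum: "{\<omega> \<in> space M. (\<Sum>i\<in>A. Z i \<omega>) = 0} \<in> events" if "A \<subseteq> {1..}" for A
    proof -
      have [measurable]: "(\<lambda>\<omega>. \<Sum>i\<in>A. Z i \<omega>) \<in> borel_measurable M"
        using Z_meas that by (intro borel_measurable_sum) auto
      show ?thesis by measurable
    qed
    have G_events: "?G k \<in> events" for k
      by (intro sets.sets_Collect_conj sets.sets_Collect_finite_All sets.sets_Collect_neg Z_sum) auto
    \<comment> \<open>A return at time n is split by the time k of the first return, obtained as a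
      least index; the increments after k then sum to 0.\<close>
    have "{\<omega> \<in> space M. (\<Sum>i=1..n. Z i \<omega>) = 0} = (\<Union>k\<in>{1..n}. ?G k)"
    proof (intro subset_antisym subsetI)
      fix \<omega> assume w: "\<omega> \<in> {\<omega> \<in> space M. (\<Sum>i=1..n. Z i \<omega>) = 0}"
      define k where "k = (LEAST k. k \<ge> 1 \<and> (\<Sum>i=1..k. Z i \<omega>) = 0)"
      have k: "k \<ge> 1 \<and> (\<Sum>i=1..k. Z i \<omega>) = 0"
        unfolding k_def by (rule LeastI[of _ n]) (use w n in auto)
      have kn: "k \<le> n" unfolding k_def by (rule Least_le) (use w n in auto)
      have "(\<Sum>i=1..j. Z i \<omega>) \<noteq> 0" if "j \<in> {1..<k}" for j
        using not_less_Least[of j "\<lambda>k. k \<ge> 1 \<and> (\<Sum>i=1..k. Z i \<omega>) = 0"] that unfolding k_def[symmetric] by auto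
      then show "\<omega> \<in> (\<Union>k\<in>{1..n}. ?G k)" using k kn w split[OF kn, of \<omega>] by (auto intro!: bexI[of _ k])
    next
      fix \<omega> assume "\<omega> \<in> (\<Union>k\<in>{1..n}. ?G k)"
      then show "\<omega> \<in> {\<omega> \<in> space M. (\<Sum>i=1..n. Z i \<omega>) = 0}" using split by auto
    qed
    then have "u n = prob (\<Union>k\<in>{1..n}. ?G k)" unfolding u_def Z_sum_0[symmetric] by simp
    also have "\<dots> = (\<Sum>k\<in>{1..n}. prob (?G k))"
    proof (rule finite_measure_finite_Union)
      show "disjoint_family_on ?G {1..n}"
        unfolding disjoint_family_on_def
      proof (intro ballI impI equals0I)
        fix a b \<omega> assume ab: "a \<in> {1..n}" "b \<in> {1..n}" "a \<noteq> b" "\<omega> \<in> ?G a \<inter> ?G b"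
        then show False by (cases "a < b") auto
      qed
    qed (use G_events in auto)
    also have "\<dots> = (\<Sum>k\<in>{1..n}. hit_prob M X 0 k * u (n - k))"
    proof (intro sum.cong refl)
      fix k assume k: "k \<in> {1..n}"
      then have "prob (?G k) = prob (?E k) * prob {\<omega> \<in> space M. (\<Sum>i=Suc k..n. Z i \<omega>) = 0}"
        by (intro prob_first_return_inter indep_Z) auto
      then show "prob (?G k) = hit_prob M X 0 k * u (n - k)"
        using hit[of k] k u_shift[of k n] unfolding Z_sum_0 by simp
    qed
    \<comment> \<open>The term k = 0 completes the convolution and vanishes, because hitting times
      are at least 1.\<close>
    also have "\<dots> = (\<Sum>k\<le>n. hit_prob M X 0 k * u (n - k))"
      by (rule sum.mono_neutral_left) (auto simp: hit_0 not_le)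
    finally show ?thesis .
  qed
  have "(\<lambda>n. complex_of_real (hit_prob M X 0 n) / of_real (real n powr (1 / \<alpha> - 2))) \<longlonglongrightarrow> of_real (kappa \<alpha> \<gamma> * c powr (1 / \<alpha>))"
  proof (rule renewal_coefficients[where u = "\<lambda>n. of_real (u n)"])
    show "char_power_int n = of_real (2 * pi) * of_real (u n)" for n
      using char_power_int_prob[of "{1..n}"] by (simp add: u_def)
    show "of_real (u 0) = (1::complex)" by (simp add: u_def prob_space)
    show "of_real (hit_prob M X 0 0) = (0::complex)" by (simp add: hit_0)
    show "norm (complex_of_real (hit_prob M X 0 n)) \<le> 1" for n by (simp add: hit_prob_def)
    show "complex_of_real (u n) = (\<Sum>k\<le>n. of_real (hit_prob M X 0 k) * of_real (u (n - k)))" if "n \<ge> 1" for n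
      by (subst renewal[OF that]) simp
  qed
  then have "(\<lambda>n. complex_of_real (hit_prob M X 0 n / real n powr (1 / \<alpha> - 2))) \<longlonglongrightarrow> of_real (kappa \<alpha> \<gamma> * c powr (1 / \<alpha>))"
    by simp
  then have lim: "(\<lambda>n. hit_prob M X 0 n / real n powr (1 / \<alpha> - 2)) \<longlonglongrightarrow> kappa \<alpha> \<gamma> * c powr (1 / \<alpha>)"
    unfolding tendsto_of_real_iff .
  \<comment> \<open>A nonzero limit is what allows the passage from a limit of quotients to
    asymptotic equivalence.\<close>
  have pos: "kappa \<alpha> \<gamma> * c powr (1 / \<alpha>) > 0"
    unfolding kappa_eq using alpha c alpha_trig_pos by (intro mult_pos_pos divide_pos_pos Gamma_real_pos) auto
  show ?thesis
  proof (rule asymp_equivI')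
    have "(\<lambda>n. hit_prob M X 0 n / real n powr (1 / \<alpha> - 2) / (kappa \<alpha> \<gamma> * c powr (1 / \<alpha>))) \<longlonglongrightarrow> 1"
    proof -
      from pos have nz: "kappa \<alpha> \<gamma> * c powr (1 / \<alpha>) \<noteq> 0" by linarith
      from tendsto_divide[OF lim tendsto_const nz] show ?thesis by (simp only: divide_self[OF nz])
    qed
    moreover have "h / (K / real n powr (2 - 1 / \<alpha>)) = h / real n powr (1 / \<alpha> - 2) / K" for h K :: real and n
      using powr_minus_divide[of "real n" "1 / \<alpha> - 2"] by simp
    ultimately show "(\<lambda>n. hit_prob M X 0 n / (kappa \<alpha> \<gamma> * c powr (1 / \<alpha>) / real n powr (2 - 1 / \<alpha>))) \<longlonglongrightarrow> 1"
      by (simp only:)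
  qed
qed

end
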